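(* Let $(M,\omega)$ be a four-dimensional symplectic manifold, let $\rho_1,\rho_2\colon M\to M$ be two distinct commuting antisymplectic involutions, and let $H\colon M\to\mathbb{R}$ be a smooth function with $H\circ\rho_1=H$ and $H\circ\rho_2=H$. Let $v$ be a nondegenerate doubly symmetric periodic orbit of the Hamiltonian vector field $X_H$ (with respect to $\rho_1,\rho_2$). Then $v$ is stable if and only if its Conley-Zehnder index is odd.
   Context: Conventions. A diffeomorphism $\rho$ of $M$ is an antisymplectic involution if $\rho^2=\mathrm{id}$ and $\rho^*\omega=-\omega$. The Hamiltonian vector field $X_H$ is defined by $dH=\omega(\cdot,X_H)$, and $\phi^t_H$ denotes its flow. Put $S^1=\mathbb{R}/\mathbb{Z}$. A simple periodic orbit is an injective map $v\colon S^1\to M$ for which there is $\tau>0$ (its period) with $\partial_t v(t)=\tau X_H(v(t))$ for all $t\in S^1$. Doubly symmetric orbits. A simple periodic orbit $v$ is symmetric with respect to $\rho_1$ if $\rho_1(v(-t))=v(t)$ for all $t\in S^1$. It is doubly symmetric (with respect to $\rho_1,\rho_2$) if it is symmetric with respect to $\rho_1$ and in addition $\rho_2(v(0))=v(\tfrac12)$. Reduced monodromy. Let $c=H(v(0))$ and $\Sigma=H^{-1}(c)$, which is a hypersurface near $v$. The linear map $d\phi^\tau_H(v(0))$ preserves $T_{v(0)}\Sigma$ and fixes $X_H(v(0))$. The induced map $M_v$ on the two-dimensional symplectic vector space $T_{v(0)}\Sigma/\langle X_H(v(0))\rangle$ is the reduced monodromy; $\det M_v=1$. The orbit $v$ is positive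 hyperbolic if $\mathrm{tr}(M_v)>2$, negative hyperbolic if $\mathrm{tr}(M_v)<-2$, and elliptic if $-2\le\mathrm{tr}(M_v)\le 2$. It is nondegenerate if $1$ is not an eigenvalue of $M_v$, i.e. $\mathrm{tr}(M_v)\ne 2$. Stability and index. "Stable" means elliptic (hyperbolic orbits are unstable). The Conley-Zehnder index of a nondegenerate $v$ is the usual Conley-Zehnder index of the path in $SL(2;\mathbb{R})$ obtained from the linearized flow, induced on $T\Sigma/\langle X_H\rangle$ along $v$ over one period, in a symplectic trivialization of this bundle along $v$; its parity is independent of the trivialization. It is a standard fact that elliptic and negative hyperbolic nondegenerate orbits have odd Conley-Zehnder index and positive hyperbolic orbits have even Conley-Zehnder index. *)

theory Defs
  imports "HOL-Analysis.Analysis"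
begin

section \<open>Smooth maps between open subsets of Euclidean spaces\<close>

text \<open>Intended for open sets only: \<open>C\<^sup>k\<close> by recursion on partial derivatives.\<close>

primrec Ck_on :: "nat \<Rightarrow> 'a::euclidean_space set \<Rightarrow> ('a \<Rightarrow> 'b::real_normed_vector) \<Rightarrow> bool" where
  "Ck_on 0 U f \<longleftrightarrow> continuous_on U f"
| "Ck_on (Suc k) U f \<longleftrightarrow>
     f differentiable_on U \<and> (\<forall>b\<in>Basis. Ck_on k U (\<lambda>x. frechet_derivative f (at x) b))"

definition smooth_on :: "'a::euclidean_space set \<Rightarrow> ('a \<Rightarrow> 'b::real_normed_vector) \<Rightarrow> bool" where
  "smooth_on U f \<longleftrightarrow> (\<forall>k. Ck_on k U f)"


section \<open>Smooth four-manifolds\<close>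

text \<open>
  The manifold is the whole type \<open>'a\<close>, a second countable Hausdorff space, with a smooth atlas.
  A chart is a pair of its domain and a map that is meaningful on that domain only.
\<close>

type_synonym 'a chart = "'a set \<times> ('a \<Rightarrow> real^4)"

abbreviation chart_dom :: "'a chart \<Rightarrow> 'a set" where
  "chart_dom c \<equiv> fst c"

abbreviation chart_map :: "'a chart \<Rightarrow> 'a \<Rightarrow> real^4" where
  "chart_map c \<equiv> snd c"

definition chart_inv :: "'a chart \<Rightarrow> real^4 \<Rightarrow> 'a" where
  "chart_inv c = inv_into (chart_dom c) (chart_map c)"

definition chart_image :: "'a chart \<Rightarrow> (real^4) set" where
  "chart_image c = chart_map c ` chart_dom c"

definition smooth_atlas :: "'a::{t2_space,second_countable_topology} chart set \<Rightarrow> bool" where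
  "smooth_atlas A \<longleftrightarrow>
     (\<Union>c\<in>A. chart_dom c) = UNIV \<and>
     (\<forall>c\<in>A. open (chart_dom c) \<and> open (chart_image c) \<and>
            homeomorphism (chart_dom c) (chart_image c) (chart_map c) (chart_inv c)) \<and>
     (\<forall>c\<in>A. \<forall>d\<in>A. smooth_on (chart_map c ` (chart_dom c \<inter> chart_dom d))
                             (chart_map d \<circ> chart_inv c))"

text \<open>
  Every point gets a preferred chart around it, and the tangent space at \<open>p\<close> is the model
  space \<open>real^4\<close>, read as coordinate vectors in the preferred chart at \<open>p\<close>. Since the preferred
  chart may jump with \<open>p\<close>, continuity and smoothness of objects on the tangent bundle are
  always expressed in the fixed charts of the atlas, using the two transformation maps below.
\<close>

definition chart_at :: "'a chart set \<Rightarrow> 'a \<Rightarrow> 'a chart" where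
  "chart_at A p = (SOME c. c \<in> A \<and> p \<in> chart_dom c)"

text \<open>From the tangent space at \<open>p\<close> to coordinates in the chart \<open>c\<close>.\<close>

definition to_chart :: "'a chart set \<Rightarrow> 'a chart \<Rightarrow> 'a \<Rightarrow> real^4 \<Rightarrow> real^4" where
  "to_chart A c p =
     frechet_derivative (chart_map c \<circ> chart_inv (chart_at A p)) (at (chart_map (chart_at A p) p))"

text \<open>From coordinates in the chart \<open>c\<close> to the tangent space at the point with coordinates \<open>x\<close>.\<close>

definition from_chart :: "'a chart set \<Rightarrow> 'a chart \<Rightarrow> real^4 \<Rightarrow> real^4 \<Rightarrow> real^4" where
  "from_chart A c x =
     frechet_derivative (chart_map (chart_at A (chart_inv c x)) \<circ> chart_inv c) (at x)"

definition smooth_function :: "'a::topological_space chart set \<Rightarrow> ('a \<Rightarrow> real) \<Rightarrow> bool" where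
  "smooth_function A f \<longleftrightarrow> (\<forall>c\<in>A. smooth_on (chart_image c) (f \<circ> chart_inv c))"

definition smooth_map :: "'a::topological_space chart set \<Rightarrow> ('a \<Rightarrow> 'a) \<Rightarrow> bool" where
  "smooth_map A f \<longleftrightarrow> continuous_on UNIV f \<and>
     (\<forall>c\<in>A. \<forall>d\<in>A. smooth_on (chart_map c ` (chart_dom c \<inter> f -` chart_dom d))
                             (chart_map d \<circ> f \<circ> chart_inv c))"

definition diffeomorphism :: "'a::topological_space chart set \<Rightarrow> ('a \<Rightarrow> 'a) \<Rightarrow> bool" where
  "diffeomorphism A f \<longleftrightarrow> bij f \<and> smooth_map A f \<and> smooth_map A (inv f)"

definition differential :: "'a chart set \<Rightarrow> ('a \<Rightarrow> real) \<Rightarrow> 'a \<Rightarrow> real^4 \<Rightarrow> real" where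
  "differential A f p =
     frechet_derivative (f \<circ> chart_inv (chart_at A p)) (at (chart_map (chart_at A p) p))"

text \<open>
  The tangent map from the tangent space at \<open>p\<close> to the one at \<open>f p\<close>; it depends only on \<open>f\<close>
  near \<open>p\<close>, so it also applies to maps that are meaningful only in a neighbourhood of \<open>p\<close>.
\<close>

definition tangent_map :: "'a chart set \<Rightarrow> ('a \<Rightarrow> 'a) \<Rightarrow> 'a \<Rightarrow> real^4 \<Rightarrow> real^4" where
  "tangent_map A f p =
     frechet_derivative (chart_map (chart_at A (f p)) \<circ> f \<circ> chart_inv (chart_at A p))
       (at (chart_map (chart_at A p) p))"

definition has_velocity ::
  "'a::topological_space chart set \<Rightarrow> (real \<Rightarrow> 'a) \<Rightarrow> real^4 \<Rightarrow> real \<Rightarrow> bool" where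
  "has_velocity A \<gamma> \<xi> t \<longleftrightarrow> isCont \<gamma> t \<and>
     ((chart_map (chart_at A (\<gamma> t)) \<circ> \<gamma>) has_vector_derivative \<xi>) (at t)"


section \<open>Symplectic forms and Hamiltonian dynamics\<close>

type_synonym 'a two_form = "'a \<Rightarrow> real^4 \<Rightarrow> real^4 \<Rightarrow> real"

definition form_coeff ::
  "'a chart set \<Rightarrow> 'a two_form \<Rightarrow> 'a chart \<Rightarrow> 4 \<Rightarrow> 4 \<Rightarrow> real^4 \<Rightarrow> real" where
  "form_coeff A \<omega> c i j x =
     \<omega> (chart_inv c x) (from_chart A c x (axis i 1)) (from_chart A c x (axis j 1))"

definition partial_deriv :: "4 \<Rightarrow> (real^4 \<Rightarrow> real) \<Rightarrow> real^4 \<Rightarrow> real" where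
  "partial_deriv i f x = frechet_derivative f (at x) (axis i 1)"

definition symplectic_form ::
  "'a::topological_space chart set \<Rightarrow> 'a two_form \<Rightarrow> bool" where
  "symplectic_form A \<omega> \<longleftrightarrow>
     (\<forall>p. bilinear (\<omega> p)) \<and>
     (\<forall>p \<xi>. \<omega> p \<xi> \<xi> = 0) \<and>
     (\<forall>p \<xi>. (\<forall>\<eta>. \<omega> p \<xi> \<eta> = 0) \<longrightarrow> \<xi> = 0) \<and>
     (\<forall>c\<in>A. \<forall>i j. smooth_on (chart_image c) (form_coeff A \<omega> c i j)) \<and>
     (\<forall>c\<in>A. \<forall>x\<in>chart_image c. \<forall>i j k.
        partial_deriv i (form_coeff A \<omega> c j k) x +
        partial_deriv j (form_coeff A \<omega> c k i) x +
        partial_deriv k (form_coeff A \<omega> c i j) x = 0)"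

definition symplectic_manifold ::
  "'a::{t2_space,second_countable_topology} chart set \<Rightarrow> 'a two_form \<Rightarrow> bool" where
  "symplectic_manifold A \<omega> \<longleftrightarrow> smooth_atlas A \<and> symplectic_form A \<omega>"

definition antisymplectic_involution ::
  "'a::topological_space chart set \<Rightarrow> 'a two_form \<Rightarrow> ('a \<Rightarrow> 'a) \<Rightarrow> bool" where
  "antisymplectic_involution A \<omega> \<rho> \<longleftrightarrow>
     diffeomorphism A \<rho> \<and> \<rho> \<circ> \<rho> = id \<and>
     (\<forall>p \<xi> \<eta>. \<omega> (\<rho> p) (tangent_map A \<rho> p \<xi>) (tangent_map A \<rho> p \<eta>) = - \<omega> p \<xi> \<eta>)"

definition ham_field ::
  "'a chart set \<Rightarrow> 'a two_form \<Rightarrow> ('a \<Rightarrow> real) \<Rightarrow> 'a \<Rightarrow> real^4" where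
  "ham_field A \<omega> H p = (THE \<xi>. \<forall>\<eta>. differential A H p \<eta> = \<omega> p \<eta> \<xi>)"

text \<open>
  The Hamiltonian field need not be complete: \<open>ham_flow A \<omega> H t p\<close> is meaningful whenever
  the integral curve starting at \<open>p\<close> exists up to time \<open>t\<close>.
\<close>

definition ham_flow ::
  "'a::topological_space chart set \<Rightarrow> 'a two_form \<Rightarrow> ('a \<Rightarrow> real) \<Rightarrow> real \<Rightarrow> 'a \<Rightarrow> 'a" where
  "ham_flow A \<omega> H t p =
     (THE q. \<exists>\<gamma> J. open J \<and> is_interval J \<and> {0, t} \<subseteq> J \<and> \<gamma> 0 = p \<and> \<gamma> t = q \<and>
        (\<forall>s\<in>J. has_velocity A \<gamma> (ham_field A \<omega> H (\<gamma> s)) s))"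


section \<open>Periodic orbits\<close>

text \<open>Maps on \<open>\<real>/\<int>\<close> are represented by functions on the reals of period one.\<close>

definition simple_periodic_orbit ::
  "'a::topological_space chart set \<Rightarrow> 'a two_form \<Rightarrow> ('a \<Rightarrow> real) \<Rightarrow> real \<Rightarrow> (real \<Rightarrow> 'a) \<Rightarrow> bool"
where
  "simple_periodic_orbit A \<omega> H \<tau> v \<longleftrightarrow>
     \<tau> > 0 \<and> (\<forall>t. v (t + 1) = v t) \<and> inj_on v {0..<1} \<and>
     (\<forall>t. has_velocity A v (\<tau> *\<^sub>R ham_field A \<omega> H (v t)) t)"

definition symmetric_orbit :: "('a \<Rightarrow> 'a) \<Rightarrow> (real \<Rightarrow> 'a) \<Rightarrow> bool" where
  "symmetric_orbit \<rho> v \<longleftrightarrow> (\<forall>t. \<rho> (v (- t)) = v t)"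

definition doubly_symmetric :: "('a \<Rightarrow> 'a) \<Rightarrow> ('a \<Rightarrow> 'a) \<Rightarrow> (real \<Rightarrow> 'a) \<Rightarrow> bool" where
  "doubly_symmetric \<rho>\<^sub>1 \<rho>\<^sub>2 v \<longleftrightarrow> symmetric_orbit \<rho>\<^sub>1 v \<and> \<rho>\<^sub>2 (v 0) = v (1/2)"


section \<open>Reduced linearized flow\<close>

text \<open>
  The tangent space at \<open>p\<close> of the level set of \<open>H\<close> through \<open>p\<close>, for a regular point \<open>p\<close>. All
  points of a simple periodic orbit are regular, because the Hamiltonian field cannot vanish
  on an injective orbit.
\<close>

definition level_tangent :: "'a chart set \<Rightarrow> ('a \<Rightarrow> real) \<Rightarrow> 'a \<Rightarrow> (real^4) set" where
  "level_tangent A H p = {\<xi>. differential A H p \<xi> = 0}"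

abbreviation ham_line ::
  "'a chart set \<Rightarrow> 'a two_form \<Rightarrow> ('a \<Rightarrow> real) \<Rightarrow> 'a \<Rightarrow> (real^4) set" where
  "ham_line A \<omega> H p \<equiv> span {ham_field A \<omega> H p}"

text \<open>
  The quotient of \<open>level_tangent\<close> by \<open>ham_line\<close> is handled through representatives. The pair
  \<open>(e $ 1, e $ 2)\<close> represents a symplectic basis of this two-dimensional symplectic space.
\<close>

definition reduced_symplectic_basis ::
  "'a chart set \<Rightarrow> 'a two_form \<Rightarrow> ('a \<Rightarrow> real) \<Rightarrow> 'a \<Rightarrow> real^4^2 \<Rightarrow> bool" where
  "reduced_symplectic_basis A \<omega> H p e \<longleftrightarrow>
     e $ 1 \<in> level_tangent A H p \<and> e $ 2 \<in> level_tangent A H p \<and> \<omega> p (e $ 1) (e $ 2) = 1"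

text \<open>
  The matrix, with respect to the bases represented by \<open>e\<close> and \<open>e'\<close>, of the map that \<open>L\<close>
  induces into a quotient by the subspace \<open>N'\<close>; the columns are the images of the basis vectors.
\<close>

definition induced_matrix ::
  "(real^4 \<Rightarrow> real^4) \<Rightarrow> (real^4) set \<Rightarrow> real^4^2 \<Rightarrow> real^4^2 \<Rightarrow> real^2^2" where
  "induced_matrix L N' e e' =
     (THE B. \<forall>j. L (e $ j) - (\<Sum>i\<in>UNIV. (B $ i $ j) *\<^sub>R (e' $ i)) \<in> N')"

definition monodromy ::
  "'a::topological_space chart set \<Rightarrow> 'a two_form \<Rightarrow> ('a \<Rightarrow> real) \<Rightarrow> real \<Rightarrow> (real \<Rightarrow> 'a) \<Rightarrow>
     real^4 \<Rightarrow> real^4" where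
  "monodromy A \<omega> H \<tau> v = tangent_map A (ham_flow A \<omega> H \<tau>) (v 0)"

text \<open>The trace of the reduced monodromy; it does not depend on the basis.\<close>

definition reduced_trace ::
  "'a::topological_space chart set \<Rightarrow> 'a two_form \<Rightarrow> ('a \<Rightarrow> real) \<Rightarrow> real \<Rightarrow> (real \<Rightarrow> 'a) \<Rightarrow> real"
where
  "reduced_trace A \<omega> H \<tau> v =
     (THE r. \<forall>e. reduced_symplectic_basis A \<omega> H (v 0) e \<longrightarrow>
        trace (induced_matrix (monodromy A \<omega> H \<tau> v) (ham_line A \<omega> H (v 0)) e e) = r)"

definition elliptic ::
  "'a::topological_space chart set \<Rightarrow> 'a two_form \<Rightarrow> ('a \<Rightarrow> real) \<Rightarrow> real \<Rightarrow> (real \<Rightarrow> 'a) \<Rightarrow> bool"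
where
  "elliptic A \<omega> H \<tau> v \<longleftrightarrow> - 2 \<le> reduced_trace A \<omega> H \<tau> v \<and> reduced_trace A \<omega> H \<tau> v \<le> 2"

abbreviation (input) stable ::
  "'a::topological_space chart set \<Rightarrow> 'a two_form \<Rightarrow> ('a \<Rightarrow> real) \<Rightarrow> real \<Rightarrow> (real \<Rightarrow> 'a) \<Rightarrow> bool"
where
  "stable \<equiv> elliptic"

text \<open>The number 1 is not an eigenvalue of the reduced monodromy.\<close>

definition nondegenerate ::
  "'a::topological_space chart set \<Rightarrow> 'a two_form \<Rightarrow> ('a \<Rightarrow> real) \<Rightarrow> real \<Rightarrow> (real \<Rightarrow> 'a) \<Rightarrow> bool"
where
  "nondegenerate A \<omega> H \<tau> v \<longleftrightarrow>
     \<not> (\<exists>\<xi>\<in>level_tangent A H (v 0). \<xi> \<notin> ham_line A \<omega> H (v 0) \<and>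
           monodromy A \<omega> H \<tau> v \<xi> - \<xi> \<in> ham_line A \<omega> H (v 0))"


section \<open>The Conley-Zehnder index\<close>

text \<open>
  A symplectic trivialization along \<open>v\<close> of the quotient bundle, given by continuous
  representatives. Every continuous frame of the quotient bundle has such representatives,
  since the quotient map of vector bundles over the circle has a continuous linear section.
\<close>

definition symplectic_trivialization ::
  "'a::topological_space chart set \<Rightarrow> 'a two_form \<Rightarrow> ('a \<Rightarrow> real) \<Rightarrow> (real \<Rightarrow> 'a) \<Rightarrow>
     (real \<Rightarrow> real^4^2) \<Rightarrow> bool" where
  "symplectic_trivialization A \<omega> H v F \<longleftrightarrow>
     (\<forall>t. F (t + 1) = F t) \<and>
     (\<forall>t. reduced_symplectic_basis A \<omega> H (v t) (F t)) \<and>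
     (\<forall>c\<in>A. \<forall>i. continuous_on {t. v t \<in> chart_dom c} (\<lambda>t. to_chart A c (v t) (F t $ i)))"

text \<open>The linearized flow over one period, as a path of \<open>2 \<times> 2\<close> matrices of determinant one.\<close>

definition linearized_path ::
  "'a::topological_space chart set \<Rightarrow> 'a two_form \<Rightarrow> ('a \<Rightarrow> real) \<Rightarrow> real \<Rightarrow> (real \<Rightarrow> 'a) \<Rightarrow>
     (real \<Rightarrow> real^4^2) \<Rightarrow> real \<Rightarrow> real^2^2" where
  "linearized_path A \<omega> H \<tau> v F t =
     induced_matrix (tangent_map A (ham_flow A \<omega> H (\<tau> * t)) (v 0))
       (ham_line A \<omega> H (v t)) (F 0) (F t)"

definition SL2_star :: "(real^2^2) set" where
  "SL2_star = {B. det B = 1 \<and> det (mat 1 - B) \<noteq> 0}"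

text \<open>
  For \<open>B\<close> in \<open>SL(2,\<real>)\<close> with polar decomposition \<open>B = U P\<close>, where \<open>P\<close> is positive definite
  and \<open>U\<close> is a rotation, this is \<open>U\<close> as a unit complex number.
\<close>

definition unitary_part :: "real^2^2 \<Rightarrow> complex" where
  "unitary_part B = sgn (Complex (B $ 1 $ 1 + B $ 2 $ 2) (B $ 2 $ 1 - B $ 1 $ 2))"

text \<open>
  The Conley-Zehnder index of a path \<open>\<Psi>\<close> from the identity to \<open>SL2_star\<close>, parametrized by
  \<open>{0..1}\<close>: extend \<open>\<Psi>\<close> inside \<open>SL2_star\<close> to a path ending at one of the matrices
  \<open>diag(-1, -1)\<close> and \<open>diag(2, 1/2)\<close>; the index is the degree of the square of the unitary part
  along the extended path, i.e. the total increment of its angle \<open>\<alpha>\<close> divided by \<open>pi\<close>.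
\<close>

definition CZ_index :: "(real \<Rightarrow> real^2^2) \<Rightarrow> int" where
  "CZ_index \<Psi> = (THE k. \<exists>\<Gamma> \<alpha>.
     continuous_on {0..2} \<Gamma> \<and> (\<forall>t\<in>{0..1}. \<Gamma> t = \<Psi> t) \<and> (\<forall>t\<in>{1..2}. \<Gamma> t \<in> SL2_star) \<and>
     \<Gamma> 2 \<in> {vector [vector [- 1, 0], vector [0, - 1]], vector [vector [2, 0], vector [0, 1/2]]} \<and>
     continuous_on {0..2} \<alpha> \<and> (\<forall>t\<in>{0..2}. unitary_part (\<Gamma> t) = cis (\<alpha> t)) \<and>
     \<alpha> 2 - \<alpha> 0 = pi * of_int k)"

definition orbit_CZ_index ::
  "'a::topological_space chart set \<Rightarrow> 'a two_form \<Rightarrow> ('a \<Rightarrow> real) \<Rightarrow> real \<Rightarrow> (real \<Rightarrow> 'a) \<Rightarrow>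
     (real \<Rightarrow> real^4^2) \<Rightarrow> int" where
  "orbit_CZ_index A \<omega> H \<tau> v F = CZ_index (linearized_path A \<omega> H \<tau> v F)"

end

(*
  Since \<rho>1 and \<rho>2 reverse the Hamiltonian flow, \<sigma> = \<rho>1 \<rho>2 is a symplectic involution commuting with it, and it
  shifts the orbit by half a period. Hence the return map is the square of \<sigma> composed with the flow over
  half a period, and the reduced monodromy is N^2 with det N = 1; so its trace is (tr N)^2 - 2 >= -2 and the
  orbit is never negative hyperbolic. On the other side the parity of the Conley-Zehnder index only depends
  on the sign of 2 - tr: it decides at which of the two model matrices the extended path ends, i.e.
  whether the unitary part ends at -1 or at 1. For the index to be defined the linearized flow has to be a
  continuous path in SL(2), which needs differentiable dependence of the flow on the initial point and
  d\<omega> = 0.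
*)
theory Submission
  imports Defs
begin

text \<open>Most of the work goes into showing that the objects exist. \<open>ham_flow\<close>,
  \<open>induced_matrix\<close>, \<open>reduced_trace\<close> and \<open>CZ_index\<close> are
  definite descriptions, so each value needs existence and uniqueness before anything can be said
  about it. On matrices of trace below 2 the unitary part omits 1, on those of trace above 2 it
  omits -1; hence the angle swept by an extension depends only on its end points. For the flow, the
  field need not be complete. Regularity is obtained for short times near one point and then
  propagated along the orbit, by connectedness of the time line. Preferred charts may jump along the
  orbit, so a continuous family of tangent vectors need not be continuous in \<open>real^4\<close>.
  The entries of the linearized path are therefore written as \<omega>-pairings of the transported
  frame with the frame: these are real numbers, and any chart may be used to compute them.\<close>

section \<open>Local flows of vector fields in Euclidean space\<close>

text \<open>Substitute for Gronwall's inequality; keeping the interval short avoids the exponential.\<close>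

lemma small_interval_bound:
  fixes f :: "real \<Rightarrow> 'a::real_normed_vector"
  assumes e: "0 \<le> e" "L * e \<le> 1/2" "0 \<le> L"
    and der: "\<And>s. s \<in> {-e..e} \<Longrightarrow> (f has_vector_derivative f' s) (at s within {-e..e})"
    and bnd: "\<And>s. s \<in> {-e..e} \<Longrightarrow> norm (f' s) \<le> L * norm (f s) + K"
    and s: "s \<in> {-e..e}"
  shows "norm (f s) \<le> 2 * (norm (f 0) + e * K)"
proof -
  have "continuous_on {-e..e} f"
    using der by (intro continuous_on_vector_derivative)
  then have "continuous_on {-e..e} (\<lambda>s. norm (f s))" by (intro continuous_intros)
  then obtain m where m: "m \<in> {-e..e}" "\<And>s. s \<in> {-e..e} \<Longrightarrow> norm (f s) \<le> norm (f m)"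
    using continuous_attains_sup[of "{-e..e}" "\<lambda>s. norm (f s)"] s by auto
  have "norm (f' 0) \<le> L * norm (f 0) + K" using bnd e by auto
  have B0: "0 \<le> L * norm (f m) + K"
    using bnd[OF m(1)] norm_ge_zero order_trans by blast
  have "norm (f m - f 0) \<le> (L * norm (f m) + K) * norm (m - 0)"
  proof (rule differentiable_bound[of "{-e..e}"])
    fix x assume x: "x \<in> {-e..e}"
    show "(f has_derivative (\<lambda>h. h *\<^sub>R f' x)) (at x within {-e..e})"
      using der[OF x] by (simp add: has_vector_derivative_def)
    have "norm (f' x) \<le> L * norm (f m) + K"
      using bnd[OF x] mult_left_mono[OF m(2)[OF x] e(3)] by linarith
    then show "onorm (\<lambda>h. h *\<^sub>R f' x) \<le> L * norm (f m) + K"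
      by (intro onorm_bound[OF B0]) (simp add: mult.commute[of _ "\<bar>_\<bar>"] mult_left_mono)
  qed (use e m in auto)
  also have "\<dots> \<le> (L * norm (f m) + K) * e"
    using m(1) B0 by (intro mult_left_mono) auto
  also have "\<dots> = (L * e) * norm (f m) + e * K" by (simp add: algebra_simps)
  \<comment> \<open>The maximum of the norm comes back on the right with a factor of at most 1/2 and
    is absorbed on the left; this is the origin of the factor 2 in the conclusion.\<close>
  also have "\<dots> \<le> (1/2) * norm (f m) + e * K"
    using mult_right_mono[OF e(2) norm_ge_zero[of "f m"]] by linarith
  finally have "norm (f m) \<le> norm (f 0) + (1/2) * norm (f m) + e * K"
    using norm_triangle_ineq2[of "f m" "f 0"] by linarith
  then show ?thesis using m(2)[OF s] by simp
qed

text \<open>This stands for the integral from 0 to \<open>a\<close> with either sign of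
  \<open>a\<close>. The set \<open>{0..a}\<close> is empty for negative \<open>a\<close>, so both
  integrals start at \<open>-e\<close> and are subtracted.\<close>

lemma integral_difference_bound:
  fixes g :: "real \<Rightarrow> 'a::euclidean_space"
  assumes "continuous_on {-e..e} g" "0 \<le> e" "a \<in> {-e..e}"
    and B: "\<And>s. s \<in> {-e..e} \<Longrightarrow> norm (g s) \<le> B"
  shows "norm (integral {-e..a} g - integral {-e..0} g) \<le> B * \<bar>a\<bar>"
proof -
  have B0: "0 \<le> B" using order_trans[OF norm_ge_zero B[of 0]] assms(2) by auto
  have "norm (integral {-e..a} g - integral {-e..0} g) \<le> B * norm (a - 0)"
  proof (rule differentiable_bound[of "{-e..e}"])
    fix x assume x: "x \<in> {-e..e}"
    show "((\<lambda>u. integral {-e..u} g) has_derivative (\<lambda>h. h *\<^sub>R g x)) (at x within {-e..e})"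
      using integral_has_vector_derivative[OF assms(1) x] by (simp add: has_vector_derivative_def)
    show "onorm (\<lambda>h. h *\<^sub>R g x) \<le> B"
      using B[OF x] by (intro onorm_bound[OF B0]) (simp add: mult.commute[of _ "\<bar>_\<bar>"] mult_left_mono)
  qed (use assms in auto)
  then show ?thesis by simp
qed

text \<open>Composing the field with the nearest point projection onto \<open>S\<close> makes it
  bounded and Lipschitz everywhere, so the integral operator is a contraction with factor 1/2 on the
  whole Banach space of bounded continuous functions. Afterwards \<open>M * e \<le> r\<close> keeps
  the fixed point inside \<open>S\<close>, where the projection is the identity.\<close>

lemma picard_existence:
  fixes X :: "'a::euclidean_space \<Rightarrow> 'a"
  assumes S: "convex S" "closed S"
    and lip: "\<And>x y. x \<in> S \<Longrightarrow> y \<in> S \<Longrightarrow> norm (X x - X y) \<le> L * norm (x - y)"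
    and bnd: "\<And>x. x \<in> S \<Longrightarrow> norm (X x) \<le> M"
    and e: "0 \<le> e" "L * e \<le> 1/2" "0 \<le> L"
    and x: "cball x r \<subseteq> S" "0 \<le> r" "M * e \<le> r"
  obtains y where "y 0 = x"
    "\<And>s. s \<in> {-e..e} \<Longrightarrow> y s \<in> S \<and> (y has_vector_derivative X (y s)) (at s within {-e..e})"
proof -
  have xS: "x \<in> S" using x by auto
  then have ne: "S \<noteq> {}" by auto
  define Y where "Y = X \<circ> closest_point S"
  have cpS: "closest_point S z \<in> S" for z using closest_point_in_set[OF S(2) ne] .
  have Ylip: "norm (Y a - Y b) \<le> L * norm (a - b)" for a b
  proof -
    have "norm (Y a - Y b) \<le> L * norm (closest_point S a - closest_point S b)"
      unfolding Y_def comp_def by (rule lip[OF cpS cpS])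
    also have "\<dots> \<le> L * norm (a - b)"
      using closest_point_lipschitz[OF S ne, of a b] e(3) by (intro mult_left_mono) (auto simp: dist_norm)
    finally show ?thesis .
  qed
  have Ybnd: "norm (Y a) \<le> M" for a unfolding Y_def comp_def by (rule bnd[OF cpS])
  have M0: "0 \<le> M" using Ybnd[of x] norm_ge_zero order_trans by blast
  have "continuous_on S X"
    using lip e(3) by (intro lipschitz_on_continuous_on[where L=L] lipschitz_onI) (auto simp: dist_norm)
  then have "continuous_on UNIV Y"
    unfolding Y_def by (intro continuous_on_compose continuous_on_closest_point S ne)
      (auto intro: continuous_on_subset cpS)
  then have Yc: "continuous_on T (\<lambda>s. Y (apply_bcontfun u s))" for u T
    by (rule continuous_on_compose2) auto
  \<comment> \<open>Clamping the time to \<open>{-e..e}\<close> extends a curve on this interval to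
    a bounded continuous function on the line, so that it becomes an element of the type on which
    the fixed point theorem acts.\<close>
  define c where "c s = max (-e) (min e s)" for s
  have c: "c s \<in> {-e..e}" "\<bar>c s\<bar> \<le> e" for s using e(1) by (auto simp: c_def)
  define I where "I u s = x + (integral {-e..s} (\<lambda>s. Y (apply_bcontfun u s)) -
    integral {-e..0} (\<lambda>s. Y (apply_bcontfun u s)))" for u s
  have Ider: "(I u has_vector_derivative Y (apply_bcontfun u s)) (at s within {-e..e})" if "s \<in> {-e..e}" for u s
    unfolding I_def
    by (rule derivative_eq_intros integral_has_vector_derivative[OF Yc that] refl)+ simp
  have Ibnd: "norm (I u s - x) \<le> M * \<bar>s\<bar>" if "s \<in> {-e..e}" for u s
    using integral_difference_bound[OF Yc e(1) that Ybnd] by (simp add: I_def)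
  have Ib: "(\<lambda>s. I u (c s)) \<in> bcontfun" for u
  proof -
    have "continuous_on {-e..e} (I u)"
      using Ider by (intro continuous_on_vector_derivative)
    moreover have "continuous_on UNIV c"
      unfolding c_def by (intro continuous_intros)
    ultimately have "continuous_on UNIV (\<lambda>s. I u (c s))"
      using c by (auto intro: continuous_on_compose2[where g="I u" and t="{-e..e}"])
    moreover have "bounded (range (\<lambda>s. I u (c s)))"
    proof (rule boundedI[where B="norm x + M * e"], safe)
      fix s
      have "norm (I u (c s)) \<le> norm x + norm (I u (c s) - x)" by (rule norm_triangle_sub)
      also have "\<dots> \<le> norm x + M * e"
        using Ibnd[OF c(1), of u s] mult_left_mono[OF c(2)[of s] M0] by linarith
      finally show "norm (I u (c s)) \<le> norm x + M * e" .
    qed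
    ultimately show ?thesis by (simp add: bcontfun_def)
  qed
  define T where "T u = Bcontfun (\<lambda>s. I u (c s))" for u
  have T: "apply_bcontfun (T u) s = I u (c s)" for u s
    using Bcontfun_inverse[OF Ib] by (simp add: T_def)
  have "dist (T u) (T w) \<le> (1/2) * dist u w" for u w
  proof (rule dist_bound)
    fix s
    have "norm ((integral {-e..c s} (\<lambda>s. Y (apply_bcontfun u s) - Y (apply_bcontfun w s)) -
      integral {-e..0} (\<lambda>s. Y (apply_bcontfun u s) - Y (apply_bcontfun w s)))) \<le> (L * dist u w) * \<bar>c s\<bar>"
    proof (rule integral_difference_bound[OF _ e(1) c(1)])
      fix s
      show "norm (Y (apply_bcontfun u s) - Y (apply_bcontfun w s)) \<le> L * dist u w"
        using Ylip[of "u s" "w s"] mult_left_mono[OF dist_bounded[of u s w] e(3)]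
        by (simp add: dist_norm)
    qed (intro continuous_intros Yc)
    moreover have "integral {-e..a} (\<lambda>s. Y (apply_bcontfun u s) - Y (apply_bcontfun w s)) =
       integral {-e..a} (\<lambda>s. Y (apply_bcontfun u s)) - integral {-e..a} (\<lambda>s. Y (apply_bcontfun w s))" for a
      by (intro integral_diff integrable_continuous_real Yc)
    moreover have "(L * dist u w) * \<bar>c s\<bar> \<le> (1/2) * dist u w"
    proof -
      have "(L * dist u w) * \<bar>c s\<bar> \<le> (L * dist u w) * e"
        using c(2) e by (intro mult_left_mono) auto
      also have "\<dots> = (L * e) * dist u w" by simp
      also have "\<dots> \<le> (1/2) * dist u w" using e by (intro mult_right_mono) auto
      finally show ?thesis .
    qed
    ultimately show "dist (apply_bcontfun (T u) s) (apply_bcontfun (T w) s) \<le> (1/2) * dist u w"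
      by (simp add: T dist_norm I_def algebra_simps)
  qed
  then obtain u where u: "T u = u"
    using banach_fix_type[of "1/2" T] by auto
  have ueq: "apply_bcontfun u s = I u s" if "s \<in> {-e..e}" for s
  proof -
    have "c s = s" using that by (auto simp: c_def)
    then show ?thesis using T[of u s] u by simp
  qed
  show ?thesis
  proof
    show "apply_bcontfun u 0 = x" using ueq[of 0] e by (simp add: I_def)
    fix s assume s: "s \<in> {-e..e}"
    have "norm (apply_bcontfun u s - x) \<le> M * \<bar>s\<bar>"
      using Ibnd[OF s] ueq[OF s] by simp
    also have "\<dots> \<le> r" using x(3) s mult_left_mono[of "\<bar>s\<bar>" e M, OF _ M0] by (auto simp: abs_le_iff)
    finally have uS: "apply_bcontfun u s \<in> S" using x(1) by (auto simp: dist_norm norm_minus_commute)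
    then have "Y (apply_bcontfun u s) = X (apply_bcontfun u s)"
      by (simp add: Y_def closest_point_self)
    then have "(I u has_vector_derivative X (apply_bcontfun u s)) (at s within {-e..e})"
      using Ider[OF s, of u] by simp
    then have "(apply_bcontfun u has_vector_derivative X (apply_bcontfun u s)) (at s within {-e..e})"
      by (rule has_vector_derivative_transform[OF s, rotated]) (simp add: ueq)
    then show "apply_bcontfun u s \<in> S \<and>
      (apply_bcontfun u has_vector_derivative X (apply_bcontfun u s)) (at s within {-e..e})"
      using uS by simp
  qed
qed


text \<open>The derivative \<open>D\<close> in the initial point is read off the flow of the system augmented by its linearization,
  to which Picard's theorem applies as well.\<close>

lemma local_flow:
  fixes X :: "'a::euclidean_space \<Rightarrow> 'a"
  assumes R: "0 < R" and L0: "0 \<le> L" and K0: "0 \<le> K"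
    and der: "\<And>x. x \<in> cball p R \<Longrightarrow> (X has_derivative X' x) (at x)"
    and L: "\<And>x w. x \<in> cball p R \<Longrightarrow> norm (X' x w) \<le> L * norm w"
    and K: "\<And>x y w. x \<in> cball p R \<Longrightarrow> y \<in> cball p R \<Longrightarrow>
      norm (X' x w - X' y w) \<le> K * norm (x - y) * norm w"
  obtains e \<Phi> D where "0 < e"
    "\<And>x. x \<in> ball p (R/2) \<Longrightarrow> \<Phi> 0 x = x"
    "\<And>x h. x \<in> ball p (R/2) \<Longrightarrow> D 0 x h = h"
    "\<And>x s. x \<in> ball p (R/2) \<Longrightarrow> s \<in> {-e<..<e} \<Longrightarrow> \<Phi> s x \<in> cball p R"
    "\<And>x s. x \<in> ball p (R/2) \<Longrightarrow> s \<in> {-e<..<e} \<Longrightarrow>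
      ((\<lambda>s. \<Phi> s x) has_vector_derivative X (\<Phi> s x)) (at s)"
    "\<And>x s. x \<in> ball p (R/2) \<Longrightarrow> s \<in> {-e<..<e} \<Longrightarrow> (\<Phi> s has_derivative D s x) (at x)"
    "\<And>x s h. x \<in> ball p (R/2) \<Longrightarrow> s \<in> {-e<..<e} \<Longrightarrow>
      ((\<lambda>s. D s x h) has_vector_derivative X' (\<Phi> s x) (D s x h)) (at s)"
    "\<And>x s. x \<in> ball p (R/2) \<Longrightarrow> s \<in> {-e<..<e} \<Longrightarrow> D s x (X x) = X (\<Phi> s x)"
proof -
  have lin: "linear (X' x)" if "x \<in> cball p R" for x
    using der[OF that] has_derivative_linear by blast
  have onL: "onorm (X' x) \<le> L" if "x \<in> cball p R" for x
    using L[OF that] L0 by (intro onorm_bound)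
  have lipX: "norm (X x - X y) \<le> L * norm (x - y)" if "x \<in> cball p R" "y \<in> cball p R" for x y
    by (rule differentiable_bound[OF convex_cball _ onL that]) (rule has_derivative_at_withinI[OF der])
  define M where "M = norm (X p) + L * R"
  have M: "norm (X x) \<le> M" if "x \<in> cball p R" for x
  proof -
    have "norm (X x) \<le> norm (X p) + norm (X x - X p)" by (rule norm_triangle_sub)
    also have "norm (X x - X p) \<le> L * norm (x - p)" using lipX that R by auto
    also have "\<dots> \<le> L * R" using that L0 by (intro mult_left_mono) (auto simp: dist_norm norm_minus_commute)
    finally show ?thesis by (simp add: M_def)
  qed
  have M0: "0 \<le> M" unfolding M_def using R L0 by simp
  define S where "S = cball p R \<times> cball (0::'a) 1"
  define Y where "Y z = (X (fst z), X' (fst z) (snd z))" for z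
  define L2 where "L2 = 2 * L + K"
  have L20: "0 \<le> L2" "L \<le> L2" using L0 K0 by (auto simp: L2_def)
  have lipY: "norm (Y a - Y b) \<le> L2 * norm (a - b)" if "a \<in> S" "b \<in> S" for a b
  proof -
    obtain x w y z where [simp]: "a = (x, w)" "b = (y, z)" by (cases a, cases b)
    have xy: "x \<in> cball p R" "y \<in> cball p R" "norm w \<le> 1" using that by (auto simp: S_def)
    have "X' x w - X' y z = (X' x w - X' y w) + X' y (w - z)"
      using linear_diff[OF lin[OF xy(2)]] by simp
    then have "norm (X' x w - X' y z) \<le> norm (X' x w - X' y w) + norm (X' y (w - z))"
      by (metis norm_triangle_ineq)
    also have "norm (X' x w - X' y w) \<le> K * norm (x - y) * norm w" by (rule K[OF xy(1,2)])
    also have "\<dots> \<le> K * norm (x - y)" using xy(3) K0 mult_left_mono[of "norm w" 1 "K * norm (x-y)"] by simp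
    also have "norm (X' y (w - z)) \<le> L * norm (w - z)" by (rule L[OF xy(2)])
    finally have 1: "norm (X' x w - X' y z) \<le> K * norm (x - y) + L * norm (w - z)" by simp
    have "norm (Y a - Y b) \<le> norm (X x - X y) + norm (X' x w - X' y z)"
      by (simp add: Y_def norm_Pair_le)
    also have "\<dots> \<le> (L + K) * norm (x - y) + L * norm (w - z)"
      using lipX[OF xy(1,2)] 1 by (simp add: algebra_simps)
    also have "\<dots> \<le> (L + K) * norm (a - b) + L * norm (a - b)"
      using norm_fst_le[of "x - y" "w - z"] norm_snd_le[of "w - z" "x - y"] L0 K0
      by (intro add_mono mult_left_mono) auto
    finally show ?thesis by (simp add: L2_def algebra_simps)
  qed
  have bndY: "norm (Y a) \<le> M + L" if "a \<in> S" for a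
  proof -
    have "norm (Y a) \<le> norm (X (fst a)) + norm (X' (fst a) (snd a))"
      by (simp add: Y_def norm_Pair_le)
    also have "norm (X (fst a)) \<le> M" using that by (intro M) (auto simp: S_def)
    also have "norm (X' (fst a) (snd a)) \<le> L * norm (snd a)" using that by (intro L) (auto simp: S_def)
    also have "\<dots> \<le> L" using that L0 mult_left_mono[of "norm (snd a)" 1 L] by (auto simp: S_def)
    finally show ?thesis by simp
  qed
  \<comment> \<open>Initial data \<open>(x, w)\<close> with \<open>x\<close> within R/2 of
    \<open>p\<close> and \<open>w\<close> of norm at most 1/2 have distance at least
    \<open>r\<close> to the outside of \<open>S\<close>.\<close>
  define r where "r = min (R/2) (1/2)"
  have r0: "0 < r" using R by (simp add: r_def)
  define e where "e = min (1 / (2 * (L2 + 1))) (r / (M + L + 1))"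
  have e0: "0 < e" using r0 L20 M0 L0 by (simp add: e_def)
  have eL2: "L2 * e \<le> 1/2"
  proof -
    have "L2 * e \<le> L2 * (1 / (2 * (L2 + 1)))" using L20 by (intro mult_left_mono) (auto simp: e_def)
    also have "\<dots> \<le> 1/2" using L20 by (simp add: field_simps)
    finally show ?thesis .
  qed
  have eL: "L * e \<le> 1/2" using mult_right_mono[OF L20(2), of e] e0 eL2 by linarith
  have eM: "(M + L) * e \<le> r"
  proof -
    have "(M + L) * e \<le> (M + L) * (r / (M + L + 1))" using M0 L0 by (intro mult_left_mono) (auto simp: e_def)
    also have "\<dots> \<le> r" using M0 L0 r0 by (simp add: field_simps)
    finally show ?thesis .
  qed
  have "\<exists>y. y 0 = (x, w) \<and> (\<forall>s\<in>{-e..e}. y s \<in> S \<and> (y has_vector_derivative Y (y s)) (at s within {-e..e}))"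
    if "x \<in> cball p (R/2)" "norm w \<le> 1/2" for x w
  proof -
    have "cball (x, w) r \<subseteq> S"
    proof
      fix a assume a: "a \<in> cball (x, w) r"
      have "dist x (fst a) \<le> r" "dist w (snd a) \<le> r"
        using a dist_fst_le[of "(x,w)" a] dist_snd_le[of "(x,w)" a] by auto
      then have "dist p (fst a) \<le> R" "norm (snd a) \<le> 1"
        using that dist_triangle[of p "fst a" x] norm_triangle_sub[of "snd a" w]
        by (auto simp: r_def dist_norm norm_minus_commute)
      then show "a \<in> S" by (cases a) (simp add: S_def)
    qed
    moreover have "convex S" "closed S" unfolding S_def by (intro convex_Times closed_Times convex_cball closed_cball)+
    ultimately obtain y where "y 0 = (x, w)"
      "\<And>s. s \<in> {-e..e} \<Longrightarrow> y s \<in> S \<and> (y has_vector_derivative Y (y s)) (at s within {-e..e})"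
      using picard_existence[of S Y L2 "M + L" e "(x, w)" r, OF _ _ lipY bndY _ eL2 L20(1) _ _ eM] r0 e0 less_imp_le by blast
    then show ?thesis by blast
  qed
  then obtain sol where sol0: "\<And>x w. x \<in> cball p (R/2) \<Longrightarrow> norm w \<le> 1/2 \<Longrightarrow> sol x w 0 = (x, w)"
    and sol: "\<And>x w s. x \<in> cball p (R/2) \<Longrightarrow> norm w \<le> 1/2 \<Longrightarrow> s \<in> {-e..e} \<Longrightarrow>
        sol x w s \<in> S \<and> (sol x w has_vector_derivative Y (sol x w s)) (at s within {-e..e})"
    by metis
  define \<Phi> where "\<Phi> s x = fst (sol x 0 s)" for s x
  define Z where "Z x w s = snd (sol x w s)" for x w s
  have fst': "((\<lambda>s. fst (sol x w s)) has_vector_derivative X (fst (sol x w s))) (at s within {-e..e})"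
     and snd': "((\<lambda>s. snd (sol x w s)) has_vector_derivative X' (fst (sol x w s)) (snd (sol x w s))) (at s within {-e..e})"
     and fstS: "fst (sol x w s) \<in> cball p R"
    if "x \<in> cball p (R/2)" "norm w \<le> 1/2" "s \<in> {-e..e}" for x w s
    using bounded_linear.has_vector_derivative[OF bounded_linear_fst, of "sol x w"]
      bounded_linear.has_vector_derivative[OF bounded_linear_snd, of "sol x w"] sol[OF that]
    by (auto simp: Y_def S_def)
  have \<Phi>0: "\<Phi> 0 x = x" if "x \<in> cball p (R/2)" for x
    using sol0[OF that, of 0] by (simp add: \<Phi>_def)
  have \<Phi>': "((\<lambda>s. \<Phi> s x) has_vector_derivative X (\<Phi> s x)) (at s within {-e..e})"
    and \<Phi>S: "\<Phi> s x \<in> cball p R"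
    if "x \<in> cball p (R/2)" "s \<in> {-e..e}" for x s
    using fst'[OF that(1), of 0 s] fstS[OF that(1), of 0 s] that unfolding \<Phi>_def by auto
  \<comment> \<open>Comparing with an augmented solution for arbitrary \<open>w\<close> serves
    twice: it gives Lipschitz dependence on the initial point, and for \<open>x = y\<close> it shows
    that the first component does not depend on \<open>w\<close>.\<close>
  have lip\<Phi>: "norm (\<Phi> s x - fst (sol y w s)) \<le> 2 * norm (x - y)"
    if "x \<in> cball p (R/2)" "y \<in> cball p (R/2)" "norm w \<le> 1/2" "s \<in> {-e..e}" for x y w s
  proof -
    have "norm (\<Phi> s x - fst (sol y w s)) \<le> 2 * (norm (\<Phi> 0 x - fst (sol y w 0)) + e * 0)"
    proof (rule small_interval_bound[where f="\<lambda>s. \<Phi> s x - fst (sol y w s)", OF _ eL L0])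
      show "s \<in> {-e..e}" "0 \<le> e" using that e0 by auto
      fix s assume s: "s \<in> {-e..e}"
      show "((\<lambda>s. \<Phi> s x - fst (sol y w s)) has_vector_derivative X (\<Phi> s x) - X (fst (sol y w s))) (at s within {-e..e})"
        by (rule has_vector_derivative_diff \<Phi>' fst' that s)+
      show "norm (X (\<Phi> s x) - X (fst (sol y w s))) \<le> L * norm (\<Phi> s x - fst (sol y w s)) + 0"
        using lipX[OF \<Phi>S[OF that(1) s] fstS[OF that(2,3) s]] by simp
    qed
    then show ?thesis using sol0 \<Phi>0 that by simp
  qed
  have fst_eq: "fst (sol x w s) = \<Phi> s x"
    if "x \<in> cball p (R/2)" "norm w \<le> 1/2" "s \<in> {-e..e}" for x w s
    using lip\<Phi>[OF that(1,1,2,3)] by simp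
  have Z': "((\<lambda>s. Z x w s) has_vector_derivative X' (\<Phi> s x) (Z x w s)) (at s within {-e..e})"
    if "x \<in> cball p (R/2)" "norm w \<le> 1/2" "s \<in> {-e..e}" for x w s
    using snd'[OF that] fst_eq[OF that] by (simp add: Z_def)
  \<comment> \<open>Solutions are available for initial vectors of norm at most 1/2 only, so half
    basis vectors are transported and the factor 2 restores the scale. Linearity in \<open>h\<close>
    is built in.\<close>
  define D where "D s x h = (\<Sum>b\<in>Basis. (2 * (h \<bullet> b)) *\<^sub>R Z x ((1/2) *\<^sub>R b) s)" for s x h
  have D0: "D 0 x h = h" if "x \<in> cball p (R/2)" for x h
  proof -
    have "D 0 x h = (\<Sum>b\<in>Basis. (h \<bullet> b) *\<^sub>R b)"
      unfolding D_def using sol0[OF that] by (intro sum.cong) (auto simp: Z_def)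
    then show ?thesis by (simp add: euclidean_representation)
  qed
  have D': "((\<lambda>s. D s x h) has_vector_derivative X' (\<Phi> s x) (D s x h)) (at s within {-e..e})"
    if "x \<in> cball p (R/2)" "s \<in> {-e..e}" for x s h
  proof -
    have "X' (\<Phi> s x) (D s x h) =
      (\<Sum>b\<in>Basis. (2 * (h \<bullet> b)) *\<^sub>R X' (\<Phi> s x) (Z x ((1/2) *\<^sub>R b) s))"
      unfolding D_def using lin[OF \<Phi>S[OF that]] by (simp add: linear_sum linear_scale)
    then show ?thesis unfolding D_def
      by (auto intro!: has_vector_derivative_sum Z' that bounded_linear.has_vector_derivative[OF bounded_linear_scaleR_right])
  qed
  have linD: "linear (D s x)" for s x
    unfolding D_def by (rule linearI) (simp_all add: inner_left_distrib algebra_simps sum.distrib scaleR_sum_right)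
  \<comment> \<open>The linearization error of the field along the segment is at most
    \<open>K\<close> times the square of \<open>2 * norm (y - x)\<close>; the factor
    \<open>2 * e\<close> of \<open>small_interval_bound\<close> turns 4 K into 8 K e. A quadratic
    remainder gives differentiability.\<close>
  have rem: "norm (\<Phi> s y - \<Phi> s x - D s x (y - x)) \<le> (8 * K * e) * (norm (y - x))\<^sup>2"
    if "x \<in> cball p (R/2)" "y \<in> cball p (R/2)" "s \<in> {-e..e}" for x y s
  proof -
    have "norm (\<Phi> s y - \<Phi> s x - D s x (y - x)) \<le>
      2 * (norm (\<Phi> 0 y - \<Phi> 0 x - D 0 x (y - x)) + e * (4 * K * (norm (y - x))\<^sup>2))"
    proof (rule small_interval_bound[where f="\<lambda>s. \<Phi> s y - \<Phi> s x - D s x (y - x)", OF _ eL L0])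
      show "s \<in> {-e..e}" "0 \<le> e" using that e0 by auto
      fix s assume s: "s \<in> {-e..e}"
      show "((\<lambda>s. \<Phi> s y - \<Phi> s x - D s x (y - x)) has_vector_derivative
         X (\<Phi> s y) - X (\<Phi> s x) - X' (\<Phi> s x) (D s x (y - x))) (at s within {-e..e})"
        by (rule has_vector_derivative_diff \<Phi>' D' that s)+
      let ?a = "\<Phi> s x" and ?b = "\<Phi> s y"
      have ab: "?a \<in> cball p R" "?b \<in> cball p R" using \<Phi>S that s by auto
      have d2: "norm (?b - ?a) \<le> 2 * norm (y - x)"
        using lip\<Phi>[OF that(2,1) _ s, of 0] by (simp add: \<Phi>_def)
      have seg: "closed_segment ?a ?b \<subseteq> cball p R"
        using ab by (intro closed_segment_subset) auto
      have "norm (X ?b - X ?a - X' ?a (?b - ?a)) \<le> norm (?b - ?a) * (K * norm (?b - ?a))"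
      proof (rule differentiable_bound_linearization[where S="closed_segment ?a ?b" and f'=X' and ?x0.0="?a"])
        fix t :: real assume "t \<in> {0..1}"
        then show "?a + t *\<^sub>R (?b - ?a) \<in> closed_segment ?a ?b"
          by (auto simp: closed_segment_def algebra_simps intro!: exI[of _ t])
      next
        fix z assume z: "z \<in> closed_segment ?a ?b"
        show "(X has_derivative X' z) (at z within closed_segment ?a ?b)"
          by (rule has_derivative_at_withinI[OF der[OF subsetD[OF seg z]]])
        have "norm (z - ?a) \<le> norm (?b - ?a)"
          using segment_bound(1)[OF z] by (simp add: norm_minus_commute)
        then have "K * norm (z - ?a) \<le> K * norm (?b - ?a)" using K0 by (rule mult_left_mono)
        then have "norm (X' z w - X' ?a w) \<le> K * norm (?b - ?a) * norm w" for w
          using K[of z ?a w] seg z ab(1) mult_right_mono[OF _ norm_ge_zero[of w]] by fastforce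
        then show "onorm (X' z - X' ?a) \<le> K * norm (?b - ?a)"
          using K0 by (intro onorm_bound) auto
      qed auto
      also have "\<dots> = K * (norm (?b - ?a))\<^sup>2" by (simp add: power2_eq_square)
      also have "\<dots> \<le> K * (2 * norm (y - x))\<^sup>2"
        using d2 K0 by (intro mult_left_mono power_mono) auto
      finally have 1: "norm (X ?b - X ?a - X' ?a (?b - ?a)) \<le> 4 * K * (norm (y - x))\<^sup>2"
        by (simp add: power_mult_distrib)
      have "X ?b - X ?a - X' ?a (D s x (y - x)) =
        (X ?b - X ?a - X' ?a (?b - ?a)) + X' ?a (?b - ?a - D s x (y - x))"
        using lin[OF ab(1)] by (simp add: linear_diff)
      then have "norm (X ?b - X ?a - X' ?a (D s x (y - x))) \<le>
        norm (X ?b - X ?a - X' ?a (?b - ?a)) + norm (X' ?a (?b - ?a - D s x (y - x)))"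
        by (metis norm_triangle_ineq)
      with 1 L[OF ab(1), of "?b - ?a - D s x (y - x)"]
      show "norm (X ?b - X ?a - X' ?a (D s x (y - x)))
        \<le> L * norm (?b - ?a - D s x (y - x)) + 4 * K * (norm (y - x))\<^sup>2" by linarith
    qed
    then show ?thesis using \<Phi>0 D0 that by (simp add: mult_ac)
  qed
  \<comment> \<open>Both sides solve the linearized equation along the same curve with the same
    initial value.\<close>
  have DX: "D s x (X x) = X (\<Phi> s x)" if "x \<in> cball p (R/2)" "s \<in> {-e..e}" for x s
  proof -
    have "norm (D s x (X x) - X (\<Phi> s x)) \<le> 2 * (norm (D 0 x (X x) - X (\<Phi> 0 x)) + e * 0)"
    proof (rule small_interval_bound[where f="\<lambda>s. D s x (X x) - X (\<Phi> s x)", OF _ eL L0])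
      show "s \<in> {-e..e}" "0 \<le> e" using that e0 by auto
      fix s assume s: "s \<in> {-e..e}"
      have "((X \<circ> (\<lambda>s. \<Phi> s x)) has_vector_derivative X' (\<Phi> s x) (X (\<Phi> s x))) (at s within {-e..e})"
        using diff_chain_within[OF \<Phi>'[OF that(1) s, unfolded has_vector_derivative_def]
            has_derivative_at_withinI[OF der[OF \<Phi>S[OF that(1) s]]]]
        by (simp add: has_vector_derivative_def comp_def linear_scale[OF lin[OF \<Phi>S[OF that(1) s]]])
      then show "((\<lambda>s. D s x (X x) - X (\<Phi> s x)) has_vector_derivative
         X' (\<Phi> s x) (D s x (X x)) - X' (\<Phi> s x) (X (\<Phi> s x))) (at s within {-e..e})"
        unfolding comp_def by (intro has_vector_derivative_diff D' that s)
      show "norm (X' (\<Phi> s x) (D s x (X x)) - X' (\<Phi> s x) (X (\<Phi> s x))) \<le> L * norm (D s x (X x) - X (\<Phi> s x)) + 0"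
        using L[OF \<Phi>S[OF that(1) s], of "D s x (X x) - X (\<Phi> s x)"] linear_diff[OF lin[OF \<Phi>S[OF that(1) s]]] by simp
    qed
    then show ?thesis using \<Phi>0 D0 that by simp
  qed
  have atI: "at s within {-e..e} = at s" if "s \<in> {-e<..<e}" for s
    using that by (intro at_within_Icc_at) auto
  have bc: "x \<in> ball p (R/2) \<Longrightarrow> x \<in> cball p (R/2)" for x by auto
  show ?thesis
  proof (rule that[OF e0, of \<Phi> D])
    fix x s assume xs: "x \<in> ball p (R/2)" "s \<in> {-e<..<e}"
    have s: "s \<in> {-e..e}" using xs by auto
    show "\<Phi> s x \<in> cball p R" "((\<lambda>s. \<Phi> s x) has_vector_derivative X (\<Phi> s x)) (at s)"
      "D s x (X x) = X (\<Phi> s x)"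
      using \<Phi>S[OF bc s] \<Phi>'[OF bc s] atI[OF xs(2)] DX[OF bc s] xs by auto
    show "((\<lambda>s. D s x h) has_vector_derivative X' (\<Phi> s x) (D s x h)) (at s)" for h
      using D'[OF bc s] atI[OF xs(2)] xs by auto
    show "(\<Phi> s has_derivative D s x) (at x)"
    proof (rule has_derivativeI_sandwich[where e="R/2 - dist p x" and H="\<lambda>y. (8 * K * e) * norm (y - x)"])
      show "0 < R/2 - dist p x" using xs by auto
      show "bounded_linear (D s x)" using linD linear_conv_bounded_linear by blast
      show "((\<lambda>y. 8 * K * e * norm (y - x)) \<longlongrightarrow> 0) (at x)"
        by (auto intro!: tendsto_eq_intros)
      fix y assume y: "y \<noteq> x" "dist y x < R/2 - dist p x"
      have "dist p y \<le> dist p x + dist y x" by (metis dist_commute dist_triangle)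
      then have "y \<in> cball p (R/2)" using y by auto
      from rem[OF bc[OF xs(1)] this s] y(1)
      show "norm (\<Phi> s y - \<Phi> s x - D s x (y - x)) / norm (y - x) \<le> 8 * K * e * norm (y - x)"
        by (simp add: field_simps power2_eq_square)
    qed
  qed (use \<Phi>0 D0 bc in auto)
qed

section \<open>Calculus of \<open>C\<^sup>k\<close> functions\<close>

lemma has_frechet_derivative_on:
  assumes "open U" "f differentiable_on U" "x \<in> U"
  shows "(f has_derivative frechet_derivative f (at x)) (at x)"
  using assms by (metis at_within_open differentiable_on_def frechet_derivative_works)

lemma frechet_derivative_cong_open:
  assumes "open U" "x \<in> U" "\<And>y. y \<in> U \<Longrightarrow> f y = g y"
  shows "frechet_derivative f (at x) = frechet_derivative g (at x)"
proof -
  have "(f has_derivative D) (at x) \<longleftrightarrow> (g has_derivative D) (at x)" for D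
    using has_derivative_transform_within_open[OF _ assms(1,2)] assms(3) by metis
  then show ?thesis by (simp add: frechet_derivative_def)
qed

lemma Ck_on_cong:
  assumes "open U" "\<And>y. y \<in> U \<Longrightarrow> f y = g y"
  shows "Ck_on k U f \<longleftrightarrow> Ck_on k U g"
  using assms
proof (induction k arbitrary: f g)
  case (Suc k)
  have "f differentiable_on U \<longleftrightarrow> g differentiable_on U"
    unfolding differentiable_on_def differentiable_def
    using Suc.prems(2) has_derivative_transform[of _ U f g] has_derivative_transform[of _ U g f] by metis
  moreover have "Ck_on k U (\<lambda>x. frechet_derivative f (at x) b) \<longleftrightarrow> Ck_on k U (\<lambda>x. frechet_derivative g (at x) b)" for b
    using frechet_derivative_cong_open[OF Suc.prems(1) _ Suc.prems(2)]
    by (intro Suc.IH[OF Suc.prems(1)]) simp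
  ultimately show ?case by simp
qed (simp cong: continuous_on_cong)

lemma Ck_on_SucD: "Ck_on (Suc k) U f \<Longrightarrow> Ck_on k U f"
proof (induction k arbitrary: f)
  case 0
  then show ?case by (simp add: differentiable_imp_continuous_on)
qed auto

lemma Ck_on_const: "Ck_on k U (\<lambda>x. c)"
  by (induction k arbitrary: c) (auto simp: frechet_derivative_const)

text \<open>The induction step for all closure properties below: any explicitly known derivative may
  replace \<open>frechet_derivative\<close>.\<close>

lemma Ck_on_SucI:
  assumes U: "open U" and d: "\<And>x. x \<in> U \<Longrightarrow> (f has_derivative D x) (at x)"
    and D: "\<And>b. b \<in> Basis \<Longrightarrow> Ck_on k U (\<lambda>x. D x b)"
  shows "Ck_on (Suc k) U f"
proof -
  have "f differentiable_on U"
    using d U by (metis at_within_open differentiable_def differentiable_on_def)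
  moreover have "Ck_on k U (\<lambda>x. frechet_derivative f (at x) b)" if "b \<in> Basis" for b
    using D[OF that] by (subst Ck_on_cong[OF U, where g="\<lambda>x. D x b"]) (auto simp: frechet_derivative_at[OF d, symmetric])
  ultimately show ?thesis by simp
qed

lemma Ck_on_bounded_linear:
  assumes U: "open U" and T: "bounded_linear T" and f: "Ck_on k U f"
  shows "Ck_on k U (\<lambda>x. T (f x))"
  using f
proof (induction k arbitrary: f)
  case 0
  then show ?case using T by (simp add: bounded_linear.continuous_on)
next
  case (Suc k)
  show ?case
  proof (rule Ck_on_SucI[OF U])
    show "((\<lambda>x. T (f x)) has_derivative (\<lambda>h. T (frechet_derivative f (at x) h))) (at x)" if "x \<in> U" for x
      using has_frechet_derivative_on[OF U _ that] Suc.prems T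
      by (auto intro: bounded_linear.has_derivative)
  qed (use Suc in auto)
qed

lemma Ck_on_add:
  assumes U: "open U" and "Ck_on k U f" "Ck_on k U g"
  shows "Ck_on k U (\<lambda>x. f x + g x)"
  using assms(2,3)
proof (induction k arbitrary: f g)
  case 0
  then show ?case by (simp add: continuous_on_add)
next
  case (Suc k)
  show ?case
  proof (rule Ck_on_SucI[OF U])
    show "((\<lambda>x. f x + g x) has_derivative
        (\<lambda>h. frechet_derivative f (at x) h + frechet_derivative g (at x) h)) (at x)" if "x \<in> U" for x
      using has_frechet_derivative_on[OF U _ that] Suc.prems by (auto intro: has_derivative_add)
  qed (use Suc in auto)
qed

lemma Ck_on_bilinear:
  assumes U: "open U" and p: "bounded_bilinear p" and "Ck_on k U f" "Ck_on k U g"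
  shows "Ck_on k U (\<lambda>x. p (f x) (g x))"
  using assms(3,4)
proof (induction k arbitrary: f g)
  case 0
  then show ?case using p by (simp add: bounded_bilinear.continuous_on)
next
  case (Suc k)
  show ?case
  proof (rule Ck_on_SucI[OF U])
    show "((\<lambda>x. p (f x) (g x)) has_derivative
        (\<lambda>h. p (f x) (frechet_derivative g (at x) h) + p (frechet_derivative f (at x) h) (g x))) (at x)" if "x \<in> U" for x
      using Suc.prems by (intro bounded_bilinear.FDERIV[OF p] has_frechet_derivative_on[OF U _ that]) auto
    show "Ck_on k U (\<lambda>x. p (f x) (frechet_derivative g (at x) b) + p (frechet_derivative f (at x) b) (g x))"
      if "b \<in> Basis" for b
      using Suc.prems that by (intro Ck_on_add[OF U] Suc.IH Ck_on_SucD[of k U f] Ck_on_SucD[of k U g]) auto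
  qed
qed

lemma Ck_on_mult:
  fixes f g :: "'a::euclidean_space \<Rightarrow> real"
  assumes "open U" "Ck_on k U f" "Ck_on k U g"
  shows "Ck_on k U (\<lambda>x. f x * g x)"
  using Ck_on_bilinear[OF assms(1) bounded_bilinear_mult assms(2,3)] .

lemma Ck_on_inverse:
  fixes f :: "'a::euclidean_space \<Rightarrow> real"
  assumes U: "open U" and "Ck_on k U f" and nz: "\<And>x. x \<in> U \<Longrightarrow> f x \<noteq> 0"
  shows "Ck_on k U (\<lambda>x. inverse (f x))"
  using assms(2)
proof (induction k)
  case 0
  then show ?case using nz by (auto intro!: continuous_on_inverse)
next
  case (Suc k)
  show ?case
  proof (rule Ck_on_SucI[OF U])
    show "((\<lambda>x. inverse (f x)) has_derivative
        (\<lambda>h. - (inverse (f x) * frechet_derivative f (at x) h * inverse (f x)))) (at x)" if "x \<in> U" for x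
      using Suc.prems by (intro Deriv.has_derivative_inverse nz[OF that] has_frechet_derivative_on[OF U _ that]) auto
    show "Ck_on k U (\<lambda>x. - (inverse (f x) * frechet_derivative f (at x) b * inverse (f x)))"
      if "b \<in> Basis" for b
      using Suc.prems that
      by (intro Ck_on_bounded_linear[OF U bounded_linear_minus[OF bounded_linear_ident]] Ck_on_mult[OF U]
          Suc.IH Ck_on_SucD[of k U f]) auto
  qed
qed

lemma Ck_on_sum:
  assumes U: "open U" and "\<And>i. i \<in> I \<Longrightarrow> Ck_on k U (f i)"
  shows "Ck_on k U (\<lambda>x. \<Sum>i\<in>I. f i x)"
  using assms(2)
  by (induction I rule: infinite_finite_induct) (auto intro: Ck_on_const Ck_on_add[OF U])

lemma Ck_on_prod:
  fixes f :: "'i \<Rightarrow> 'a::euclidean_space \<Rightarrow> real"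
  assumes U: "open U" and "\<And>i. i \<in> I \<Longrightarrow> Ck_on k U (f i)"
  shows "Ck_on k U (\<lambda>x. \<Prod>i\<in>I. f i x)"
  using assms(2)
  by (induction I rule: infinite_finite_induct) (auto intro: Ck_on_const Ck_on_mult[OF U])

lemma Ck_on_det:
  fixes f :: "'a::euclidean_space \<Rightarrow> real^'n^'n"
  assumes U: "open U" and "\<And>i j. Ck_on k U (\<lambda>x. f x $ i $ j)"
  shows "Ck_on k U (\<lambda>x. det (f x))"
  unfolding det_def by (intro Ck_on_sum[OF U] Ck_on_mult[OF U] Ck_on_const Ck_on_prod[OF U] assms(2))

lemma Ck_on_vec:
  fixes f :: "'a::euclidean_space \<Rightarrow> real^'n"
  assumes U: "open U" and "\<And>i. Ck_on k U (\<lambda>x. f x $ i)"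
  shows "Ck_on k U f"
proof -
  have "Ck_on k U (\<lambda>x. \<Sum>i\<in>UNIV. f x $ i *\<^sub>R axis i 1)"
    by (intro Ck_on_sum[OF U] Ck_on_bilinear[OF U bounded_bilinear_scaleR] assms(2) Ck_on_const)
  then show ?thesis
    by (subst Ck_on_cong[OF U, where g="\<lambda>x. \<Sum>i\<in>UNIV. f x $ i *\<^sub>R axis i 1"])
      (auto simp: vec_eq_iff axis_def if_distrib[of "\<lambda>x. _ * x"] cong: if_cong)
qed

text \<open>Cramer's rule makes every coordinate of the solution a quotient of determinants in the
  coefficients. This is how the Hamiltonian field, known only as the solution of a linear system, is
  seen to be smooth.\<close>

lemma Ck_on_linear_solution:
  fixes B :: "'a::euclidean_space \<Rightarrow> real^'n^'n" and f g :: "'a \<Rightarrow> real^'n"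
  assumes U: "open U" and B: "\<And>i j. Ck_on k U (\<lambda>x. B x $ i $ j)" and g: "\<And>i. Ck_on k U (\<lambda>x. g x $ i)"
    and inv: "\<And>x. x \<in> U \<Longrightarrow> det (B x) \<noteq> 0" and eq: "\<And>x. x \<in> U \<Longrightarrow> B x *v f x = g x"
  shows "Ck_on k U f"
proof (rule Ck_on_vec[OF U])
  fix l
  let ?h = "\<lambda>x. det (\<chi> i j. if j = l then g x $ i else B x $ i $ j) * inverse (det (B x))"
  have "Ck_on k U ?h"
  proof (intro Ck_on_mult[OF U] Ck_on_inverse[OF U] Ck_on_det[OF U])
    show "Ck_on k U (\<lambda>x. (\<chi> i j. if j = l then g x $ i else B x $ i $ j) $ i $ j)" for i j
      using B g by (cases "j = l") auto
  qed (use B inv in auto)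
  moreover have "f x $ l = ?h x" if "x \<in> U" for x
    using iffD1[OF cramer[OF inv[OF that]] eq[OF that]] by (simp add: divide_inverse)
  ultimately show "Ck_on k U (\<lambda>x. f x $ l)"
    by (subst Ck_on_cong[OF U, where g="?h"]) auto
qed

section \<open>Derivative bounds on compact sets and symmetry of second derivatives\<close>

lemma linear_norm_bound_Basis:
  fixes T :: "'a::euclidean_space \<Rightarrow> 'b::real_normed_vector"
  assumes "linear T" "\<And>b. b \<in> Basis \<Longrightarrow> norm (T b) \<le> C"
  shows "norm (T w) \<le> (real DIM('a) * C) * norm w"
proof -
  have "T w = T (\<Sum>b\<in>Basis. (w \<bullet> b) *\<^sub>R b)" by (simp add: euclidean_representation)
  also have "\<dots> = (\<Sum>b\<in>Basis. (w \<bullet> b) *\<^sub>R T b)" using assms(1) by (simp add: linear_sum linear_scale)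
  finally have "norm (T w) \<le> (\<Sum>b\<in>Basis. norm ((w \<bullet> b) *\<^sub>R T b))" by (metis norm_sum)
  also have "\<dots> \<le> (\<Sum>b\<in>(Basis::'a set). norm w * C)"
    using assms(2) by (intro sum_mono) (auto intro!: mult_mono Basis_le_norm)
  finally show ?thesis by (simp add: mult_ac)
qed

lemma C1_lipschitz_on_compact:
  fixes f :: "'a::euclidean_space \<Rightarrow> 'b::real_normed_vector"
  assumes U: "open U" and f: "Ck_on 1 U f" and S: "compact S" "convex S" "S \<subseteq> U"
  obtains C where "0 \<le> C" "\<And>x y. x \<in> S \<Longrightarrow> y \<in> S \<Longrightarrow> norm (f x - f y) \<le> C * norm (x - y)"
    "\<And>x w. x \<in> S \<Longrightarrow> norm (frechet_derivative f (at x) w) \<le> C * norm w"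
proof -
  have d: "(f has_derivative frechet_derivative f (at x)) (at x)" if "x \<in> S" for x
    using has_frechet_derivative_on[OF U, of f x] f S(3) that by auto
  have "\<exists>c. \<forall>x\<in>S. norm (frechet_derivative f (at x) b) \<le> c" if "b \<in> Basis" for b
  proof -
    have "continuous_on S (\<lambda>x. frechet_derivative f (at x) b)"
      using f that S(3) by (auto intro: continuous_on_subset)
    then have "bounded ((\<lambda>x. frechet_derivative f (at x) b) ` S)"
      using S(1) compact_continuous_image compact_imp_bounded by blast
    then show ?thesis by (auto simp: bounded_iff)
  qed
  then obtain c where c: "\<And>b x. b \<in> Basis \<Longrightarrow> x \<in> S \<Longrightarrow> norm (frechet_derivative f (at x) b) \<le> c b"
    by metis
  define m where "m = (\<Sum>b\<in>Basis. \<bar>c b\<bar>)"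
  have m: "norm (frechet_derivative f (at x) b) \<le> m" if "b \<in> Basis" "x \<in> S" for b x
  proof -
    have "\<bar>c b\<bar> \<le> m" unfolding m_def using that by (intro member_le_sum) auto
    then show ?thesis using c[OF that] by linarith
  qed
  define C where "C = real DIM('a) * m"
  have C0: "0 \<le> C" unfolding C_def m_def by (simp add: sum_nonneg)
  have b: "norm (frechet_derivative f (at x) w) \<le> C * norm w" if "x \<in> S" for x w
    unfolding C_def
    by (rule linear_norm_bound_Basis[OF has_derivative_linear[OF d[OF that]] m[OF _ that]])
  show ?thesis
  proof (rule that[OF C0 _ b])
    fix x y assume xy: "x \<in> S" "y \<in> S"
    show "norm (f x - f y) \<le> C * norm (x - y)"
      by (rule differentiable_bound[OF S(2) has_derivative_at_withinI[OF d] _ xy])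
        (auto intro!: onorm_bound C0 b)
  qed
qed

text \<open>This supplies the constant \<open>K\<close> of \<open>local_flow\<close>, as the
  preceding lemma supplies \<open>L\<close>; the Lipschitz constants of the finitely many partial
  derivatives are added up.\<close>

lemma C2_derivative_lipschitz_on_compact:
  fixes f :: "'a::euclidean_space \<Rightarrow> 'b::real_normed_vector"
  assumes U: "open U" and f: "Ck_on 2 U f" and S: "compact S" "convex S" "S \<subseteq> U"
  obtains K where "0 \<le> K" "\<And>x y w. x \<in> S \<Longrightarrow> y \<in> S \<Longrightarrow>
    norm (frechet_derivative f (at x) w - frechet_derivative f (at y) w) \<le> K * norm (x - y) * norm w"
proof -
  have f2: "f differentiable_on U" "\<And>b. b \<in> Basis \<Longrightarrow> Ck_on 1 U (\<lambda>x. frechet_derivative f (at x) b)"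
    using f by (auto simp: numeral_2_eq_2)
  have "\<exists>C\<ge>0. \<forall>x\<in>S. \<forall>y\<in>S. norm (frechet_derivative f (at x) b - frechet_derivative f (at y) b) \<le> C * norm (x - y)"
    if "b \<in> Basis" for b
    using C1_lipschitz_on_compact[OF U f2(2)[OF that] S] by metis
  then obtain c where c: "\<And>b. b \<in> Basis \<Longrightarrow> 0 \<le> c b" "\<And>b x y. b \<in> Basis \<Longrightarrow> x \<in> S \<Longrightarrow> y \<in> S \<Longrightarrow>
    norm (frechet_derivative f (at x) b - frechet_derivative f (at y) b) \<le> c b * norm (x - y)"
    by metis
  define m where "m = (\<Sum>b\<in>Basis. c b)"
  have m0: "0 \<le> m" unfolding m_def using c(1) by (intro sum_nonneg)
  have m: "c b \<le> m" if "b \<in> Basis" for b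
    unfolding m_def using that c(1) by (intro member_le_sum) auto
  have lin: "linear (frechet_derivative f (at x))" if "x \<in> S" for x
    using has_derivative_linear[OF has_frechet_derivative_on[OF U f2(1)]] S(3) that by blast
  show ?thesis
  proof
    show "0 \<le> real DIM('a) * m" using m0 by simp
    fix x y w assume xy: "x \<in> S" "y \<in> S"
    have "norm (frechet_derivative f (at x) w - frechet_derivative f (at y) w)
       \<le> (real DIM('a) * (m * norm (x - y))) * norm w"
    proof (rule linear_norm_bound_Basis)
      show "linear (\<lambda>w. frechet_derivative f (at x) w - frechet_derivative f (at y) w)"
        using lin xy by (intro linear_compose_sub)
      fix b :: 'a assume b: "b \<in> Basis"
      show "norm (frechet_derivative f (at x) b - frechet_derivative f (at y) b) \<le> m * norm (x - y)"
        using c(2)[OF b xy] mult_right_mono[OF m[OF b] norm_ge_zero[of "x - y"]] by linarith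
    qed
    then show "norm (frechet_derivative f (at x) w - frechet_derivative f (at y) w) \<le> real DIM('a) * m * norm (x - y) * norm w"
      by (simp add: mult_ac)
  qed
qed

text \<open>The second difference over a square of side \<open>t\<close> is symmetric in
  \<open>b\<close> and \<open>c\<close>, while the mean value theorem, used once in each direction,
  turns it into a mixed derivative taken in a chosen order.\<close>

lemma mixed_difference_mean_value:
  fixes f :: "'a::euclidean_space \<Rightarrow> real"
  assumes U: "open U" and f: "Ck_on 2 U f" and bc: "b \<in> Basis" "c \<in> Basis"
    and t: "0 < t" and sub: "cball x (2 * t) \<subseteq> U"
  shows "\<exists>y\<in>cball x (2 * t). f (x + t *\<^sub>R b + t *\<^sub>R c) - f (x + t *\<^sub>R b) - f (x + t *\<^sub>R c) + f x =
    t * (t * frechet_derivative (\<lambda>z. frechet_derivative f (at z) b) (at y) c)"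
proof -
  let ?P = "\<lambda>z. frechet_derivative f (at z) b"
  have f2: "f differentiable_on U" "?P differentiable_on U" using f bc by (auto simp: numeral_2_eq_2)
  have inball: "x + u *\<^sub>R b + v *\<^sub>R c \<in> cball x (2 * t)" if "0 \<le> u" "u \<le> t" "0 \<le> v" "v \<le> t" for u v
    using that norm_triangle_ineq4[of "- (u *\<^sub>R b)" "v *\<^sub>R c"] bc
    by (simp add: dist_norm add.assoc)
  have d1: "((\<lambda>u. f (x + u *\<^sub>R b + v *\<^sub>R c)) has_real_derivative ?P (x + u *\<^sub>R b + v *\<^sub>R c)) (at u)"
    if "0 \<le> u" "u \<le> t" "0 \<le> v" "v \<le> t" for u v
  proof -
    have df: "(f has_derivative frechet_derivative f (at (x + u *\<^sub>R b + v *\<^sub>R c))) (at (x + u *\<^sub>R b + v *\<^sub>R c))"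
      using has_frechet_derivative_on[OF U f2(1)] inball[OF that] sub by blast
    have "((\<lambda>u. x + u *\<^sub>R b + v *\<^sub>R c) has_derivative (\<lambda>h. h *\<^sub>R b)) (at u)"
      by (auto intro!: derivative_eq_intros)
    from diff_chain_at[OF this df] show ?thesis
      using linear_scale[OF has_derivative_linear[OF df]]
      by (simp add: has_field_derivative_def comp_def mult_commute_abs)
  qed
  have d2: "((\<lambda>v. ?P (x + u *\<^sub>R b + v *\<^sub>R c)) has_real_derivative
      frechet_derivative ?P (at (x + u *\<^sub>R b + v *\<^sub>R c)) c) (at v)"
    if "0 \<le> u" "u \<le> t" "0 \<le> v" "v \<le> t" for u v
  proof -
    have df: "(?P has_derivative frechet_derivative ?P (at (x + u *\<^sub>R b + v *\<^sub>R c))) (at (x + u *\<^sub>R b + v *\<^sub>R c))"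
      using has_frechet_derivative_on[OF U f2(2)] inball[OF that] sub by blast
    have "((\<lambda>v. x + u *\<^sub>R b + v *\<^sub>R c) has_derivative (\<lambda>h. h *\<^sub>R c)) (at v)"
      by (auto intro!: derivative_eq_intros)
    from diff_chain_at[OF this df] show ?thesis
      using linear_scale[OF has_derivative_linear[OF df]]
      by (simp add: has_field_derivative_def comp_def mult_commute_abs)
  qed
  let ?g = "\<lambda>u. f (x + u *\<^sub>R b + t *\<^sub>R c) - f (x + u *\<^sub>R b + 0 *\<^sub>R c)"
  have "\<exists>u. 0 < u \<and> u < t \<and> ?g t - ?g 0 =
     (t - 0) * (?P (x + u *\<^sub>R b + t *\<^sub>R c) - ?P (x + u *\<^sub>R b + 0 *\<^sub>R c))"
    using t by (intro MVT2 DERIV_diff d1) auto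
  then obtain u where u: "0 < u" "u < t" "?g t - ?g 0 =
     (t - 0) * (?P (x + u *\<^sub>R b + t *\<^sub>R c) - ?P (x + u *\<^sub>R b + 0 *\<^sub>R c))" by blast
  have "\<exists>v. 0 < v \<and> v < t \<and> ?P (x + u *\<^sub>R b + t *\<^sub>R c) - ?P (x + u *\<^sub>R b + 0 *\<^sub>R c) =
     (t - 0) * frechet_derivative ?P (at (x + u *\<^sub>R b + v *\<^sub>R c)) c"
    using t u by (intro MVT2 d2) auto
  then obtain v where v: "0 < v" "v < t" "?P (x + u *\<^sub>R b + t *\<^sub>R c) - ?P (x + u *\<^sub>R b + 0 *\<^sub>R c) =
     (t - 0) * frechet_derivative ?P (at (x + u *\<^sub>R b + v *\<^sub>R c)) c" by blast
  show ?thesis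
    using inball[of u v] u v by (intro bexI[of _ "x + u *\<^sub>R b + v *\<^sub>R c"]) auto
qed

text \<open>On a small square both orders of differentiation represent the same second difference,
  so the two mixed derivatives take a common value at points \<open>y\<close> and \<open>z\<close>
  close to \<open>x\<close>. With continuity at \<open>x\<close>, a gap of 2 \<epsilon> between
  their values there is impossible.\<close>

lemma second_partials_commute:
  fixes f :: "'a::euclidean_space \<Rightarrow> real"
  assumes U: "open U" and f: "Ck_on 2 U f" and bc: "b \<in> Basis" "c \<in> Basis" and x: "x \<in> U"
  shows "frechet_derivative (\<lambda>z. frechet_derivative f (at z) b) (at x) c =
    frechet_derivative (\<lambda>z. frechet_derivative f (at z) c) (at x) b" (is "?F x = ?G x")
proof (rule ccontr)
  assume neq: "?F x \<noteq> ?G x"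
  define \<epsilon> where "\<epsilon> = \<bar>?F x - ?G x\<bar> / 2"
  have \<epsilon>: "0 < \<epsilon>" using neq by (simp add: \<epsilon>_def)
  have cont: "isCont ?F x" "isCont ?G x"
    using f bc U x by (auto simp: numeral_2_eq_2 continuous_on_eq_continuous_at)
  obtain d1 where d1: "0 < d1" "\<And>y. dist y x < d1 \<Longrightarrow> dist (?F y) (?F x) < \<epsilon>"
    using cont(1) \<epsilon> unfolding continuous_at_eps_delta by (metis (no_types, lifting))
  obtain d2 where d2: "0 < d2" "\<And>y. dist y x < d2 \<Longrightarrow> dist (?G y) (?G x) < \<epsilon>"
    using cont(2) \<epsilon> unfolding continuous_at_eps_delta by (metis (no_types, lifting))
  obtain d3 where d3: "0 < d3" "cball x d3 \<subseteq> U" using U x open_contains_cball by blast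
  define t where "t = min d3 (min (d1/2) (d2/2)) / 2"
  have t: "0 < t" "2 * t < d1" "2 * t < d2" "2 * t \<le> d3" using d1 d2 d3 by (auto simp: t_def)
  have sub: "cball x (2 * t) \<subseteq> U" using d3(2) t(4) by (meson order_trans subset_cball)
  obtain y where y: "y \<in> cball x (2 * t)"
    "f (x + t *\<^sub>R b + t *\<^sub>R c) - f (x + t *\<^sub>R b) - f (x + t *\<^sub>R c) + f x = t * (t * ?F y)"
    using mixed_difference_mean_value[OF U f bc t(1) sub] by blast
  obtain z where z: "z \<in> cball x (2 * t)"
    "f (x + t *\<^sub>R c + t *\<^sub>R b) - f (x + t *\<^sub>R c) - f (x + t *\<^sub>R b) + f x = t * (t * ?G z)"
    using mixed_difference_mean_value[OF U f bc(2,1) t(1) sub] by blast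
  have sw: "x + t *\<^sub>R c + t *\<^sub>R b = x + t *\<^sub>R b + t *\<^sub>R c" by simp
  have "t * (t * ?F y) = t * (t * ?G z)" using y(2) z(2) unfolding sw by linarith
  then have "?F y = ?G z" using t(1) by simp
  moreover have "\<bar>?F y - ?F x\<bar> < \<epsilon>" "\<bar>?G z - ?G x\<bar> < \<epsilon>"
    using d1(2)[of y] d2(2)[of z] y(1) z(1) t by (auto simp: dist_commute dist_real_def)
  moreover have "\<not> (\<bar>p - r\<bar> < \<bar>r - s\<bar> / 2 \<and> \<bar>p - s\<bar> < \<bar>r - s\<bar> / 2)" for p r s :: real
    using dist_triangle_half_r[of p r "dist r s" s] by (auto simp: dist_real_def)
  ultimately show False unfolding \<epsilon>_def by metis
qed

section \<open>Reduced symplectic linear algebra\<close>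

text \<open>Representatives of a symplectic basis of the quotient of the \<open>w\<close>-complement
  of \<open>X\<close> by the line of \<open>X\<close>: the pointwise linear algebra behind
  \<open>reduced_symplectic_basis\<close>.\<close>

definition adapted_basis :: "(real^4 \<Rightarrow> real^4 \<Rightarrow> real) \<Rightarrow> real^4 \<Rightarrow> real^4^2 \<Rightarrow> bool" where
  "adapted_basis w X e \<longleftrightarrow> w (e $ 1) X = 0 \<and> w (e $ 2) X = 0 \<and> w (e $ 1) (e $ 2) = 1"

locale symplectic_vector_space4 =
  fixes w :: "real^4 \<Rightarrow> real^4 \<Rightarrow> real"
  assumes bil: "bilinear w" and alternating: "\<And>x. w x x = 0"
    and nondeg: "\<And>x. (\<And>y. w x y = 0) \<Longrightarrow> x = 0"
begin

lemmas bilinear_simps =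
  bilinear_ladd[OF bil] bilinear_radd[OF bil] bilinear_lmul[OF bil] bilinear_rmul[OF bil]
  bilinear_lsub[OF bil] bilinear_rsub[OF bil] bilinear_lzero[OF bil] bilinear_rzero[OF bil]
  bilinear_lneg[OF bil] bilinear_rneg[OF bil]

lemma antisym: "w x y = - w y x"
proof -
  have "w (x + y) (x + y) = w x x + w x y + (w y x + w y y)"
    by (simp only: bilinear_ladd[OF bil] bilinear_radd[OF bil])
  then show ?thesis unfolding alternating by simp
qed

lemma linear_left: "linear (\<lambda>x. w x y)" and linear_right: "linear (w x)"
  using bil by (auto simp: bilinear_def)

lemma vanish_on_span_right:
  assumes "\<And>x. x \<in> S \<Longrightarrow> w u x = 0" "x \<in> span S"
  shows "w u x = 0"
  using linear_eq_0_on_span[OF linear_right, of S u x] assms by auto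

lemma vanish_on_span_left:
  assumes "\<And>x. x \<in> S \<Longrightarrow> w x u = 0" "x \<in> span S"
  shows "w x u = 0"
proof -
  have "w u y = 0" if "y \<in> S" for y using assms(1)[OF that] antisym[of u y] by simp
  then have "w u x = 0" using assms(2) by (rule vanish_on_span_right)
  then show ?thesis using antisym[of x u] by simp
qed

text \<open>Adding the vectors in the order \<open>X\<close>, \<open>e $ 1\<close>,
  \<open>e $ 2\<close>, \<open>y\<close>, each time some pairing with a fixed vector kills the
  earlier ones but not the new one. So they are independent, and there are four of them.\<close>

lemma adapted_span:
  assumes e: "adapted_basis w X e" and X: "X \<noteq> 0" and y: "w X y \<noteq> 0"
  shows "span {X, e $ 1, e $ 2, y} = UNIV"
proof -
  have e': "w (e $ 1) X = 0" "w (e $ 2) X = 0" "w X (e $ 1) = 0" "w X (e $ 2) = 0" "w (e $ 1) (e $ 2) = 1"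
    using e antisym[of X "e $ 1"] antisym[of X "e $ 2"] by (auto simp: adapted_basis_def)
  have 1: "e $ 1 \<notin> span {X}" using vanish_on_span_left[of "{X}" "e $ 2" "e $ 1"] e' by auto
  have 2: "e $ 2 \<notin> span {e $ 1, X}"
    using vanish_on_span_right[of "{e $ 1, X}" "e $ 1" "e $ 2"] e' alternating by auto
  have 3: "y \<notin> span {e $ 2, e $ 1, X}"
    using vanish_on_span_right[of "{e $ 2, e $ 1, X}" X y] e' alternating y by auto
  have ind: "independent {y, e $ 2, e $ 1, X}"
    by (intro independent_insertI 1 2 3 independent_empty) (simp add: X)
  have "y \<notin> {e $ 2, e $ 1, X}" "e $ 2 \<notin> {e $ 1, X}" "e $ 1 \<notin> {X}"
    using 1 2 3 by (blast intro: span_base)+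
  then have "card {y, e $ 2, e $ 1, X} = 4" by simp
  then have "UNIV \<subseteq> span {y, e $ 2, e $ 1, X}"
    using card_ge_dim_independent[OF subset_UNIV ind] by simp
  moreover have "{y, e $ 2, e $ 1, X} = {X, e $ 1, e $ 2, y}" by auto
  ultimately show ?thesis by auto
qed

text \<open>The coefficients are forced by pairing with the basis. The remainder pairs to zero with
  \<open>X\<close> and both basis vectors; a multiple of \<open>X\<close> corrects its pairing with
  a fourth vector \<open>y\<close>, and nondegeneracy makes the corrected remainder vanish.\<close>

lemma adapted_decomposition:
  assumes e: "adapted_basis w X e" and X: "X \<noteq> 0" and z: "w z X = 0"
  shows "z - (\<Sum>i\<in>UNIV. (vector [w z (e $ 2), w (e $ 1) z] $ i) *\<^sub>R (e $ i)) \<in> span {X}"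
proof -
  have e': "w (e $ 1) X = 0" "w (e $ 2) X = 0" "w X (e $ 1) = 0" "w X (e $ 2) = 0"
    "w (e $ 1) (e $ 2) = 1" "w (e $ 2) (e $ 1) = -1"
    using e antisym[of X "e $ 1"] antisym[of X "e $ 2"] antisym[of "e $ 2" "e $ 1"] by (auto simp: adapted_basis_def)
  obtain y where y: "w X y \<noteq> 0" using nondeg X by blast
  define z' where "z' = z - w z (e $ 2) *\<^sub>R e $ 1 - w (e $ 1) z *\<^sub>R e $ 2"
  define z'' where "z'' = z' - (w z' y / w X y) *\<^sub>R X"
  have "w z'' u = 0" if "u \<in> {X, e $ 1, e $ 2, y}" for u
    using that e' z y antisym[of z "e $ 1"] by (auto simp: z''_def z'_def bilinear_simps alternating)
  then have "w z'' u = 0" for u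
    using vanish_on_span_right[of "{X, e $ 1, e $ 2, y}" z'' u] adapted_span[OF e X y] by auto
  then have "z'' = 0" by (rule nondeg)
  then have "z' = (w z' y / w X y) *\<^sub>R X" by (simp add: z''_def)
  then have "z' \<in> span {X}" by (metis insertI1 span_base span_scale)
  then show ?thesis by (simp add: z'_def sum_2 vector_2 algebra_simps)
qed

text \<open>The definite description is justified here: existence is the decomposition above, and
  uniqueness holds because pairing with \<open>e' $ 1\<close> and \<open>e' $ 2\<close> kills the
  line of \<open>X\<close>. The entries as pairings are what continuity and the determinant are
  later read from.\<close>

lemma induced_matrix_properties:
  assumes e': "adapted_basis w X e'" and X: "X \<noteq> 0" and L: "\<And>j. w (L (e $ j)) X = 0"
  defines "B \<equiv> induced_matrix L (span {X}) e e'"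
  shows "B $ 1 $ j = w (L (e $ j)) (e' $ 2)" "B $ 2 $ j = w (e' $ 1) (L (e $ j))"
    "L (e $ j) - (\<Sum>i\<in>UNIV. (B $ i $ j) *\<^sub>R (e' $ i)) \<in> span {X}"
    "(\<And>j. L (e $ j) - (\<Sum>i\<in>UNIV. (C $ i $ j) *\<^sub>R (e' $ i)) \<in> span {X}) \<Longrightarrow> C = B"
proof -
  have ee: "w (e' $ 1) X = 0" "w (e' $ 2) X = 0" "w X (e' $ 1) = 0" "w X (e' $ 2) = 0"
    "w (e' $ 1) (e' $ 2) = 1" "w (e' $ 2) (e' $ 1) = -1"
    using e' antisym[of X "e' $ 1"] antisym[of X "e' $ 2"] antisym[of "e' $ 2" "e' $ 1"] by (auto simp: adapted_basis_def)
  define D :: "real^2^2" where "D = (\<chi> i j. vector [w (L (e $ j)) (e' $ 2), w (e' $ 1) (L (e $ j))] $ i)"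
  have D: "\<forall>j. L (e $ j) - (\<Sum>i\<in>UNIV. (D $ i $ j) *\<^sub>R (e' $ i)) \<in> span {X}"
    using adapted_decomposition[OF e' X L] by (simp add: D_def)
  have uniq: "C = D" if C: "\<And>j. L (e $ j) - (\<Sum>i\<in>UNIV. (C $ i $ j) *\<^sub>R (e' $ i)) \<in> span {X}" for C
  proof -
    have "w (L (e $ j) - (\<Sum>i\<in>UNIV. (C $ i $ j) *\<^sub>R (e' $ i))) (e' $ 2) = 0"
       "w (e' $ 1) (L (e $ j) - (\<Sum>i\<in>UNIV. (C $ i $ j) *\<^sub>R (e' $ i))) = 0" for j
      using vanish_on_span_left[OF _ C[of j]] vanish_on_span_right[OF _ C[of j]] ee by auto
    then have "C $ 1 $ j = D $ 1 $ j" "C $ 2 $ j = D $ 2 $ j" for j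
      using ee by (auto simp: D_def sum_2 vector_2 bilinear_simps alternating)
    then show ?thesis by (simp add: vec_eq_iff forall_2)
  qed
  have "B = D"
    unfolding B_def induced_matrix_def using D uniq by (intro the_equality) auto
  then show "B $ 1 $ j = w (L (e $ j)) (e' $ 2)" "B $ 2 $ j = w (e' $ 1) (L (e $ j))"
    "L (e $ j) - (\<Sum>i\<in>UNIV. (B $ i $ j) *\<^sub>R (e' $ i)) \<in> span {X}"
    "(\<And>j. L (e $ j) - (\<Sum>i\<in>UNIV. (C $ i $ j) *\<^sub>R (e' $ i)) \<in> span {X}) \<Longrightarrow> C = B"
    using D uniq by (auto simp: D_def vector_2)
qed

text \<open>Since the images of the basis pair to zero with \<open>X\<close>, the pairing of the two
  images does not see the components along \<open>X\<close>; in the symplectic basis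
  \<open>e'\<close> it is the determinant of the coefficients.\<close>

lemma det_induced_matrix:
  assumes e': "adapted_basis w X e'" and X: "X \<noteq> 0" and L: "\<And>j. w (L (e $ j)) X = 0"
  shows "det (induced_matrix L (span {X}) e e') = w (L (e $ 1)) (L (e $ 2))"
proof -
  let ?B = "induced_matrix L (span {X}) e e'"
  have ee: "w (e' $ 1) (e' $ 2) = 1" "w (e' $ 2) (e' $ 1) = -1"
    using e' antisym[of "e' $ 2" "e' $ 1"] by (auto simp: adapted_basis_def)
  let ?n = "\<lambda>j. L (e $ j) - (\<Sum>i\<in>UNIV. (?B $ i $ j) *\<^sub>R (e' $ i))"
  have n: "?n j \<in> span {X}" for j using induced_matrix_properties(3)[of X e' L e, OF e' X L] .
  have "w (?n 1) (L (e $ 2)) = 0"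
    using vanish_on_span_left[OF _ n, of "L (e $ 2)" 1] L[of 2] antisym[of X "L (e $ 2)"] by auto
  then have "w (L (e $ 1)) (L (e $ 2)) =
      ?B $ 1 $ 1 * w (e' $ 1) (L (e $ 2)) + ?B $ 2 $ 1 * w (e' $ 2) (L (e $ 2))"
    by (simp add: sum_2 bilinear_simps)
  moreover have "w (e' $ 2) (L (e $ 2)) = - ?B $ 1 $ 2" "w (e' $ 1) (L (e $ 2)) = ?B $ 2 $ 2"
    using induced_matrix_properties(1,2)[of X e' L e, OF e' X L, of 2] antisym[of "e' $ 2" "L (e $ 2)"] by auto
  ultimately show ?thesis by (simp add: det_2)
qed

lemma trace_induced_matrix:
  assumes e: "adapted_basis w X e" and X: "X \<noteq> 0" and L: "\<And>j. w (L (e $ j)) X = 0"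
  shows "trace (induced_matrix L (span {X}) e e) = w (L (e $ 1)) (e $ 2) + w (e $ 1) (L (e $ 2))"
  using induced_matrix_properties(1,2)[of X e L e, OF e X L] by (simp add: trace_def sum_2)

text \<open>The trace is the value on the basis of the alternating form sending \<open>u\<close>,
  \<open>v\<close> to \<open>w (L u) v + w u (L v)\<close>. A change of basis multiplies such a form
  by its determinant, which is 1 between symplectic bases.\<close>

lemma trace_induced_matrix_basis_independent:
  assumes e: "adapted_basis w X e" and f: "adapted_basis w X f" and X: "X \<noteq> 0"
    and L: "linear L" "L X = X" "\<And>u v. w (L u) (L v) = w u v"
  shows "trace (induced_matrix L (span {X}) f f) = trace (induced_matrix L (span {X}) e e)"
proof -
  have LX: "w (L u) X = w u X" "w X (L u) = w X u" for u using L(2,3) by metis+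
  have ee: "w (e $ j) X = 0" "w X (e $ j) = 0" "w (f $ j) X = 0" "w X (f $ j) = 0" for j
    using e f antisym[of X "e $ j"] antisym[of X "f $ j"] exhaust_2[of j] by (auto simp: adapted_basis_def)
  have "\<exists>a b p. f $ j = a *\<^sub>R e $ 1 + b *\<^sub>R e $ 2 + p *\<^sub>R X" for j
  proof -
    have "f $ j - (\<Sum>i\<in>UNIV. (vector [w (f $ j) (e $ 2), w (e $ 1) (f $ j)] $ i) *\<^sub>R (e $ i)) \<in> span {X}"
      by (rule adapted_decomposition[OF e X ee(3)])
    then obtain p where "f $ j - (\<Sum>i\<in>UNIV. (vector [w (f $ j) (e $ 2), w (e $ 1) (f $ j)] $ i) *\<^sub>R (e $ i)) = p *\<^sub>R X"
      by (auto simp: span_singleton)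
    then have "f $ j = w (f $ j) (e $ 2) *\<^sub>R e $ 1 + w (e $ 1) (f $ j) *\<^sub>R e $ 2 + p *\<^sub>R X"
      by (simp add: sum_2 vector_2 algebra_simps)
    then show ?thesis by blast
  qed
  then obtain a b p where f_eq: "\<And>j. f $ j = a j *\<^sub>R e $ 1 + b j *\<^sub>R e $ 2 + p j *\<^sub>R X" by metis
  have "w (f $ 1) (f $ 2) = 1" using f by (simp add: adapted_basis_def)
  moreover have "w (e $ 1) (e $ 2) = 1" "w (e $ 2) (e $ 1) = -1"
    using e antisym[of "e $ 2" "e $ 1"] by (auto simp: adapted_basis_def)
  ultimately have 1: "a 1 * b 2 - b 1 * a 2 = 1"
    unfolding f_eq by (simp add: bilinear_simps alternating ee algebra_simps)
  have "w (L (f $ 1)) (f $ 2) + w (f $ 1) (L (f $ 2)) =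
    (a 1 * b 2 - b 1 * a 2) * (w (L (e $ 1)) (e $ 2) + w (e $ 1) (L (e $ 2)))"
    unfolding f_eq
    using antisym[of "L (e $ 1)" "e $ 1"] antisym[of "L (e $ 2)" "e $ 2"]
      antisym[of "L (e $ 2)" "e $ 1"] antisym[of "e $ 2" "L (e $ 1)"]
    by (simp add: linear_add[OF L(1)] linear_scale[OF L(1)] L(2) bilinear_simps alternating LX ee algebra_simps)
  then show ?thesis
    using trace_induced_matrix[OF e X, of L] trace_induced_matrix[OF f X, of L] LX ee 1 by simp
qed

text \<open>As \<open>L\<close> fixes \<open>X\<close>, the error terms along \<open>X\<close>
  remain multiples of \<open>X\<close> under a second application; the uniqueness clause for induced
  matrices then identifies the product.\<close>

lemma induced_matrix_square:
  assumes e: "adapted_basis w X e" and X: "X \<noteq> 0"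
    and L: "linear L" "L X = X" "\<And>u v. w (L u) (L v) = w u v"
  defines "B \<equiv> induced_matrix L (span {X}) e e"
  shows "induced_matrix (L \<circ> L) (span {X}) e e = B ** B"
proof -
  have LX: "w (L u) X = w u X" for u using L(2,3) by metis
  have ee: "w (e $ j) X = 0" for j
    using e exhaust_2[of j] by (auto simp: adapted_basis_def)
  have "\<exists>p. L (e $ j) = B $ 1 $ j *\<^sub>R e $ 1 + B $ 2 $ j *\<^sub>R e $ 2 + p *\<^sub>R X" for j
  proof -
    obtain p where "L (e $ j) - (\<Sum>i\<in>UNIV. (B $ i $ j) *\<^sub>R (e $ i)) = p *\<^sub>R X"
      using induced_matrix_properties(3)[OF e X, of L e j] LX ee unfolding B_def[symmetric]
      by (auto simp: span_singleton)
    then show ?thesis by (intro exI[of _ p]) (simp add: sum_2 algebra_simps)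
  qed
  then obtain p where p: "\<And>j. L (e $ j) = B $ 1 $ j *\<^sub>R e $ 1 + B $ 2 $ j *\<^sub>R e $ 2 + p j *\<^sub>R X" by metis
  have "(L \<circ> L) (e $ j) - (\<Sum>i\<in>UNIV. ((B ** B) $ i $ j) *\<^sub>R (e $ i)) =
     (B $ 1 $ j * p 1 + B $ 2 $ j * p 2 + p j) *\<^sub>R X" for j
  proof -
    have "(L \<circ> L) (e $ j) = B $ 1 $ j *\<^sub>R L (e $ 1) + B $ 2 $ j *\<^sub>R L (e $ 2) + p j *\<^sub>R X"
      by (simp add: p[of j] linear_add[OF L(1)] linear_scale[OF L(1)] L(2))
    then show ?thesis unfolding p by (simp add: sum_2 matrix_matrix_mult_def algebra_simps)
  qed
  then have "(L \<circ> L) (e $ j) - (\<Sum>i\<in>UNIV. ((B ** B) $ i $ j) *\<^sub>R (e $ i)) \<in> span {X}" for j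
    by (metis insertI1 span_base span_scale)
  then show ?thesis
    using induced_matrix_properties(4)[OF e X, of "L \<circ> L" e "B ** B"] LX ee by simp
qed

text \<open>A kernel vector of \<open>mat 1 - B\<close> gives the coefficients of a representative
  in the basis \<open>e\<close>. This produces the kind of vector that \<open>nondegenerate\<close>
  excludes.\<close>

lemma unit_eigenvector_of_induced_matrix:
  assumes e: "adapted_basis w X e" and X: "X \<noteq> 0" and L: "linear L" "\<And>j. w (L (e $ j)) X = 0"
    and det: "det (mat 1 - induced_matrix L (span {X}) e e) = 0"
  obtains \<xi> where "w \<xi> X = 0" "\<xi> \<notin> span {X}" "L \<xi> - \<xi> \<in> span {X}"
proof -
  let ?B = "induced_matrix L (span {X}) e e"
  obtain x :: "real^2" where x: "x \<noteq> 0" "(mat 1 - ?B) *v x = 0"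
    using det matrix_left_invertible_ker[of "mat 1 - ?B"] invertible_det_nz[of "mat 1 - ?B"]
    by (auto simp: invertible_left_inverse)
  then have Bx: "?B *v x = x" by (simp add: matrix_vector_mult_diff_rdistrib)
  have ee: "w (e $ 1) X = 0" "w (e $ 2) X = 0" "w (e $ 1) (e $ 2) = 1" "w X (e $ 2) = 0" "w (e $ 1) X = 0"
    using e antisym[of X "e $ 2"] by (auto simp: adapted_basis_def)
  define \<xi> where "\<xi> = x $ 1 *\<^sub>R e $ 1 + x $ 2 *\<^sub>R e $ 2"
  have "\<xi> \<notin> span {X}"
  proof
    assume "\<xi> \<in> span {X}"
    then have "w \<xi> (e $ 2) = 0" "w (e $ 1) \<xi> = 0"
      using vanish_on_span_left[of "{X}" "e $ 2" \<xi>] vanish_on_span_right[of "{X}" "e $ 1" \<xi>] ee by auto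
    then have "x $ 1 = 0" "x $ 2 = 0" using ee by (simp_all add: \<xi>_def bilinear_simps alternating)
    then show False using x(1) by (simp add: vec_eq_iff forall_2)
  qed
  moreover have "w \<xi> X = 0" using ee by (simp add: \<xi>_def bilinear_simps)
  moreover have "L \<xi> - \<xi> \<in> span {X}"
  proof -
    let ?n = "\<lambda>j. L (e $ j) - (\<Sum>i\<in>UNIV. (?B $ i $ j) *\<^sub>R (e $ i))"
    have n: "?n j \<in> span {X}" for j using induced_matrix_properties(3)[of X e L e, OF e X L(2)] .
    have "x $ i = ?B $ i $ 1 * x $ 1 + ?B $ i $ 2 * x $ 2" for i
      using arg_cong[OF Bx, of "\<lambda>y. y $ i"] by (simp add: matrix_vector_mult_def sum_2)
    then have "\<xi> = (?B $ 1 $ 1 * x $ 1 + ?B $ 1 $ 2 * x $ 2) *\<^sub>R e $ 1 + (?B $ 2 $ 1 * x $ 1 + ?B $ 2 $ 2 * x $ 2) *\<^sub>R e $ 2"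
      unfolding \<xi>_def by metis
    moreover have "L \<xi> = x $ 1 *\<^sub>R L (e $ 1) + x $ 2 *\<^sub>R L (e $ 2)"
      by (simp add: \<xi>_def linear_add[OF L(1)] linear_scale[OF L(1)])
    ultimately have eq: "L \<xi> - \<xi> = x $ 1 *\<^sub>R ?n 1 + x $ 2 *\<^sub>R ?n 2"
      by (simp add: sum_2 algebra_simps)
    show ?thesis unfolding eq by (intro span_add span_scale n)
  qed
  ultimately show ?thesis using that by blast
qed

end

text \<open>The trace of the Cayley-Hamilton identity; with determinant 1 it bounds the trace of a
  square from below by -2.\<close>

lemma trace_square_matrix2: "trace (B ** B :: real^2^2) = (trace B)\<^sup>2 - 2 * det B"
  by (simp add: trace_def matrix_matrix_mult_def sum_2 det_2 power2_eq_square algebra_simps)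

section \<open>The parity of the Conley-Zehnder index\<close>

lemma continuous_on_matrix2:
  fixes f :: "'a::topological_space \<Rightarrow> real^2^2"
  assumes "\<And>i j. continuous_on S (\<lambda>x. f x $ i $ j)"
  shows "continuous_on S f"
proof -
  have "continuous_on S (\<lambda>x. \<chi> i j. f x $ i $ j)" by (intro continuous_on_vec_lambda assms)
  then show ?thesis by simp
qed

lemma det_one_minus_matrix2: "det (mat 1 - B :: real^2^2) = 1 - trace B + det B"
  by (simp add: det_2 trace_def sum_2 mat_def algebra_simps)

lemma SL2_star_iff: "B \<in> SL2_star \<longleftrightarrow> det B = 1 \<and> trace B \<noteq> 2"
  by (auto simp: SL2_star_def det_one_minus_matrix2)

text \<open>Otherwise the matrix would be symmetric and traceless, and its determinant minus a sum
  of two squares.\<close>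

lemma unitary_part_arg_nonzero:
  fixes B :: "real^2^2"
  assumes "det B = 1"
  shows "Complex (B $ 1 $ 1 + B $ 2 $ 2) (B $ 2 $ 1 - B $ 1 $ 2) \<noteq> 0"
proof
  assume "Complex (B $ 1 $ 1 + B $ 2 $ 2) (B $ 2 $ 1 - B $ 1 $ 2) = 0"
  then have "B $ 2 $ 2 = - B $ 1 $ 1" "B $ 2 $ 1 = B $ 1 $ 2" by (auto simp: complex_eq_iff)
  with assms have "- (B $ 1 $ 1 * B $ 1 $ 1) - B $ 1 $ 2 * B $ 1 $ 2 = 1" by (simp add: det_2)
  moreover have "0 \<le> B $ 1 $ 1 * B $ 1 $ 1" "0 \<le> B $ 1 $ 2 * B $ 1 $ 2" by auto
  ultimately show False by linarith
qed

lemma norm_unitary_part: "det B = 1 \<Longrightarrow> norm (unitary_part B) = 1"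
  using unitary_part_arg_nonzero by (simp add: unitary_part_def norm_sgn)

lemma continuous_on_unitary_part:
  assumes "continuous_on S f" "\<And>x. x \<in> S \<Longrightarrow> det (f x) = 1"
  shows "continuous_on S (\<lambda>x. unitary_part (f x))"
  unfolding unitary_part_def sgn_div_norm Complex_eq
  using unitary_part_arg_nonzero[OF assms(2), unfolded Complex_eq]
  by (intro continuous_intros assms(1)) auto

lemma Re_unitary_part_pos_iff:
  assumes "det B = 1" shows "Re (unitary_part B) > 0 \<longleftrightarrow> trace B > 0"
  using unitary_part_arg_nonzero[OF assms]
  by (simp add: unitary_part_def sgn_div_norm trace_def sum_2 zero_less_mult_iff)

text \<open>\<open>tr(U P) = cos \<theta> tr P\<close> with \<open>tr P \<ge> 2\<close>.\<close>

lemma unitary_part_eq_1_imp_trace: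
  fixes B :: "real^2^2"
  assumes "det B = 1" "unitary_part B = 1" shows "trace B \<ge> 2"
proof -
  let ?z = "Complex (B $ 1 $ 1 + B $ 2 $ 2) (B $ 2 $ 1 - B $ 1 $ 2)"
  have "?z = of_real (norm ?z)"
    using assms(2) unitary_part_arg_nonzero[OF assms(1)]
    by (simp add: unitary_part_def sgn_eq)
  then have "Im ?z = 0" by (metis Im_complex_of_real)
  then have sym: "B $ 2 $ 1 = B $ 1 $ 2" by simp
  have "trace B > 0" using Re_unitary_part_pos_iff[OF assms(1)] assms(2) by simp
  moreover have "(trace B)\<^sup>2 \<ge> 2\<^sup>2"
  proof -
    have "(trace B)\<^sup>2 = 4 * det B + (B $ 1 $ 1 - B $ 2 $ 2)\<^sup>2 + 4 * (B $ 1 $ 2)\<^sup>2"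
      by (simp add: trace_def sum_2 det_2 sym power2_eq_square algebra_simps)
    then show ?thesis using assms(1) by simp
  qed
  ultimately show ?thesis using power2_le_imp_le[of 2 "trace B"] by simp
qed

section \<open>Connecting paths on either side of trace 2\<close>

text \<open>Coordinates in which \<open>SL(2,\<real>)\<close> is the quadric \<open>w\<^sup>2 + z\<^sup>2 = 1 + x\<^sup>2 + y\<^sup>2\<close> and the trace is \<open>2 w\<close>.\<close>

definition quadric_matrix :: "real \<Rightarrow> real \<Rightarrow> real \<Rightarrow> real \<Rightarrow> real^2^2" where
  "quadric_matrix w z x y = vector [vector [w + x, y + z], vector [y - z, w - x]]"

lemma det_quadric_matrix: "det (quadric_matrix w z x y) = w\<^sup>2 + z\<^sup>2 - x\<^sup>2 - y\<^sup>2"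
  by (simp add: quadric_matrix_def det_2 vector_2 power2_eq_square algebra_simps)

lemma trace_quadric_matrix: "trace (quadric_matrix w z x y) = 2 * w"
  by (simp add: quadric_matrix_def trace_def sum_2 vector_2)

lemma quadric_matrix_cases:
  fixes B :: "real^2^2"
  obtains w z x y where "B = quadric_matrix w z x y"
proof
  show "B = quadric_matrix ((B$1$1 + B$2$2)/2) ((B$1$2 - B$2$1)/2) ((B$1$1 - B$2$2)/2) ((B$1$2 + B$2$1)/2)"
    by (simp add: quadric_matrix_def vec_eq_iff forall_2 vector_2 field_simps)
qed

lemma continuous_on_quadric_matrix:
  assumes "continuous_on S w" "continuous_on S z" "continuous_on S x" "continuous_on S y"
  shows "continuous_on S (\<lambda>s. quadric_matrix (w s) (z s) (x s) (y s))"
proof (rule continuous_on_matrix2)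
  fix i j :: 2
  show "continuous_on S (\<lambda>s. quadric_matrix (w s) (z s) (x s) (y s) $ i $ j)"
    using exhaust_2[of i] exhaust_2[of j]
    by (elim disjE; simp add: quadric_matrix_def vector_2; intro continuous_intros assms)
qed

text \<open>Move \<open>(w, z)\<close> along a straight line, turn the angle of
  \<open>(x, y)\<close> to 0 and let the quadric equation determine its radius. The coordinate
  \<open>w\<close> stays above 1, which makes the radius real and keeps the trace above 2.\<close>

lemma path_in_trace_gt_2:
  fixes B :: "real^2^2"
  assumes "det B = 1" "trace B > 2"
  obtains P :: "real \<Rightarrow> real^2^2" where "continuous_on {0..1} P" "P 0 = B" "P 1 = vector [vector [2, 0], vector [0, 1/2]]"
    "\<And>s. s \<in> {0..1} \<Longrightarrow> det (P s) = 1 \<and> trace (P s) > 2"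
proof -
  obtain w z x y where B: "B = quadric_matrix w z x y" by (rule quadric_matrix_cases)
  have w: "w > 1" and q: "w\<^sup>2 + z\<^sup>2 = 1 + x\<^sup>2 + y\<^sup>2"
    using assms by (auto simp: B det_quadric_matrix trace_quadric_matrix)
  obtain r a where ra: "x = r * cos a" "y = r * sin a" "r \<ge> 0"
    using polar_Ex[of x y] by (metis (no_types, opaque_lifting) Re_rcis Im_rcis complex.sel norm_ge_zero rcis_cmod_Arg)
  have r2: "r\<^sup>2 = x\<^sup>2 + y\<^sup>2"
    using sin_cos_squared_add3[of a] by (simp add: ra power_mult_distrib power2_eq_square algebra_simps flip: distrib_left)
  \<comment> \<open>The target diag(2, 1/2) has the coordinates \<open>w = 5/4\<close>,
    \<open>z = 0\<close>, \<open>x = 3/4\<close>, \<open>y = 0\<close>.\<close>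
  define W where "W s = (1 - s) * w + s * (5/4)" for s :: real
  define Z where "Z s = (1 - s) * z" for s :: real
  define R where "R s = sqrt ((W s)\<^sup>2 + (Z s)\<^sup>2 - 1)" for s
  define P where "P s = quadric_matrix (W s) (Z s) (R s * cos ((1 - s) * a)) (R s * sin ((1 - s) * a))" for s
  have W1: "W s > 1" if "s \<in> {0..1}" for s
  proof (cases "s = 1")
    case False
    then have "(1 - s) * w > (1 - s) * 1" using that w by (intro mult_strict_left_mono) auto
    moreover have "s * (5/4) \<ge> s" using that by simp
    ultimately show ?thesis by (simp add: W_def)
  qed (simp add: W_def)
  show ?thesis
  proof (rule that[of P])
    show "continuous_on {0..1} P"
      unfolding P_def R_def W_def Z_def by (intro continuous_on_quadric_matrix continuous_intros)
    have "R 0 = r" using q r2 ra(3) by (simp add: R_def W_def Z_def real_sqrt_unique)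
    then show "P 0 = B" by (simp add: P_def B ra W_def Z_def)
    have R1: "R 1 = 3/4" unfolding R_def by (rule real_sqrt_unique) (simp_all add: W_def Z_def power2_eq_square)
    show "P 1 = vector [vector [2, 0], vector [0, 1/2]]"
      unfolding P_def R1 by (simp add: quadric_matrix_def W_def Z_def)
    fix s :: real assume s: "s \<in> {0..1}"
    have "(W s)\<^sup>2 \<ge> 1" using W1[OF s] by (simp add: one_le_power)
    then have "(R s)\<^sup>2 = (W s)\<^sup>2 + (Z s)\<^sup>2 - 1" by (simp add: R_def add_increasing2)
    moreover have "(R s * cos ((1 - s) * a))\<^sup>2 + (R s * sin ((1 - s) * a))\<^sup>2 = (R s)\<^sup>2"
      by (simp add: power_mult_distrib flip: distrib_left)
    ultimately show "det (P s) = 1 \<and> trace (P s) > 2"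
      using W1[OF s] by (simp add: P_def det_quadric_matrix trace_quadric_matrix)
  qed
qed

text \<open>Here the roles are exchanged: \<open>(x, y)\<close> shrinks linearly to 0, the quadric
  equation determines the radius of \<open>(w, z)\<close>, and the angle of \<open>(w, z)\<close>,
  measured from the negative \<open>w\<close>-axis, is turned to 0. During the motion
  \<open>w\<close> is either nonpositive or at most its initial value, because the angle moves
  towards that axis and the radius decreases.\<close>

lemma path_in_trace_lt_2:
  fixes B :: "real^2^2"
  assumes "det B = 1" "trace B < 2"
  obtains P :: "real \<Rightarrow> real^2^2" where "continuous_on {0..1} P" "P 0 = B" "P 1 = vector [vector [- 1, 0], vector [0, - 1]]"
    "\<And>s. s \<in> {0..1} \<Longrightarrow> det (P s) = 1 \<and> trace (P s) < 2"
proof -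
  obtain w z x y where B: "B = quadric_matrix w z x y" by (rule quadric_matrix_cases)
  have w: "w < 1" and q: "w\<^sup>2 + z\<^sup>2 = 1 + x\<^sup>2 + y\<^sup>2"
    using assms by (auto simp: B det_quadric_matrix trace_quadric_matrix)
  define r where "r = sqrt (w\<^sup>2 + z\<^sup>2)"
  have r2: "r\<^sup>2 = 1 + x\<^sup>2 + y\<^sup>2" "r \<ge> 1" using q by (auto simp: r_def)
  have "(- w / r)\<^sup>2 + (- z / r)\<^sup>2 = 1"
    using r2 q add_pos_nonneg[of 1 "x\<^sup>2 + y\<^sup>2"]
    by (simp add: power_divide add.assoc flip: add_divide_distrib)
  then obtain b where b: "- w / r = cos b" "- z / r = sin b" "-pi < b" "b \<le> pi"
    using sincos_principal_value[of "Arg (Complex (- w / r) (- z / r))"]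
    by (metis (no_types, lifting) Arg_bounded cis_Arg complex_norm complex.sel(1,2) cis.sel(1,2) norm_eq_zero real_sqrt_one zero_neq_one sgn_eq div_by_1 of_real_1)
  have wz: "w = - r * cos b" "z = - r * sin b" using b(1,2) r2(2) by (auto simp: field_simps)
  define R where "R s = sqrt (1 + (1 - s)\<^sup>2 * (x\<^sup>2 + y\<^sup>2))" for s :: real
  define P where "P s = quadric_matrix (- R s * cos ((1 - s) * b)) (- R s * sin ((1 - s) * b)) ((1 - s) * x) ((1 - s) * y)" for s
  show ?thesis
  proof (rule that[of P])
    show "continuous_on {0..1} P"
      unfolding P_def R_def by (intro continuous_on_quadric_matrix continuous_intros)
    have "R 0 = r" using r2 by (simp add: R_def real_sqrt_unique)
    then show "P 0 = B" by (simp add: P_def B wz)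
    show "P 1 = vector [vector [- 1, 0], vector [0, - 1]]"
      by (simp add: P_def quadric_matrix_def R_def)
    fix s :: real assume s: "s \<in> {0..1}"
    have R2: "(R s)\<^sup>2 = 1 + (1 - s)\<^sup>2 * (x\<^sup>2 + y\<^sup>2)" "0 \<le> R s" by (simp_all add: R_def)
    have "(R s * cos ((1 - s) * b))\<^sup>2 + (R s * sin ((1 - s) * b))\<^sup>2 = (R s)\<^sup>2"
      by (simp add: power_mult_distrib flip: distrib_left)
    then have "det (P s) = (R s)\<^sup>2 - ((1 - s) * x)\<^sup>2 - ((1 - s) * y)\<^sup>2"
      by (simp add: P_def det_quadric_matrix)
    then have "det (P s) = 1" unfolding R2(1) by (simp add: power_mult_distrib distrib_left)
    moreover have "- R s * cos ((1 - s) * b) < 1"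
    proof (cases "cos ((1 - s) * b) \<ge> 0")
      case True
      then have "0 \<le> R s * cos ((1 - s) * b)" using R2(2) by simp
      then show ?thesis by linarith
    next
      case False
      have "(1 - s) * \<bar>b\<bar> \<le> \<bar>b\<bar>" using s by (simp add: mult_left_le_one_le)
      then have "cos \<bar>b\<bar> \<le> cos ((1 - s) * \<bar>b\<bar>)" using s b(3,4)
        by (intro cos_monotone_0_pi_le) auto
      moreover have "cos ((1 - s) * \<bar>b\<bar>) = cos ((1 - s) * b)" by (cases "b \<ge> 0") auto
      ultimately have "cos b \<le> cos ((1 - s) * b)" by simp
      moreover have "R s \<le> r"
      proof -
        have "(1 - s)\<^sup>2 \<le> 1" using s by (simp add: power_le_one)
        then have "(1 - s)\<^sup>2 * (x\<^sup>2 + y\<^sup>2) \<le> x\<^sup>2 + y\<^sup>2" by (simp add: mult_left_le_one_le)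
        then show ?thesis using q by (simp add: R_def r_def)
      qed
      ultimately have "R s * (- cos ((1 - s) * b)) \<le> r * (- cos b)"
        using False R2(2) r2(2) by (intro mult_mono) auto
      then show ?thesis using wz(1) w by simp
    qed
    ultimately show "det (P s) = 1 \<and> trace (P s) < 2"
      by (simp add: P_def trace_quadric_matrix)
  qed
qed

section \<open>Continuous angles and their increments\<close>

lemma floor_constant_if_avoids_Ints:
  fixes g :: "real \<Rightarrow> real"
  assumes "a \<le> b" "continuous_on {a..b} g" "\<And>t. t \<in> {a..b} \<Longrightarrow> g t \<notin> \<int>"
  shows "\<lfloor>g a\<rfloor> = \<lfloor>g b\<rfloor>"
proof (rule ccontr)
  assume "\<lfloor>g a\<rfloor> \<noteq> \<lfloor>g b\<rfloor>"
  then consider "\<lfloor>g a\<rfloor> < \<lfloor>g b\<rfloor>" | "\<lfloor>g b\<rfloor> < \<lfloor>g a\<rfloor>" by linarith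
  then obtain n :: int where "g a \<le> n \<and> n \<le> g b \<or> g b \<le> n \<and> n \<le> g a"
  proof cases
    case 1
    then show ?thesis using that[of "\<lfloor>g b\<rfloor>"] by linarith
  next
    case 2
    then show ?thesis using that[of "\<lfloor>g a\<rfloor>"] by linarith
  qed
  then obtain t where "t \<in> {a..b}" "g t = n"
    using IVT'[of g a n b] IVT2'[of g b n a] assms(1,2) by auto
  then show False using assms(3) Ints_of_int by metis
qed

lemma cis_eq_iff_Ints: "cis x = cis y \<longleftrightarrow> (x - y) / (2 * pi) \<in> \<int>"
proof -
  have "cis x = cis y \<longleftrightarrow> cis (x - y) = 1"
    by (metis cis_divide cis_neq_zero div_self nonzero_divide_eq_eq mult_1)
  also have "\<dots> \<longleftrightarrow> cos (x - y) = 1"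
    by (auto simp: complex_eq_iff cos_one_sin_zero)
  also have "\<dots> \<longleftrightarrow> (\<exists>n::int. x - y = n * 2 * pi)" by (rule cos_one_2pi_int)
  also have "\<dots> \<longleftrightarrow> (x - y) / (2 * pi) \<in> \<int>"
    by (auto simp: Ints_def field_simps)
  finally show ?thesis .
qed

lemma angle_difference_constant:
  fixes \<alpha> \<beta> :: "real \<Rightarrow> real"
  assumes "a \<le> b" "continuous_on {a..b} \<alpha>" "continuous_on {a..b} \<beta>"
    and "\<And>t. t \<in> {a..b} \<Longrightarrow> cis (\<alpha> t) = cis (\<beta> t)"
  shows "\<alpha> b - \<beta> b = \<alpha> a - \<beta> a"
proof -
  define g where "g t = (\<alpha> t - \<beta> t) / (2 * pi)" for t
  have g: "g t \<in> \<int>" if "t \<in> {a..b}" for t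
    using assms(4)[OF that] by (simp add: g_def cis_eq_iff_Ints)
  \<comment> \<open>The function \<open>g\<close> takes only integer values, so the shift by 1/2
    makes it avoid the integers and its floor constant.\<close>
  have "\<lfloor>g a + 1/2\<rfloor> = \<lfloor>g b + 1/2\<rfloor>"
  proof (rule floor_constant_if_avoids_Ints[OF assms(1)])
    show "continuous_on {a..b} (\<lambda>t. g t + 1/2)"
      unfolding g_def by (intro continuous_intros assms) auto
    fix t assume "t \<in> {a..b}"
    from g[OF this] obtain n :: int where n: "g t = n" by (auto elim: Ints_cases)
    show "g t + 1/2 \<notin> \<int>"
    proof
      assume "g t + 1/2 \<in> \<int>"
      then obtain m :: int where "g t + 1/2 = m" by (auto elim: Ints_cases)
      then have "real_of_int (2 * n + 1) = real_of_int (2 * m)" using n by simp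
      then have "2 * n + 1 = 2 * m" by (simp only: of_int_eq_iff)
      then show False by presburger
    qed
  qed
  moreover obtain m n :: int where "g a = m" "g b = n" using g[of a] g[of b] assms(1) by (auto elim!: Ints_cases)
  ultimately have "g a = g b" by simp
  then show ?thesis by (simp add: g_def)
qed

text \<open>A continuous angle that never points in the direction \<open>c\<close> stays between two
  consecutive values of \<open>c\<close> modulo 2 pi, and in such an interval an angle is determined
  by its point on the circle.\<close>

lemma angle_avoiding_value:
  fixes \<alpha> \<beta> :: "real \<Rightarrow> real"
  assumes "a \<le> b" "continuous_on {a..b} \<alpha>" "continuous_on {a..b} \<beta>" "\<alpha> a = \<beta> a" "cis (\<alpha> b) = cis (\<beta> b)"
    and "\<And>t. t \<in> {a..b} \<Longrightarrow> cis (\<alpha> t) \<noteq> cis c" "\<And>t. t \<in> {a..b} \<Longrightarrow> cis (\<beta> t) \<noteq> cis c"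
  shows "\<alpha> b = \<beta> b"
proof -
  have "\<lfloor>(\<alpha> a - c) / (2 * pi)\<rfloor> = \<lfloor>(\<alpha> b - c) / (2 * pi)\<rfloor>"
    using assms(6) by (intro floor_constant_if_avoids_Ints[OF assms(1)] continuous_intros assms)
      (auto simp flip: cis_eq_iff_Ints)
  moreover have "\<lfloor>(\<beta> a - c) / (2 * pi)\<rfloor> = \<lfloor>(\<beta> b - c) / (2 * pi)\<rfloor>"
    using assms(7) by (intro floor_constant_if_avoids_Ints[OF assms(1)] continuous_intros assms)
      (auto simp flip: cis_eq_iff_Ints)
  moreover obtain n :: int where n: "(\<alpha> b - \<beta> b) / (2 * pi) = n"
    using assms(5) by (auto simp: cis_eq_iff_Ints elim: Ints_cases)
  then have "(\<alpha> b - c) / (2 * pi) = (\<beta> b - c) / (2 * pi) + n" by (simp add: diff_divide_distrib)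
  ultimately have "n = 0" using assms(4) by simp
  then show ?thesis using n by simp
qed

section \<open>Existence, uniqueness and parity of the index\<close>

lemma unitary_part_mat_1: "unitary_part (mat 1) = 1"
  by (simp add: unitary_part_def mat_def complex_eq_iff sgn_div_norm cmod_def)

text \<open>The condition under the definite description in \<open>CZ_index\<close>, with the path
  and the angle as parameters so that different witnesses can be compared.\<close>

definition CZ_extension :: "(real \<Rightarrow> real^2^2) \<Rightarrow> (real \<Rightarrow> real^2^2) \<Rightarrow> (real \<Rightarrow> real) \<Rightarrow> int \<Rightarrow> bool" where
  "CZ_extension \<Psi> \<Gamma> \<alpha> k \<longleftrightarrow>
     continuous_on {0..2} \<Gamma> \<and> (\<forall>t\<in>{0..1}. \<Gamma> t = \<Psi> t) \<and> (\<forall>t\<in>{1..2}. \<Gamma> t \<in> SL2_star) \<and>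
     \<Gamma> 2 \<in> {vector [vector [- 1, 0], vector [0, - 1]], vector [vector [2, 0], vector [0, 1/2]]} \<and>
     continuous_on {0..2} \<alpha> \<and> (\<forall>t\<in>{0..2}. unitary_part (\<Gamma> t) = cis (\<alpha> t)) \<and>
     \<alpha> 2 - \<alpha> 0 = pi * of_int k"

lemma CZ_index_eq: "CZ_index \<Psi> = (THE k. \<exists>\<Gamma> \<alpha>. CZ_extension \<Psi> \<Gamma> \<alpha> k)"
  by (simp add: CZ_index_def CZ_extension_def)

text \<open>Trace 2 is excluded on \<open>SL2_star\<close>, so by the intermediate value theorem the
  extension cannot change sides.\<close>

lemma CZ_extension_trace:
  assumes "CZ_extension \<Psi> \<Gamma> \<alpha> k" "t \<in> {1..2}"
  shows "trace (\<Gamma> t) < 2 \<longleftrightarrow> trace (\<Psi> 1) < 2"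
proof -
  have c: "continuous_on {1..2} (\<lambda>t. trace (\<Gamma> t))"
    using assms(1) unfolding CZ_extension_def trace_def
    by (auto intro!: continuous_intros intro: continuous_on_subset)
  have ne: "trace (\<Gamma> s) \<noteq> 2" if "s \<in> {1..2}" for s
    using assms(1) that by (auto simp: CZ_extension_def SL2_star_iff)
  have c': "continuous_on {1..t} (\<lambda>t. trace (\<Gamma> t))"
    using c assms(2) by (auto intro: continuous_on_subset)
  have eq: "\<Gamma> 1 = \<Psi> 1" using assms(1) by (simp add: CZ_extension_def)
  show ?thesis
  proof (rule ccontr)
    assume "\<not> ?thesis"
    then obtain s where "s \<in> {1..t}" "trace (\<Gamma> s) = 2"
      using IVT'[of "\<lambda>t. trace (\<Gamma> t)" 1 2 t] IVT2'[of "\<lambda>t. trace (\<Gamma> t)" t 2 1] c' assms(2) unfolding eq[symmetric]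
      by (metis atLeastAtMost_iff linorder_le_cases order.order_iff_strict not_less)
    then show False using ne assms(2) by auto
  qed
qed

text \<open>The two model matrices have traces -2 and 5/2, so the side of the extension singles out
  one of them; their unitary parts are -1 and 1.\<close>

lemma CZ_extension_end:
  assumes "CZ_extension \<Psi> \<Gamma> \<alpha> k"
  shows "cis (\<alpha> 2) = (if trace (\<Psi> 1) < 2 then -1 else 1)"
proof -
  have "cis (\<alpha> 2) = unitary_part (\<Gamma> 2)" using assms by (auto simp: CZ_extension_def)
  moreover have "\<Gamma> 2 = vector [vector [- 1, 0], vector [0, - 1]] \<or> \<Gamma> 2 = vector [vector [2, 0], vector [0, 1/2]]"
    using assms by (auto simp: CZ_extension_def)
  ultimately show ?thesis using CZ_extension_trace[OF assms, of 2]
    by (auto simp: unitary_part_def complex_eq_iff sgn_div_norm cmod_def trace_def sum_2 vector_2)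
qed

text \<open>On \<open>{0..1}\<close> both angles lift the same curve and differ by a constant. On
  \<open>{1..2}\<close> the paths may differ, but both unitary parts avoid the same point of the
  circle and reach the same end point, so the angles make the same increment.\<close>

lemma CZ_extension_unique:
  assumes 1: "CZ_extension \<Psi> \<Gamma> \<alpha> k" and 2: "CZ_extension \<Psi> \<Gamma>' \<alpha>' k'"
  shows "k = k'"
proof -
  have c: "continuous_on {0..2} \<alpha>" "continuous_on {0..2} \<alpha>'" using 1 2 by (auto simp: CZ_extension_def)
  have u: "cis (\<alpha> t) = unitary_part (\<Gamma> t)" "cis (\<alpha>' t) = unitary_part (\<Gamma>' t)" if "t \<in> {0..2}" for t
    using 1 2 that by (auto simp: CZ_extension_def)
  have d: "\<alpha> 1 - \<alpha>' 1 = \<alpha> 0 - \<alpha>' 0"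
  proof (rule angle_difference_constant)
    show "continuous_on {0..1} \<alpha>" "continuous_on {0..1} \<alpha>'" using c by (auto intro: continuous_on_subset)
    show "cis (\<alpha> t) = cis (\<alpha>' t)" if "t \<in> {0..1}" for t
      using u[of t] 1 2 that by (auto simp: CZ_extension_def)
  qed auto
  have cis1: "cis (\<alpha>' t + (\<alpha> 1 - \<alpha>' 1)) = cis (\<alpha>' t)" for t
  proof -
    have "cis (\<alpha> 1) = cis (\<alpha>' 1)" using u[of 1] 1 2 by (auto simp: CZ_extension_def)
    then show ?thesis unfolding cis_eq_iff_Ints by simp
  qed
  \<comment> \<open>The omitted direction: unitary part 1 forces trace at least 2, whereas trace
    above 2 forces a positive real part and so excludes -1.\<close>
  define c0 where "c0 = (if trace (\<Psi> 1) < 2 then 0 else pi)"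
  have avoid: "cis (\<beta> t) \<noteq> cis c0"
    if "CZ_extension \<Psi> G \<beta> l" "t \<in> {1..2}" for G \<beta> l t
  proof -
    have b: "cis (\<beta> t) = unitary_part (G t)" "det (G t) = 1" "trace (G t) \<noteq> 2"
      using that by (auto simp: CZ_extension_def SL2_star_iff)
    show ?thesis
    proof (cases "trace (\<Psi> 1) < 2")
      case True
      then show ?thesis using CZ_extension_trace[OF that] unitary_part_eq_1_imp_trace[OF b(2)] b(1)
        by (auto simp: c0_def)
    next
      case False
      then have "Re (cis (\<beta> t)) > 0"
        using CZ_extension_trace[OF that] Re_unitary_part_pos_iff[OF b(2)] b by auto
      then have "cis (\<beta> t) \<noteq> -1" by (metis Re_complex_of_real of_real_1 of_real_minus not_one_less_zero neg_0_less_iff_less)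
      then show ?thesis using False by (simp add: c0_def)
    qed
  qed
  have "\<alpha> 2 = \<alpha>' 2 + (\<alpha> 1 - \<alpha>' 1)"
  proof (rule angle_avoiding_value[where c=c0 and a=1 and b=2 and \<alpha>=\<alpha> and \<beta>="\<lambda>t. \<alpha>' t + (\<alpha> 1 - \<alpha>' 1)"])
    show "continuous_on {1..2} \<alpha>" "continuous_on {1..2} (\<lambda>t. \<alpha>' t + (\<alpha> 1 - \<alpha>' 1))"
      using c by (auto intro: continuous_on_subset intro!: continuous_intros)
    show "cis (\<alpha> 2) = cis (\<alpha>' 2 + (\<alpha> 1 - \<alpha>' 1))"
      using CZ_extension_end[OF 1] CZ_extension_end[OF 2] cis1 by simp
  qed (use avoid[OF 1] avoid[OF 2] cis1 in auto)
  then have "\<alpha> 2 - \<alpha> 0 = \<alpha>' 2 - \<alpha>' 0" using d by simp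
  then show ?thesis using 1 2 by (simp add: CZ_extension_def)
qed

text \<open>A connecting path to a model matrix is attached on \<open>{1..2}\<close>. The unitary
  part along the result has a continuous logarithm because the interval is contractible, and its
  imaginary part is the angle. The increment is a multiple of pi, since the unitary part goes from 1
  to 1 or -1.\<close>

lemma CZ_extension_exists:
  assumes \<Psi>: "continuous_on {0..1} \<Psi>" "\<And>t. t \<in> {0..1} \<Longrightarrow> det (\<Psi> t) = 1"
    and start: "\<Psi> 0 = mat 1" and ne: "trace (\<Psi> 1) \<noteq> 2"
  obtains \<Gamma> \<alpha> k where "CZ_extension \<Psi> \<Gamma> \<alpha> k"
proof -
  obtain P :: "real \<Rightarrow> real^2^2" where P: "continuous_on {0..1} P" "P 0 = \<Psi> 1"
    "P 1 \<in> {vector [vector [- 1, 0], vector [0, - 1]], vector [vector [2, 0], vector [0, 1/2]]}"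
    "\<And>s. s \<in> {0..1} \<Longrightarrow> P s \<in> SL2_star"
  proof (cases "trace (\<Psi> 1) < 2")
    case True
    show ?thesis
      using path_in_trace_lt_2[OF \<Psi>(2) True] that by (metis SL2_star_iff atLeastAtMost_iff insertCI less_irrefl zero_le_one order_refl)
  next
    case False
    then have gt: "trace (\<Psi> 1) > 2" using ne by simp
    show ?thesis
      using path_in_trace_gt_2[OF \<Psi>(2) gt] that by (metis SL2_star_iff atLeastAtMost_iff insertCI less_irrefl zero_le_one order_refl)
  qed
  define \<Gamma> where "\<Gamma> t = (if t \<le> 1 then \<Psi> t else P (t - 1))" for t :: real
  have c: "continuous_on {0..2} \<Gamma>"
  proof -
    have "continuous_on ({0..1} \<union> {1..2}) \<Gamma>"
      unfolding \<Gamma>_def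
    proof (rule continuous_on_If)
      show "continuous_on {1..2} (\<lambda>t. P (t - 1))"
        by (rule continuous_on_compose2[OF P(1)]) (auto intro!: continuous_intros)
    qed (use \<Psi>(1) P(2) in auto)
    moreover have "{0..1} \<union> {1..2::real} = {0..2}" by auto
    ultimately show ?thesis by simp
  qed
  have S: "\<Gamma> t \<in> SL2_star" if "t \<in> {1..2}" for t
  proof (cases "t = 1")
    case True
    then show ?thesis using ne \<Psi>(2)[of 1] by (simp add: \<Gamma>_def SL2_star_iff)
  qed (use that P(4)[of "t - 1"] in \<open>auto simp: \<Gamma>_def\<close>)
  have det: "det (\<Gamma> t) = 1" if "t \<in> {0..2}" for t
    using S[of t] \<Psi>(2)[of t] that by (cases "t \<le> 1") (auto simp: \<Gamma>_def SL2_star_iff)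
  have cu: "continuous_on {0..2} (\<lambda>t. unitary_part (\<Gamma> t))"
    by (rule continuous_on_unitary_part[OF c det])
  moreover have nz: "unitary_part (\<Gamma> t) \<noteq> 0" if "t \<in> {0..2}" for t
    using norm_unitary_part[OF det[OF that]] by auto
  ultimately obtain g where g: "continuous_on {0..2} g" "\<And>t. t \<in> {0..2} \<Longrightarrow> unitary_part (\<Gamma> t) = exp (g t)"
    using continuous_logarithm_on_contractible[OF cu convex_imp_contractible] by (metis convex_real_interval(5))
  define \<alpha> where "\<alpha> t = Im (g t)" for t
  have ca: "continuous_on {0..2} \<alpha>" unfolding \<alpha>_def by (intro continuous_intros g)
  have a: "unitary_part (\<Gamma> t) = cis (\<alpha> t)" if "t \<in> {0..2}" for t
  proof -
    have "exp (Re (g t)) = 1" using norm_unitary_part[OF det[OF that]] g(2)[OF that] by simp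
    then show ?thesis using g(2)[OF that] by (simp add: \<alpha>_def exp_eq_polar)
  qed
  have "sin (\<alpha> 2 - \<alpha> 0) = 0"
  proof -
    have 0: "cis (\<alpha> 0) = 1" using a[of 0] start by (simp add: \<Gamma>_def unitary_part_mat_1)
    have "cis (\<alpha> 2) = 1 \<or> cis (\<alpha> 2) = -1"
      using a[of 2, symmetric] P(3) by (auto simp: \<Gamma>_def unitary_part_def complex_eq_iff sgn_div_norm cmod_def vector_2)
    then have "sin (\<alpha> 2) = 0" by (auto simp: complex_eq_iff)
    then show ?thesis using 0 by (simp add: sin_diff complex_eq_iff)
  qed
  then obtain k :: int where "\<alpha> 2 - \<alpha> 0 = of_int k * pi" using sin_zero_iff_int2 by blast
  then have "CZ_extension \<Psi> \<Gamma> \<alpha> k"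
    using c S P(3) ca a by (auto simp: CZ_extension_def \<Gamma>_def)
  then show ?thesis by (rule that)
qed

text \<open>With unitary part 1 at the start and angle increment \<open>pi * k\<close>, the unitary
  part at the end is 1 or -1 according to the parity of \<open>k\<close>;
  \<open>CZ_extension_end\<close> compares this with the trace.\<close>

theorem odd_CZ_index_iff:
  assumes \<Psi>: "continuous_on {0..1} \<Psi>" "\<And>t. t \<in> {0..1} \<Longrightarrow> det (\<Psi> t) = 1"
    and start: "\<Psi> 0 = mat 1" and ne: "trace (\<Psi> 1) \<noteq> 2"
  shows "odd (CZ_index \<Psi>) \<longleftrightarrow> trace (\<Psi> 1) < 2"
proof -
  obtain \<Gamma> \<alpha> k where k: "CZ_extension \<Psi> \<Gamma> \<alpha> k" using CZ_extension_exists[OF assms] by blast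
  then have ind: "CZ_index \<Psi> = k"
    unfolding CZ_index_eq by (intro the_equality) (auto intro: CZ_extension_unique)
  have u: "\<forall>t\<in>{0..2}. unitary_part (\<Gamma> t) = cis (\<alpha> t)" and e: "\<forall>t\<in>{0..1}. \<Gamma> t = \<Psi> t"
    using k by (auto simp: CZ_extension_def)
  have "unitary_part (\<Gamma> 0) = cis (\<alpha> 0)" using u by simp
  moreover have "\<Gamma> 0 = \<Psi> 0" using e by simp
  ultimately have 0: "cis (\<alpha> 0) = 1" using start by (simp add: unitary_part_mat_1)
  have "\<alpha> 2 = \<alpha> 0 + pi * of_int k" using k by (simp add: CZ_extension_def)
  then have "cis (\<alpha> 2) = cis (pi * of_int k)" using 0 by (simp flip: cis_mult)
  then have "cos (pi * of_int k) = (if trace (\<Psi> 1) < 2 then -1 else 1)"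
    using CZ_extension_end[OF k] by (simp add: complex_eq_iff split: if_splits)
  moreover have "cos (pi * of_int k) = (if even k then 1 else -1)"
    by simp
  ultimately show ?thesis unfolding ind by (auto split: if_splits)
qed

section \<open>Calculus in charts\<close>

text \<open>A relation instead of a chosen derivative, and for an arbitrary chart: it records
  differentiability and lets the chain rule pass through any convenient chart.\<close>

definition has_chart_derivative ::
  "'a::t2_space chart \<Rightarrow> ('a \<Rightarrow> 'b::real_normed_vector) \<Rightarrow> 'a \<Rightarrow> (real^4 \<Rightarrow> 'b) \<Rightarrow> bool" where
  "has_chart_derivative c f p D \<longleftrightarrow> ((f \<circ> chart_inv c) has_derivative D) (at (chart_map c p))"

text \<open>Continuity has to be demanded separately. The map of \<open>d\<close> is meaningful on
  its domain only, so a differentiable coordinate expression does not force points near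
  \<open>p\<close> to be mapped into that domain.\<close>

definition has_charts_derivative ::
  "'a::t2_space chart \<Rightarrow> 'a chart \<Rightarrow> ('a \<Rightarrow> 'a) \<Rightarrow> 'a \<Rightarrow> (real^4 \<Rightarrow> real^4) \<Rightarrow> bool" where
  "has_charts_derivative c d f p D \<longleftrightarrow> isCont f p \<and> has_chart_derivative c (chart_map d \<circ> f) p D"

definition has_chart_velocity :: "'a::t2_space chart \<Rightarrow> (real \<Rightarrow> 'a) \<Rightarrow> real^4 \<Rightarrow> real \<Rightarrow> bool" where
  "has_chart_velocity c \<gamma> \<xi> t \<longleftrightarrow> isCont \<gamma> t \<and> ((chart_map c \<circ> \<gamma>) has_vector_derivative \<xi>) (at t)"

text \<open>\<open>tangent_map\<close> returns some linear or nonlinear map even where the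
  derivative fails to exist; this certifies that its value is the derivative.\<close>

definition has_tangent_map :: "'a::t2_space chart set \<Rightarrow> ('a \<Rightarrow> 'a) \<Rightarrow> 'a \<Rightarrow> bool" where
  "has_tangent_map A f p \<longleftrightarrow>
     has_charts_derivative (chart_at A p) (chart_at A (f p)) f p (tangent_map A f p)"

lemma isCont_open_preimage:
  assumes "isCont f p" "open V" "f p \<in> V"
  obtains W where "open W" "p \<in> W" "f ` W \<subseteq> V"
proof -
  have "eventually (\<lambda>q. f q \<in> V) (at p)"
    using assms topological_tendstoD[of f "f p" "at p" V] by (simp add: isCont_def)
  then obtain W where "open W" "p \<in> W" "\<And>q. q \<in> W \<Longrightarrow> q \<noteq> p \<Longrightarrow> f q \<in> V"
    by (auto simp: eventually_at_topological)
  then show ?thesis using assms(3) by (intro that[of W]) auto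
qed

locale atlas =
  fixes A :: "'a::{t2_space,second_countable_topology} chart set"
  assumes smooth_atlas: "smooth_atlas A"
begin

abbreviation "ch \<equiv> chart_at A"

lemma chart_at_props [simp]: "ch p \<in> A" "p \<in> chart_dom (ch p)"
proof -
  have "(\<Union>c\<in>A. chart_dom c) = UNIV" using smooth_atlas by (simp add: smooth_atlas_def)
  then have "\<exists>c. c \<in> A \<and> p \<in> chart_dom c" by blast
  then show "ch p \<in> A" "p \<in> chart_dom (ch p)"
    unfolding chart_at_def by (metis (mono_tags, lifting) someI_ex)+
qed

lemma chart_props:
  assumes "c \<in> A"
  shows open_chart_dom: "open (chart_dom c)" and open_chart_image: "open (chart_image c)"
    and chart_inv_map: "p \<in> chart_dom c \<Longrightarrow> chart_inv c (chart_map c p) = p"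
    and chart_map_inv: "x \<in> chart_image c \<Longrightarrow> chart_map c (chart_inv c x) = x"
    and chart_map_in: "p \<in> chart_dom c \<Longrightarrow> chart_map c p \<in> chart_image c"
    and chart_inv_in: "x \<in> chart_image c \<Longrightarrow> chart_inv c x \<in> chart_dom c"
    and continuous_on_chart_map: "continuous_on (chart_dom c) (chart_map c)"
    and continuous_on_chart_inv: "continuous_on (chart_image c) (chart_inv c)"
proof -
  have h: "open (chart_dom c)" "open (chart_image c)"
    "homeomorphism (chart_dom c) (chart_image c) (chart_map c) (chart_inv c)"
    using smooth_atlas assms by (auto simp: smooth_atlas_def)
  show "open (chart_dom c)" "open (chart_image c)" by (fact h)+
  show "p \<in> chart_dom c \<Longrightarrow> chart_inv c (chart_map c p) = p"
     "x \<in> chart_image c \<Longrightarrow> chart_map c (chart_inv c x) = x"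
     "p \<in> chart_dom c \<Longrightarrow> chart_map c p \<in> chart_image c"
     "x \<in> chart_image c \<Longrightarrow> chart_inv c x \<in> chart_dom c"
     "continuous_on (chart_dom c) (chart_map c)" "continuous_on (chart_image c) (chart_inv c)"
    using h(3) unfolding homeomorphism_def by auto
qed

lemma isCont_chart_map: "c \<in> A \<Longrightarrow> p \<in> chart_dom c \<Longrightarrow> isCont (chart_map c) p"
  using continuous_on_chart_map open_chart_dom continuous_on_eq_continuous_at by blast

lemma isCont_chart_inv: "c \<in> A \<Longrightarrow> x \<in> chart_image c \<Longrightarrow> isCont (chart_inv c) x"
  using continuous_on_chart_inv open_chart_image continuous_on_eq_continuous_at by blast

lemma open_chart_map_image:
  assumes "c \<in> A" "open W" shows "open (chart_map c ` (chart_dom c \<inter> W))"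
proof -
  have "chart_map c ` (chart_dom c \<inter> W) = chart_image c \<inter> chart_inv c -` W"
    using chart_props[OF assms(1)] by (force simp: chart_image_def)
  then show ?thesis
    using continuous_openin_preimage_gen[OF continuous_on_chart_inv[OF assms(1)] assms(2)]
      open_chart_image[OF assms(1)] by (simp add: openin_open_eq)
qed

lemma open_chart_dom_preimage:
  assumes "c \<in> A" "open V" shows "open (chart_dom c \<inter> chart_map c -` V)"
  using continuous_openin_preimage_gen[OF continuous_on_chart_map[OF assms(1)] assms(2)]
    open_chart_dom[OF assms(1)] by (simp add: openin_open_eq)

lemma has_chart_derivative_cong:
  assumes "c \<in> A" "p \<in> chart_dom c" "open W" "p \<in> W" "\<And>q. q \<in> W \<Longrightarrow> f q = g q"
    and "has_chart_derivative c f p D"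
  shows "has_chart_derivative c g p D"
  unfolding has_chart_derivative_def
proof (rule has_derivative_transform_within_open[OF assms(6)[unfolded has_chart_derivative_def]])
  show "open (chart_map c ` (chart_dom c \<inter> W))" by (rule open_chart_map_image[OF assms(1,3)])
qed (use assms chart_inv_map[OF assms(1)] in auto)

lemma has_chart_derivative_compose:
  assumes c: "c \<in> A" "p \<in> chart_dom c" and d: "d \<in> A" "f p \<in> chart_dom d"
    and f: "has_charts_derivative c d f p D" and h: "has_chart_derivative d h (f p) E"
  shows "has_chart_derivative c (h \<circ> f) p (E \<circ> D)"
proof -
  obtain W where W: "open W" "p \<in> W" "f ` W \<subseteq> chart_dom d"
    using isCont_open_preimage[where f=f and p=p and V="chart_dom d"] open_chart_dom[OF d(1)] d(2) f
    by (auto simp: has_charts_derivative_def)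
  have "((chart_map d \<circ> f \<circ> chart_inv c) has_derivative D) (at (chart_map c p))"
    using f by (simp add: has_charts_derivative_def has_chart_derivative_def)
  moreover have "((h \<circ> chart_inv d) has_derivative E) (at ((chart_map d \<circ> f \<circ> chart_inv c) (chart_map c p)))"
    using h chart_inv_map[OF c] by (simp add: has_chart_derivative_def)
  ultimately have "((h \<circ> chart_inv d \<circ> (chart_map d \<circ> f \<circ> chart_inv c)) has_derivative E \<circ> D) (at (chart_map c p))"
    by (rule diff_chain_at)
  then have "has_chart_derivative c (h \<circ> chart_inv d \<circ> (chart_map d \<circ> f)) p (E \<circ> D)"
    by (simp add: has_chart_derivative_def o_assoc)
  then show ?thesis
    by (rule has_chart_derivative_cong[OF c W(1,2), rotated]) (use chart_inv_map[OF d(1)] W(3) in auto)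
qed

lemma has_charts_derivative_compose:
  assumes "c \<in> A" "p \<in> chart_dom c" "d \<in> A" "f p \<in> chart_dom d"
    and "has_charts_derivative c d f p D" "has_charts_derivative d e g (f p) E"
  shows "has_charts_derivative c e (g \<circ> f) p (E \<circ> D)"
  using has_chart_derivative_compose[OF assms(1-5), of "chart_map e \<circ> g" E] assms(5,6)
  by (auto simp: has_charts_derivative_def o_assoc intro: continuous_at_compose)

lemma has_charts_derivative_cong:
  assumes "c \<in> A" "p \<in> chart_dom c" "open W" "p \<in> W" "\<And>q. q \<in> W \<Longrightarrow> f q = g q"
    and "has_charts_derivative c d f p D"
  shows "has_charts_derivative c d g p D"
proof -
  have "\<forall>\<^sub>F q in nhds p. f q = g q" using assms(3-5) eventually_nhds by blast
  then have "isCont g p" using isCont_cong[of f g p] assms(6) by (simp add: has_charts_derivative_def)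
  moreover have "has_chart_derivative c (chart_map d \<circ> g) p D"
    using has_chart_derivative_cong[OF assms(1-4), of "chart_map d \<circ> f" "chart_map d \<circ> g"] assms(5,6)
    by (simp add: has_charts_derivative_def)
  ultimately show ?thesis by (simp add: has_charts_derivative_def)
qed

lemma has_charts_derivative_unique:
  "has_charts_derivative c d f p D \<Longrightarrow> has_charts_derivative c d f p E \<Longrightarrow> D = E"
  by (auto simp: has_charts_derivative_def has_chart_derivative_def intro: has_derivative_unique)

text \<open>The maps \<open>to_chart\<close> and \<open>from_chart\<close> are the cases with a
  preferred chart at one end; the cocycle rule \<open>transition_compose\<close> makes them inverse
  to each other.\<close>

definition transition :: "'a chart \<Rightarrow> 'a chart \<Rightarrow> 'a \<Rightarrow> real^4 \<Rightarrow> real^4" where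
  "transition c d p = frechet_derivative (chart_map d \<circ> chart_inv c) (at (chart_map c p))"

lemma has_charts_derivative_transition:
  assumes "c \<in> A" "p \<in> chart_dom c" "d \<in> A" "p \<in> chart_dom d"
  shows "has_charts_derivative c d id p (transition c d p)"
proof -
  have "smooth_on (chart_map c ` (chart_dom c \<inter> chart_dom d)) (chart_map d \<circ> chart_inv c)"
    using smooth_atlas assms(1,3) by (auto simp: smooth_atlas_def)
  then have "Ck_on 1 (chart_map c ` (chart_dom c \<inter> chart_dom d)) (chart_map d \<circ> chart_inv c)"
    by (simp add: smooth_on_def)
  moreover have "open (chart_map c ` (chart_dom c \<inter> chart_dom d))"
    using assms by (intro open_chart_map_image open_chart_dom)
  ultimately have "((chart_map d \<circ> chart_inv c) has_derivative transition c d p) (at (chart_map c p))"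
    unfolding transition_def using assms by (intro has_frechet_derivative_on) auto
  then show ?thesis by (simp add: has_charts_derivative_def has_chart_derivative_def)
qed

lemma has_charts_derivative_id:
  assumes "c \<in> A" "p \<in> chart_dom c" shows "has_charts_derivative c c id p id"
proof -
  have "((chart_map c \<circ> chart_inv c) has_derivative id) (at (chart_map c p))"
    by (rule has_derivative_transform_within_open[OF has_derivative_id[unfolded id_def[symmetric]] open_chart_image[OF assms(1)] chart_map_in[OF assms]])
      (simp add: chart_map_inv[OF assms(1)])
  then show ?thesis by (simp add: has_charts_derivative_def has_chart_derivative_def)
qed

lemma transition_compose:
  assumes "c \<in> A" "p \<in> chart_dom c" "d \<in> A" "p \<in> chart_dom d" "e \<in> A" "p \<in> chart_dom e"
  shows "transition d e p (transition c d p \<xi>) = transition c e p \<xi>"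
proof -
  have "has_charts_derivative c e (id \<circ> id) p (transition d e p \<circ> transition c d p)"
    by (rule has_charts_derivative_compose[OF assms(1-3)])
      (use assms has_charts_derivative_transition in auto)
  then have "transition d e p \<circ> transition c d p = transition c e p"
    using has_charts_derivative_unique has_charts_derivative_transition[OF assms(1,2,5,6)] by simp
  then show ?thesis by (metis comp_apply)
qed

lemma transition_self: "c \<in> A \<Longrightarrow> p \<in> chart_dom c \<Longrightarrow> transition c c p \<xi> = \<xi>"
  using has_charts_derivative_unique[OF has_charts_derivative_transition has_charts_derivative_id] by (metis id_apply)

lemma to_chart_eq: "to_chart A c p = transition (ch p) c p"
  by (simp add: to_chart_def transition_def)

lemma from_chart_eq:
  "c \<in> A \<Longrightarrow> x \<in> chart_image c \<Longrightarrow> from_chart A c x = transition c (ch (chart_inv c x)) (chart_inv c x)"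
  by (simp add: from_chart_def transition_def chart_map_inv)

lemma linear_has_charts_derivative: "has_charts_derivative c d f p D \<Longrightarrow> linear D"
  by (auto simp: has_charts_derivative_def has_chart_derivative_def dest: has_derivative_linear)

lemma linear_to_chart: "c \<in> A \<Longrightarrow> p \<in> chart_dom c \<Longrightarrow> linear (to_chart A c p)"
  unfolding to_chart_eq by (rule linear_has_charts_derivative[OF has_charts_derivative_transition]) auto

lemma linear_from_chart: "c \<in> A \<Longrightarrow> x \<in> chart_image c \<Longrightarrow> linear (from_chart A c x)"
  using chart_inv_in
  by (simp add: from_chart_eq) (rule linear_has_charts_derivative[OF has_charts_derivative_transition], auto)

lemma from_to_chart:
  assumes "c \<in> A" "p \<in> chart_dom c" shows "from_chart A c (chart_map c p) (to_chart A c p \<xi>) = \<xi>"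
  using assms transition_compose[of "ch p" p c "ch p"] transition_self[of "ch p"]
  by (simp add: from_chart_eq to_chart_eq chart_map_in chart_inv_map)

lemma to_from_chart:
  assumes "c \<in> A" "x \<in> chart_image c" shows "to_chart A c (chart_inv c x) (from_chart A c x \<xi>) = \<xi>"
  using assms transition_compose[of c "chart_inv c x" "ch (chart_inv c x)" c] transition_self[of c]
  by (simp add: from_chart_eq to_chart_eq chart_inv_in)

text \<open>Composition with transition maps on both sides passes from the given charts to the
  preferred ones. The local flow is computed in one fixed chart, whereas \<open>tangent_map\<close>
  refers to the preferred chart at the image point.\<close>

lemma has_tangent_map_charts:
  assumes c: "c \<in> A" "p \<in> chart_dom c" and d: "d \<in> A" "f p \<in> chart_dom d"
    and f: "has_charts_derivative c d f p D"
  shows "has_tangent_map A f p" "to_chart A d (f p) (tangent_map A f p \<xi>) = D (to_chart A c p \<xi>)"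
proof -
  let ?D = "transition d (ch (f p)) (f p) \<circ> (D \<circ> transition (ch p) c p)"
  have "has_charts_derivative (ch p) d (f \<circ> id) p (D \<circ> transition (ch p) c p)"
    by (rule has_charts_derivative_compose[where d=c]) (use c f has_charts_derivative_transition in auto)
  then have "has_charts_derivative (ch p) (ch (f p)) (id \<circ> f) p ?D"
    using d has_charts_derivative_transition by (intro has_charts_derivative_compose[where d=d]) auto
  then have D: "has_charts_derivative (ch p) (ch (f p)) f p ?D" by simp
  then have "tangent_map A f p = ?D"
    unfolding tangent_map_def has_charts_derivative_def has_chart_derivative_def
    by (metis frechet_derivative_at)
  with D show "has_tangent_map A f p" "to_chart A d (f p) (tangent_map A f p \<xi>) = D (to_chart A c p \<xi>)"
    using d transition_compose[of d "f p" "ch (f p)" d] transition_self[of d]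
    by (auto simp: has_tangent_map_def to_chart_eq)
qed

lemma has_tangent_mapI_smooth:
  assumes "smooth_map A f" shows "has_tangent_map A f p"
proof -
  let ?c = "ch p" and ?d = "ch (f p)"
  have cont: "continuous_on UNIV f" using assms by (simp add: smooth_map_def)
  let ?U = "chart_map ?c ` (chart_dom ?c \<inter> f -` chart_dom ?d)"
  have "smooth_on ?U (chart_map ?d \<circ> f \<circ> chart_inv ?c)"
    using assms by (simp add: smooth_map_def)
  then have "Ck_on 1 ?U (chart_map ?d \<circ> f \<circ> chart_inv ?c)" by (simp add: smooth_on_def)
  moreover have "open ?U"
    using open_vimage[OF open_chart_dom cont] by (intro open_chart_map_image) auto
  ultimately have "((chart_map ?d \<circ> f \<circ> chart_inv ?c) has_derivative
     frechet_derivative (chart_map ?d \<circ> f \<circ> chart_inv ?c) (at (chart_map ?c p))) (at (chart_map ?c p))"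
    by (intro has_frechet_derivative_on) auto
  moreover have "isCont f p" using cont by (simp add: continuous_on_eq_continuous_at)
  ultimately show ?thesis
    by (simp add: has_tangent_map_def has_charts_derivative_def has_chart_derivative_def tangent_map_def)
qed

lemma linear_tangent_map: "has_tangent_map A f p \<Longrightarrow> linear (tangent_map A f p)"
  unfolding has_tangent_map_def by (rule linear_has_charts_derivative)

lemma tangent_map_compose:
  assumes "has_tangent_map A f p" "has_tangent_map A g (f p)"
  shows "has_tangent_map A (g \<circ> f) p" "tangent_map A (g \<circ> f) p = tangent_map A g (f p) \<circ> tangent_map A f p"
proof -
  have "has_charts_derivative (ch p) (ch (g (f p))) (g \<circ> f) p (tangent_map A g (f p) \<circ> tangent_map A f p)"
    by (rule has_charts_derivative_compose[where d="ch (f p)"])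
      (use assms in \<open>auto simp: has_tangent_map_def\<close>)
  then show "has_tangent_map A (g \<circ> f) p" "tangent_map A (g \<circ> f) p = tangent_map A g (f p) \<circ> tangent_map A f p"
    by (auto simp: has_tangent_map_def tangent_map_def has_charts_derivative_def has_chart_derivative_def o_assoc
        frechet_derivative_at[symmetric])
qed

lemma tangent_map_cong:
  assumes "open W" "p \<in> W" "\<And>q. q \<in> W \<Longrightarrow> f q = g q" "has_tangent_map A f p"
  shows "has_tangent_map A g p" "tangent_map A g p = tangent_map A f p"
proof -
  have "has_charts_derivative (ch p) (ch (g p)) g p (tangent_map A f p)"
    by (rule has_charts_derivative_cong[OF _ _ assms(1-3)]) (use assms in \<open>auto simp: has_tangent_map_def\<close>)
  then show "has_tangent_map A g p" "tangent_map A g p = tangent_map A f p"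
    by (auto simp: has_tangent_map_def tangent_map_def has_charts_derivative_def has_chart_derivative_def o_assoc
        frechet_derivative_at[symmetric])
qed

lemma tangent_map_id: "has_tangent_map A id p" "tangent_map A id p = id"
  using has_charts_derivative_id[of "ch p" p]
  by (auto simp: has_tangent_map_def tangent_map_def has_charts_derivative_def has_chart_derivative_def o_assoc
      frechet_derivative_at[symmetric])

section \<open>Velocities of curves and differentials of functions\<close>

lemma has_chart_velocity_compose:
  assumes c: "c \<in> A" "\<gamma> t \<in> chart_dom c"
    and f: "has_charts_derivative c d f (\<gamma> t) D" and g: "has_chart_velocity c \<gamma> \<xi> t"
  shows "has_chart_velocity d (f \<circ> \<gamma>) (D \<xi>) t"
proof -
  have D: "((chart_map d \<circ> f \<circ> chart_inv c) has_derivative D) (at (chart_map c (\<gamma> t)))"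
    using f by (simp add: has_charts_derivative_def has_chart_derivative_def)
  have "((chart_map d \<circ> f \<circ> chart_inv c \<circ> (chart_map c \<circ> \<gamma>)) has_derivative D \<circ> (\<lambda>h. h *\<^sub>R \<xi>)) (at t)"
    using g D by (intro diff_chain_at) (auto simp: has_chart_velocity_def has_vector_derivative_def)
  then have 1: "((chart_map d \<circ> f \<circ> chart_inv c \<circ> (chart_map c \<circ> \<gamma>)) has_vector_derivative D \<xi>) (at t)"
    using linear_scale[OF has_derivative_linear[OF D]] by (simp add: has_vector_derivative_def comp_def)
  obtain W where W: "open W" "t \<in> W" "\<gamma> ` W \<subseteq> chart_dom c"
    using isCont_open_preimage[where f=\<gamma> and p=t and V="chart_dom c"] open_chart_dom[OF c(1)] c(2) g by (auto simp: has_chart_velocity_def)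
  have "((chart_map d \<circ> (f \<circ> \<gamma>)) has_vector_derivative D \<xi>) (at t)"
    by (rule has_vector_derivative_transform_within_open[OF 1 W(1,2)])
      (use W(3) chart_inv_map[OF c(1)] in auto)
  moreover have "isCont (f \<circ> \<gamma>) t"
    using f g by (auto simp: has_chart_velocity_def has_charts_derivative_def intro: continuous_at_compose)
  ultimately show ?thesis by (simp add: has_chart_velocity_def)
qed

lemma has_velocity_eq: "has_velocity A \<gamma> \<xi> t \<longleftrightarrow> has_chart_velocity (ch (\<gamma> t)) \<gamma> \<xi> t"
  by (simp add: has_velocity_def has_chart_velocity_def)

lemma has_velocity_iff_chart:
  assumes "c \<in> A" "\<gamma> t \<in> chart_dom c"
  shows "has_velocity A \<gamma> \<xi> t \<longleftrightarrow> has_chart_velocity c \<gamma> (to_chart A c (\<gamma> t) \<xi>) t"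
proof
  assume "has_velocity A \<gamma> \<xi> t"
  then have "has_chart_velocity c (id \<circ> \<gamma>) (transition (ch (\<gamma> t)) c (\<gamma> t) \<xi>) t"
    using assms by (intro has_chart_velocity_compose[where c="ch (\<gamma> t)"] has_charts_derivative_transition)
      (auto simp: has_velocity_eq)
  then show "has_chart_velocity c \<gamma> (to_chart A c (\<gamma> t) \<xi>) t" by (simp add: to_chart_eq)
next
  assume "has_chart_velocity c \<gamma> (to_chart A c (\<gamma> t) \<xi>) t"
  then have "has_chart_velocity (ch (\<gamma> t)) (id \<circ> \<gamma>) (transition c (ch (\<gamma> t)) (\<gamma> t) (to_chart A c (\<gamma> t) \<xi>)) t"
    using assms by (intro has_chart_velocity_compose[where c=c] has_charts_derivative_transition) auto
  then show "has_velocity A \<gamma> \<xi> t"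
    using assms transition_compose[of "ch (\<gamma> t)" "\<gamma> t" c "ch (\<gamma> t)" \<xi>] transition_self[of "ch (\<gamma> t)"]
    by (simp add: has_velocity_eq to_chart_eq)
qed

lemma has_velocity_compose:
  assumes "has_tangent_map A f (\<gamma> t)" "has_velocity A \<gamma> \<xi> t"
  shows "has_velocity A (f \<circ> \<gamma>) (tangent_map A f (\<gamma> t) \<xi>) t"
  using assms has_chart_velocity_compose[of "ch (\<gamma> t)" \<gamma> t]
  by (simp add: has_velocity_eq has_tangent_map_def)

lemma has_velocity_cong:
  assumes "has_velocity A \<gamma> \<xi> t" "open J" "t \<in> J" "\<And>s. s \<in> J \<Longrightarrow> \<gamma> s = \<gamma>' s"
  shows "has_velocity A \<gamma>' \<xi> t"
proof -
  have "\<forall>\<^sub>F s in nhds t. \<gamma> s = \<gamma>' s" using assms eventually_nhds by blast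
  then have "isCont \<gamma>' t" using isCont_cong[of \<gamma> \<gamma>' t] assms(1) by (simp add: has_velocity_def)
  moreover have "((chart_map (ch (\<gamma>' t)) \<circ> \<gamma>') has_vector_derivative \<xi>) (at t)"
  proof (rule has_vector_derivative_transform_within_open[OF _ assms(2,3)])
    show "((chart_map (ch (\<gamma>' t)) \<circ> \<gamma>) has_vector_derivative \<xi>) (at t)"
      using assms(1) assms(4)[OF assms(3)] by (simp add: has_velocity_def)
  qed (simp add: assms(4))
  ultimately show ?thesis by (simp add: has_velocity_def)
qed

lemma has_velocity_affine:
  assumes "has_velocity A \<gamma> \<xi> (a * t + b)"
  shows "has_velocity A (\<lambda>s. \<gamma> (a * s + b)) (a *\<^sub>R \<xi>) t"
proof -
  have "((\<lambda>s. a * s + b) has_vector_derivative a) (at t)"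
    by (auto intro!: derivative_eq_intros simp: has_real_derivative_iff_has_vector_derivative[symmetric])
  then have "((chart_map (ch (\<gamma> (a * t + b))) \<circ> \<gamma> \<circ> (\<lambda>s. a * s + b)) has_vector_derivative a *\<^sub>R \<xi>) (at t)"
    using assms by (intro vector_diff_chain_at) (auto simp: has_velocity_def)
  moreover have "isCont (\<lambda>s. \<gamma> (a * s + b)) t"
    using assms by (intro isCont_o2[of t "\<lambda>s. a * s + b" \<gamma>]) (auto simp: has_velocity_def)
  ultimately show ?thesis by (simp add: has_velocity_def comp_def)
qed

lemma differential_chart:
  assumes f: "smooth_function A f" and c: "c \<in> A" "p \<in> chart_dom c"
  shows "has_chart_derivative c f p (frechet_derivative (f \<circ> chart_inv c) (at (chart_map c p)))"
    "frechet_derivative (f \<circ> chart_inv c) (at (chart_map c p)) (to_chart A c p \<xi>) = differential A f p \<xi>"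
proof -
  have *: "has_chart_derivative c f p (frechet_derivative (f \<circ> chart_inv c) (at (chart_map c p)))"
    if "c \<in> A" "p \<in> chart_dom c" for c
  proof -
    have "Ck_on 1 (chart_image c) (f \<circ> chart_inv c)"
      using f that(1) unfolding smooth_function_def smooth_on_def by blast
    then show ?thesis unfolding has_chart_derivative_def
      using that by (intro has_frechet_derivative_on[OF open_chart_image]) (auto simp: chart_map_in)
  qed
  show "has_chart_derivative c f p (frechet_derivative (f \<circ> chart_inv c) (at (chart_map c p)))"
    by (rule *[OF c])
  have "has_chart_derivative (ch p) (f \<circ> id) p (frechet_derivative (f \<circ> chart_inv c) (at (chart_map c p)) \<circ> to_chart A c p)"
    unfolding to_chart_eq
    using c by (intro has_chart_derivative_compose[where d=c] has_charts_derivative_transition) (auto intro: *)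
  then have "frechet_derivative (f \<circ> chart_inv c) (at (chart_map c p)) \<circ> to_chart A c p = differential A f p"
    unfolding differential_def has_chart_derivative_def by (simp add: frechet_derivative_at)
  then show "frechet_derivative (f \<circ> chart_inv c) (at (chart_map c p)) (to_chart A c p \<xi>) = differential A f p \<xi>"
    by (metis comp_apply)
qed

lemma differential_compose:
  assumes f: "smooth_function A f" and g: "has_tangent_map A g p"
  shows "differential A (f \<circ> g) p \<xi> = differential A f (g p) (tangent_map A g p \<xi>)"
proof -
  have "has_chart_derivative (ch (g p)) f (g p) (differential A f (g p))"
    using differential_chart(1)[OF f, of "ch (g p)"] by (simp add: differential_def)
  then have "has_chart_derivative (ch p) (f \<circ> g) p (differential A f (g p) \<circ> tangent_map A g p)"
    using g by (intro has_chart_derivative_compose[where d="ch (g p)"]) (auto simp: has_tangent_map_def)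
  then show ?thesis
    unfolding has_chart_derivative_def by (simp add: differential_def[of A "f \<circ> g"] frechet_derivative_at[symmetric])
qed

end

section \<open>The Hamiltonian flow\<close>

lemma basis4_expansion: "(u::real^4) = (\<Sum>i\<in>UNIV. u $ i *\<^sub>R axis i 1)"
  by (simp add: vec_eq_iff axis_def if_distrib[of "\<lambda>x. _ * x"] cong: if_cong)

lemma linear_axis_expansion:
  fixes f :: "real^4 \<Rightarrow> real"
  assumes "linear f" shows "f u = (\<Sum>i\<in>UNIV. u $ i * f (axis i 1))"
proof -
  have "f u = f (\<Sum>i\<in>UNIV. u $ i *\<^sub>R axis i 1)" using basis4_expansion[of u] by simp
  then show ?thesis using assms by (simp add: linear_sum linear_scale)
qed

lemma sum_rotate3: "(\<Sum>i\<in>I. \<Sum>j\<in>J. \<Sum>k\<in>K. f i j k) = (\<Sum>k\<in>K. \<Sum>i\<in>I. \<Sum>j\<in>J. f i j k)"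
proof -
  have "(\<Sum>i\<in>I. \<Sum>j\<in>J. \<Sum>k\<in>K. f i j k) = (\<Sum>i\<in>I. \<Sum>k\<in>K. \<Sum>j\<in>J. f i j k)"
    by (rule sum.cong[OF refl], rule sum.swap)
  also have "\<dots> = (\<Sum>k\<in>K. \<Sum>i\<in>I. \<Sum>j\<in>J. f i j k)" by (rule sum.swap)
  finally show ?thesis .
qed

lemma bilinear_sum_expansion:
  fixes w :: "real^4 \<Rightarrow> real^4 \<Rightarrow> real"
  assumes "bilinear w"
  shows "w u v = (\<Sum>i\<in>UNIV. \<Sum>j\<in>UNIV. w (axis i 1) (axis j 1) * u $ i * v $ j)"
proof -
  have l: "linear (\<lambda>x. w x y)" and r: "linear (w x)" for x y using assms by (auto simp: bilinear_def)
  have "w u v = (\<Sum>i\<in>UNIV. u $ i * w (axis i 1) v)" by (rule linear_axis_expansion[OF l])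
  also have "\<dots> = (\<Sum>i\<in>UNIV. u $ i * (\<Sum>j\<in>UNIV. v $ j * w (axis i 1) (axis j 1)))"
    by (intro sum.cong refl arg_cong2[where f="(*)"] linear_axis_expansion r)
  finally show ?thesis by (simp add: sum_distrib_left mult_ac)
qed

locale hamiltonian_system = atlas A for A :: "'a::{t2_space,second_countable_topology} chart set" +
  fixes \<omega> :: "'a two_form" and H :: "'a \<Rightarrow> real"
  assumes symplectic: "symplectic_form A \<omega>" and smooth_H: "smooth_function A H"
begin

abbreviation "X \<equiv> ham_field A \<omega> H"

lemma symplectic_at: "symplectic_vector_space4 (\<omega> p)"
proof
  show "\<xi> = 0" if "\<And>\<eta>. \<omega> p \<xi> \<eta> = 0" for \<xi>
    using symplectic that unfolding symplectic_form_def by blast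
qed (use symplectic in \<open>auto simp: symplectic_form_def\<close>)

lemmas nondeg_\<omega> = symplectic_vector_space4.nondeg[OF symplectic_at]
lemmas antisym_\<omega> = symplectic_vector_space4.antisym[OF symplectic_at]

lemma linear_differential: "linear (differential A H p)"
proof -
  have "has_chart_derivative (ch p) H p (differential A H p)"
    using differential_chart(1)[OF smooth_H, of "ch p" p] by (simp add: differential_def)
  then show ?thesis unfolding has_chart_derivative_def by (rule has_derivative_linear)
qed

text \<open>By nondegeneracy the map from vectors to functionals is injective, hence surjective in
  equal dimension; so exactly one vector represents the differential, and the description of the
  Hamiltonian field denotes it.\<close>

lemma differential_eq: "differential A H p \<eta> = \<omega> p \<eta> (X p)"
proof -
  interpret symplectic_vector_space4 "\<omega> p" by (rule symplectic_at)
  define T where "T \<xi> = (\<chi> i. \<omega> p (axis i 1) \<xi>)" for \<xi>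
  have linT: "linear T"
    by (rule linearI) (simp_all add: T_def vec_eq_iff bilinear_simps)
  have expand: "\<omega> p \<eta> \<xi> = (\<Sum>i\<in>UNIV. \<eta> $ i * T \<xi> $ i)" for \<eta> \<xi>
    using linear_axis_expansion[OF linear_left, of \<eta> \<xi>] by (simp add: T_def)
  have "inj T"
    unfolding linear_injective_0[OF linT]
  proof (intro allI impI)
    fix \<xi> assume "T \<xi> = 0"
    then have "\<omega> p \<eta> \<xi> = 0" for \<eta> by (simp add: expand)
    then have "\<omega> p \<xi> \<eta> = 0" for \<eta> using antisym[of \<xi> \<eta>] by simp
    then show "\<xi> = 0" by (rule nondeg)
  qed
  then have "surj T" using linear_injective_imp_surjective[OF linT] by simp
  then obtain \<xi> where \<xi>: "T \<xi> = (\<chi> i. differential A H p (axis i 1))" by (metis surj_def)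
  have e: "differential A H p \<eta> = \<omega> p \<eta> \<xi>" for \<eta>
    using linear_axis_expansion[OF linear_differential, of p \<eta>] by (simp add: expand \<xi>)
  have "X p = \<xi>"
    unfolding ham_field_def
  proof (rule the_equality)
    fix \<zeta> assume "\<forall>\<eta>. differential A H p \<eta> = \<omega> p \<eta> \<zeta>"
    then have "\<omega> p \<eta> (\<zeta> - \<xi>) = 0" for \<eta> using e[of \<eta>] by (simp add: bilinear_simps)
    then have "\<omega> p (\<zeta> - \<xi>) \<eta> = 0" for \<eta> using antisym[of "\<zeta> - \<xi>" \<eta>] by simp
    then show "\<zeta> = \<xi>" using nondeg[of "\<zeta> - \<xi>"] by simp
  qed (simp add: e)
  then show ?thesis using e by simp
qed

section \<open>The symplectic form and the Hamiltonian field in coordinates\<close>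

definition form_matrix :: "'a chart \<Rightarrow> real^4 \<Rightarrow> real^4^4" where
  "form_matrix c x = (\<chi> i j. form_coeff A \<omega> c i j x)"

definition chart_form :: "'a chart \<Rightarrow> real^4 \<Rightarrow> real^4 \<Rightarrow> real^4 \<Rightarrow> real" where
  "chart_form c x u w = (\<Sum>i\<in>UNIV. \<Sum>j\<in>UNIV. form_coeff A \<omega> c i j x * u $ i * w $ j)"

definition chart_field :: "'a chart \<Rightarrow> real^4 \<Rightarrow> real^4" where
  "chart_field c x = to_chart A c (chart_inv c x) (X (chart_inv c x))"

lemma chart_form_eq:
  assumes "c \<in> A" "x \<in> chart_image c"
  shows "chart_form c x u w = \<omega> (chart_inv c x) (from_chart A c x u) (from_chart A c x w)"
proof -
  interpret symplectic_vector_space4 "\<omega> (chart_inv c x)" by (rule symplectic_at)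
  have "bilinear (\<lambda>u w. \<omega> (chart_inv c x) (from_chart A c x u) (from_chart A c x w))"
    using linear_compose[OF linear_from_chart[OF assms] linear_left]
       linear_compose[OF linear_from_chart[OF assms] linear_right]
    by (simp add: bilinear_def comp_def)
  from bilinear_sum_expansion[OF this, of u w] show ?thesis
    unfolding chart_form_def form_coeff_def by (rule sym)
qed

lemma \<omega>_chart:
  assumes "c \<in> A" "p \<in> chart_dom c"
  shows "\<omega> p \<xi> \<eta> = chart_form c (chart_map c p) (to_chart A c p \<xi>) (to_chart A c p \<eta>)"
  using assms by (simp add: chart_form_eq chart_map_in from_to_chart chart_inv_map)

lemma chart_form_antisym:
  assumes "c \<in> A" "x \<in> chart_image c" shows "chart_form c x u w = - chart_form c x w u"
  unfolding chart_form_eq[OF assms] by (rule antisym_\<omega>)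

lemma bilinear_chart_form: "bilinear (chart_form c x)"
  unfolding bilinear_def chart_form_def
  by (intro conjI allI linearI) (simp_all add: algebra_simps sum.distrib sum_distrib_left)

lemma chart_form_nondegenerate:
  assumes c: "c \<in> A" "x \<in> chart_image c" and u: "\<And>w. chart_form c x w u = 0"
  shows "u = 0"
proof -
  let ?p = "chart_inv c x"
  have "\<omega> ?p \<eta> (from_chart A c x u) = 0" for \<eta>
    using u[of "to_chart A c ?p \<eta>"] from_to_chart[OF c(1) chart_inv_in[OF c]] c
    by (simp add: chart_form_eq chart_map_inv)
  then have "\<omega> ?p (from_chart A c x u) \<eta> = 0" for \<eta>
    using antisym_\<omega>[of ?p "from_chart A c x u" \<eta>] by simp
  then have "from_chart A c x u = 0" by (rule nondeg_\<omega>)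
  then show "u = 0"
    using to_from_chart[OF c, of u] linear_0[OF linear_to_chart[OF c(1) chart_inv_in[OF c]]] by simp
qed

lemma form_matrix_mult: "(form_matrix c x *v u) $ i = chart_form c x (axis i 1) u"
proof -
  have "chart_form c x (axis i 1) u =
      (\<Sum>i'\<in>UNIV. if i' = i then \<Sum>j\<in>UNIV. form_coeff A \<omega> c i' j x * u $ j else 0)"
    unfolding chart_form_def by (intro sum.cong refl) (simp add: axis_def)
  then show ?thesis by (simp add: form_matrix_def matrix_vector_mult_def)
qed

lemma form_coeff_eq_chart_form: "form_coeff A \<omega> c i j x = chart_form c x (axis i 1) (axis j 1)"
proof -
  have "form_matrix c x *v axis j 1 = column j (form_matrix c x)" by (rule matrix_vector_mult_basis)
  then show ?thesis
    using form_matrix_mult[of c x "axis j 1" i] by (simp add: column_def form_matrix_def)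
qed

lemma det_form_matrix:
  assumes c: "c \<in> A" "x \<in> chart_image c" shows "det (form_matrix c x) \<noteq> 0"
proof -
  have "u = 0" if "form_matrix c x *v u = 0" for u
  proof (rule chart_form_nondegenerate[OF c])
    fix w
    have 0: "chart_form c x (axis i 1) u = 0" for i
      using that by (simp flip: form_matrix_mult)
    have l: "linear (\<lambda>w. chart_form c x w u)" using bilinear_chart_form by (auto simp: bilinear_def)
    show "chart_form c x w u = 0" by (subst linear_axis_expansion[OF l]) (simp add: 0)
  qed
  then have "\<exists>B. B ** form_matrix c x = mat 1" by (simp add: matrix_left_invertible_ker)
  then show ?thesis
    by (metis invertible_det_nz invertible_left_inverse)
qed

lemma chart_gradient:
  assumes c: "c \<in> A" "x \<in> chart_image c"
  shows "chart_form c x u (chart_field c x) = frechet_derivative (H \<circ> chart_inv c) (at x) u"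
proof -
  let ?p = "chart_inv c x"
  have p: "?p \<in> chart_dom c" by (rule chart_inv_in[OF c])
  have "frechet_derivative (H \<circ> chart_inv c) (at x) (to_chart A c ?p (from_chart A c x u)) =
      \<omega> ?p (from_chart A c x u) (X ?p)"
    using differential_chart(2)[OF smooth_H c(1) p, of "from_chart A c x u"] chart_map_inv[OF c]
    by (simp add: differential_eq)
  then show ?thesis
    using to_from_chart[OF c] from_to_chart[OF c(1) p] chart_map_inv[OF c]
    by (simp add: chart_form_eq[OF c] chart_field_def)
qed

lemma smooth_form_coeff: "c \<in> A \<Longrightarrow> Ck_on k (chart_image c) (form_coeff A \<omega> c i j)"
  using symplectic unfolding symplectic_form_def smooth_on_def by blast

lemma smooth_H_chart: "c \<in> A \<Longrightarrow> Ck_on k (chart_image c) (H \<circ> chart_inv c)"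
  using smooth_H unfolding smooth_function_def smooth_on_def by blast

lemma Ck_chart_field:
  assumes c: "c \<in> A" shows "Ck_on k (chart_image c) (chart_field c)"
proof (rule Ck_on_linear_solution[OF open_chart_image[OF c]])
  show "Ck_on k (chart_image c) (\<lambda>x. form_matrix c x $ i $ j)" for i j
    using smooth_form_coeff[OF c] by (simp add: form_matrix_def)
  show "det (form_matrix c x) \<noteq> 0" if "x \<in> chart_image c" for x using det_form_matrix[OF c that] .
  have "Ck_on (Suc k) (chart_image c) (H \<circ> chart_inv c)" by (rule smooth_H_chart[OF c])
  then show "Ck_on k (chart_image c) (\<lambda>x. (\<chi> i. frechet_derivative (H \<circ> chart_inv c) (at x) (axis i 1)) $ i)" for i
    by simp
  show "form_matrix c x *v chart_field c x = (\<chi> i. frechet_derivative (H \<circ> chart_inv c) (at x) (axis i 1))"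
    if "x \<in> chart_image c" for x
    by (simp add: vec_eq_iff form_matrix_mult chart_gradient[OF c that])
qed

text \<open>The Lie derivative of \<open>\<omega>\<close> along \<open>X\<close> vanishes: this is \<open>d\<omega> = 0\<close> together with the symmetry of
  the second derivative of \<open>H\<close>.\<close>

lemma chart_form_invariant:
  assumes c: "c \<in> A" "x \<in> chart_image c"
  defines "P \<equiv> \<lambda>i j. frechet_derivative (form_coeff A \<omega> c i j) (at x)"
    and "V \<equiv> frechet_derivative (chart_field c) (at x)"
  shows "(\<Sum>i\<in>UNIV. \<Sum>j\<in>UNIV. P i j (chart_field c x) * u $ i * w $ j) +
    chart_form c x (V u) w + chart_form c x u (V w) = 0"
proof -
  let ?U = "chart_image c" and ?Y = "chart_field c x" and ?h = "H \<circ> chart_inv c"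
  note U = open_chart_image[OF c(1)]
  define Q where "Q h u w = (\<Sum>i\<in>UNIV. \<Sum>j\<in>UNIV. P i j h * u $ i * w $ j)" for h u w
  have dP: "(form_coeff A \<omega> c i j has_derivative P i j) (at x)" for i j
    unfolding P_def using smooth_form_coeff[OF c(1), of 1] by (intro has_frechet_derivative_on[OF U _ c(2)]) auto
  have dV: "(chart_field c has_derivative V) (at x)"
    unfolding V_def using Ck_chart_field[OF c(1), of 1] by (intro has_frechet_derivative_on[OF U _ c(2)]) auto
  have Panti: "P i j h = - P j i h" for i j h
  proof -
    have "P i j = frechet_derivative (\<lambda>y. - form_coeff A \<omega> c j i y) (at x)"
      unfolding P_def using U c(2)
    proof (rule frechet_derivative_cong_open)
      fix y assume "y \<in> ?U"
      then show "form_coeff A \<omega> c i j y = - form_coeff A \<omega> c j i y"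
        unfolding form_coeff_eq_chart_form by (rule chart_form_antisym[OF c(1)])
    qed
    also have "\<dots> = (\<lambda>h. - P j i h)"
      using has_derivative_minus[OF dP[of j i]] by (rule frechet_derivative_at[symmetric])
    finally show ?thesis by simp
  qed
  have Qanti: "Q h u w = - Q h w u" for h u w
  proof -
    have "Q h w u = (\<Sum>j\<in>UNIV. \<Sum>i\<in>UNIV. P i j h * w $ i * u $ j)"
      unfolding Q_def by (rule sum.swap)
    also have "\<dots> = (\<Sum>j\<in>UNIV. \<Sum>i\<in>UNIV. - (P j i h * u $ j * w $ i))"
      by (intro sum.cong refl) (subst Panti, simp)
    finally show ?thesis by (simp add: Q_def sum_negf)
  qed
  define G where "G i h = frechet_derivative (\<lambda>y. frechet_derivative ?h (at y) (axis i 1)) (at x) h" for i h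
  have h2: "Ck_on 2 ?U ?h" by (rule smooth_H_chart[OF c(1)])
  have dG: "((\<lambda>y. frechet_derivative ?h (at y) (axis i 1)) has_derivative G i) (at x)" for i
    unfolding G_def using h2 by (intro has_frechet_derivative_on[OF U _ c(2)]) (auto simp: numeral_2_eq_2)
  have Gsym: "G i (axis k 1) = G k (axis i 1)" for i k
    unfolding G_def by (rule second_partials_commute[OF U h2 _ _ c(2)]) auto
  have Gexp: "G i h = (\<Sum>k\<in>UNIV. h $ k * G i (axis k 1))" for i h
    by (rule linear_axis_expansion[OF has_derivative_linear[OF dG]])
  \<comment> \<open>The product rule applied to the \<open>i\<close>-th component of
    \<open>chart_gradient\<close>: a row of the Hessian of \<open>H\<close> splits into a derivative
    of the form and a derivative of the field.\<close>
  have grad: "G i h = (\<Sum>j\<in>UNIV. P i j h * ?Y $ j) + (\<Sum>j\<in>UNIV. form_coeff A \<omega> c i j x * V h $ j)" for i h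
  proof -
    have "((\<lambda>y. \<Sum>j\<in>UNIV. form_coeff A \<omega> c i j y * chart_field c y $ j) has_derivative
      (\<lambda>h. \<Sum>j\<in>UNIV. form_coeff A \<omega> c i j x * V h $ j + P i j h * ?Y $ j)) (at x)"
      by (intro has_derivative_sum has_derivative_mult dP bounded_linear.has_derivative[OF bounded_linear_vec_nth] dV)
    moreover have "(\<Sum>j\<in>UNIV. form_coeff A \<omega> c i j y * chart_field c y $ j) = frechet_derivative ?h (at y) (axis i 1)"
      if "y \<in> ?U" for y
      using chart_gradient[OF c(1) that, of "axis i 1"] form_matrix_mult[of c y "chart_field c y" i]
      by (simp add: form_matrix_def matrix_vector_mult_def)
    ultimately have "((\<lambda>y. frechet_derivative ?h (at y) (axis i 1)) has_derivative
      (\<lambda>h. \<Sum>j\<in>UNIV. form_coeff A \<omega> c i j x * V h $ j + P i j h * ?Y $ j)) (at x)"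
      using has_derivative_transform_within_open[OF _ U c(2)] by (metis (no_types, lifting))
    then have "G i = (\<lambda>h. \<Sum>j\<in>UNIV. form_coeff A \<omega> c i j x * V h $ j + P i j h * ?Y $ j)"
      using dG has_derivative_unique by blast
    then show ?thesis by (simp add: sum.distrib)
  qed
  define S where "S u h = (\<Sum>i\<in>UNIV. u $ i * G i h)" for u h
  have Ssym: "S u h = S h u" for u h
  proof -
    have "S u h = (\<Sum>i\<in>UNIV. \<Sum>k\<in>UNIV. u $ i * (h $ k * G i (axis k 1)))"
      unfolding S_def by (subst Gexp) (simp add: sum_distrib_left)
    also have "\<dots> = (\<Sum>k\<in>UNIV. \<Sum>i\<in>UNIV. h $ k * (u $ i * G k (axis i 1)))"
      by (subst sum.swap) (simp add: Gsym mult_ac)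
    also have "\<dots> = S h u"
      unfolding S_def by (subst (2) Gexp) (simp add: sum_distrib_left)
    finally show ?thesis .
  qed
  have Sdec: "S u h = Q h u ?Y + chart_form c x u (V h)" for u h
    unfolding S_def grad Q_def chart_form_def
    by (simp add: distrib_left sum.distrib sum_distrib_left mult_ac)
  have closed: "P j k (axis i 1) + P k i (axis j 1) + P i j (axis k 1) = 0" for i j k
    using symplectic c unfolding symplectic_form_def partial_deriv_def P_def by blast
  have Qexp: "Q h u w = (\<Sum>k\<in>UNIV. \<Sum>i\<in>UNIV. \<Sum>j\<in>UNIV. P i j (axis k 1) * h $ k * u $ i * w $ j)" for h u w
  proof -
    have "P i j h = (\<Sum>k\<in>UNIV. h $ k * P i j (axis k 1))" for i j
      by (rule linear_axis_expansion[OF has_derivative_linear[OF dP]])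
    then have "P i j h * u $ i * w $ j = (\<Sum>k\<in>UNIV. P i j (axis k 1) * h $ k * u $ i * w $ j)" for i j
      by (simp add: sum_distrib_left sum_distrib_right mult_ac)
    then show ?thesis
      unfolding Q_def by (simp add: sum_rotate3[of "\<lambda>i j k. P i j (axis k 1) * h $ k * u $ i * w $ j"])
  qed
  \<comment> \<open>Closedness of \<omega>, evaluated on the field, \<open>u\<close> and
    \<open>w\<close>. Rotating the summation indices brings the three sums to one order, so that the
    coefficient identity applies termwise.\<close>
  have cyc: "Q ?Y u w + Q u w ?Y + Q w ?Y u = 0"
  proof -
    have "Q u w ?Y = (\<Sum>k\<in>UNIV. \<Sum>i\<in>UNIV. \<Sum>j\<in>UNIV. P j k (axis i 1) * u $ i * w $ j * ?Y $ k)"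
      unfolding Qexp by (rule sum_rotate3[of "\<lambda>i j k. P j k (axis i 1) * u $ i * w $ j * ?Y $ k"])
    moreover have "Q w ?Y u = (\<Sum>k\<in>UNIV. \<Sum>i\<in>UNIV. \<Sum>j\<in>UNIV. P k i (axis j 1) * w $ j * ?Y $ k * u $ i)"
      unfolding Qexp sum_rotate3[of "\<lambda>j k i. P k i (axis j 1) * w $ j * ?Y $ k * u $ i"]
      by (rule sum_rotate3[of "\<lambda>i j k. P k i (axis j 1) * w $ j * ?Y $ k * u $ i"])
    ultimately have "Q ?Y u w + Q u w ?Y + Q w ?Y u = (\<Sum>k\<in>UNIV. \<Sum>i\<in>UNIV. \<Sum>j\<in>UNIV.
      (P j k (axis i 1) + P k i (axis j 1) + P i j (axis k 1)) * (?Y $ k * u $ i * w $ j))"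
      by (simp add: Qexp[of ?Y] algebra_simps sum.distrib)
    then show ?thesis by (simp add: closed)
  qed
  have "chart_form c x (V u) w = - chart_form c x w (V u)" by (rule chart_form_antisym[OF c])
  \<comment> \<open>Subtract the two decompositions of the symmetric Hessian on \<open>u\<close>,
    \<open>w\<close>. The remaining derivatives of the form, \<open>Q w u ?Y - Q u w ?Y\<close>,
    equal \<open>Q ?Y u w\<close> by closedness and antisymmetry.\<close>
  then have "Q ?Y u w + chart_form c x (V u) w + chart_form c x u (V w) = 0"
    using Sdec[of u w] Sdec[of w u] Ssym[of u w] cyc Qanti[of w u ?Y] by linarith
  then show ?thesis by (simp add: Q_def)
qed

section \<open>Integral curves and the graph of the flow\<close>

definition integral_curve :: "real set \<Rightarrow> (real \<Rightarrow> 'a) \<Rightarrow> bool" where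
  "integral_curve J \<gamma> \<longleftrightarrow> open J \<and> is_interval J \<and> (\<forall>s\<in>J. has_velocity A \<gamma> (X (\<gamma> s)) s)"

text \<open>The graph of the flow. Unlike the total function \<open>ham_flow\<close>, the relation
  carries the information that the integral curve exists up to time \<open>t\<close>.\<close>

definition reaches :: "real \<Rightarrow> 'a \<Rightarrow> 'a \<Rightarrow> bool" where
  "reaches t p q \<longleftrightarrow> (\<exists>\<gamma> J. integral_curve J \<gamma> \<and> {0, t} \<subseteq> J \<and> \<gamma> 0 = p \<and> \<gamma> t = q)"

abbreviation "flow \<equiv> ham_flow A \<omega> H"

lemma flow_eq_The: "flow t p = (THE q. reaches t p q)"
  by (simp add: ham_flow_def reaches_def integral_curve_def conj_assoc) (metis (no_types, opaque_lifting))

lemma velocity_in_chart: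
  assumes "c \<in> A" "\<gamma> s \<in> chart_dom c"
  shows "has_velocity A \<gamma> (X (\<gamma> s)) s \<longleftrightarrow>
    isCont \<gamma> s \<and> ((chart_map c \<circ> \<gamma>) has_vector_derivative chart_field c (chart_map c (\<gamma> s))) (at s)"
  using has_velocity_iff_chart[of c \<gamma> s "X (\<gamma> s)", OF assms] assms
  by (simp add: has_chart_velocity_def chart_field_def chart_inv_map)

lemma chart_field_bounds:
  assumes c: "c \<in> A" "p \<in> chart_dom c"
  defines "V \<equiv> \<lambda>x. frechet_derivative (chart_field c) (at x)"
  obtains R L K where "0 < R" "0 \<le> L" "0 \<le> K" "cball (chart_map c p) R \<subseteq> chart_image c"
    "\<And>x. x \<in> cball (chart_map c p) R \<Longrightarrow> (chart_field c has_derivative V x) (at x)"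
    "\<And>x y. x \<in> cball (chart_map c p) R \<Longrightarrow> y \<in> cball (chart_map c p) R \<Longrightarrow>
      norm (chart_field c x - chart_field c y) \<le> L * norm (x - y)"
    "\<And>x w. x \<in> cball (chart_map c p) R \<Longrightarrow> norm (V x w) \<le> L * norm w"
    "\<And>x y w. x \<in> cball (chart_map c p) R \<Longrightarrow> y \<in> cball (chart_map c p) R \<Longrightarrow>
      norm (V x w - V y w) \<le> K * norm (x - y) * norm w"
proof -
  note U = open_chart_image[OF c(1)]
  obtain R where R: "0 < R" "cball (chart_map c p) R \<subseteq> chart_image c"
    using U chart_map_in[OF c] open_contains_cball by blast
  have d: "(chart_field c has_derivative V x) (at x)" if "x \<in> cball (chart_map c p) R" for x
    unfolding V_def using Ck_chart_field[OF c(1), of 1] R(2) that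
    by (intro has_frechet_derivative_on[OF U]) auto
  show ?thesis
    using C1_lipschitz_on_compact[OF U Ck_chart_field[OF c(1)] compact_cball convex_cball R(2)]
      C2_derivative_lipschitz_on_compact[OF U Ck_chart_field[OF c(1)] compact_cball convex_cball R(2)]
      R d that unfolding V_def by metis
qed

text \<open>In a chart around the common point the difference of the curves starts at 0 and obeys a
  Lipschitz estimate, so \<open>small_interval_bound\<close> forces it to vanish on a short
  interval.\<close>

lemma integral_curve_locally_unique:
  assumes 1: "integral_curve J \<gamma>1" and 2: "integral_curve J \<gamma>2" and s0: "s0 \<in> J" "\<gamma>1 s0 = \<gamma>2 s0"
  obtains T where "open T" "s0 \<in> T" "T \<subseteq> J" "\<And>s. s \<in> T \<Longrightarrow> \<gamma>1 s = \<gamma>2 s"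
proof -
  let ?c = "ch (\<gamma>1 s0)" and ?p = "\<gamma>1 s0"
  obtain R L where R: "0 < R" "0 \<le> L"
    "\<And>x y. x \<in> cball (chart_map ?c ?p) R \<Longrightarrow> y \<in> cball (chart_map ?c ?p) R \<Longrightarrow>
      norm (chart_field ?c x - chart_field ?c y) \<le> L * norm (x - y)"
    using chart_field_bounds[of ?c ?p] by (metis chart_at_props)
  define N where "N = chart_dom ?c \<inter> chart_map ?c -` ball (chart_map ?c ?p) R"
  have N: "open N" "?p \<in> N" using R(1) by (auto simp: N_def intro: open_chart_dom_preimage)
  have v: "has_velocity A \<gamma>1 (X (\<gamma>1 s)) s" "has_velocity A \<gamma>2 (X (\<gamma>2 s)) s" if "s \<in> J" for s
    using 1 2 that by (auto simp: integral_curve_def)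
  have "isCont \<gamma>1 s0" "isCont \<gamma>2 s0" using v[OF s0(1)] by (auto simp: has_velocity_def)
  then obtain T1 T2 where T: "open T1" "s0 \<in> T1" "\<gamma>1 ` T1 \<subseteq> N" "open T2" "s0 \<in> T2" "\<gamma>2 ` T2 \<subseteq> N"
    using isCont_open_preimage[where f=\<gamma>1 and p=s0 and V=N] isCont_open_preimage[where f=\<gamma>2 and p=s0 and V=N] N s0(2) by metis
  have "open (J \<inter> T1 \<inter> T2)" "s0 \<in> J \<inter> T1 \<inter> T2" using 1 T s0 by (auto simp: integral_curve_def)
  then obtain e0 where e0: "0 < e0" "cball s0 e0 \<subseteq> J \<inter> T1 \<inter> T2" using open_contains_cball by blast
  define e where "e = min e0 (1 / (2 * (L + 1)))"
  have e: "0 < e" "e \<le> e0" "L * e \<le> 1/2"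
  proof -
    have "L * e \<le> L * (1 / (2 * (L + 1)))" using R(2) by (intro mult_left_mono) (auto simp: e_def)
    also have "\<dots> \<le> 1/2" using R(2) by (simp add: field_simps)
    finally show "L * e \<le> 1/2" .
  qed (use e0(1) R(2) in \<open>auto simp: e_def\<close>)
  have in_N: "s0 + u \<in> J" "\<gamma>1 (s0 + u) \<in> N" "\<gamma>2 (s0 + u) \<in> N" if "u \<in> {-e..e}" for u
  proof -
    have "s0 + u \<in> cball s0 e0" using that e(2) by (auto simp: dist_real_def)
    then show "s0 + u \<in> J" "\<gamma>1 (s0 + u) \<in> N" "\<gamma>2 (s0 + u) \<in> N" using e0(2) T by blast+
  qed
  have sh: "((\<lambda>u. s0 + u) has_vector_derivative 1) (at u)" for u
    by (auto intro!: derivative_eq_intros)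
  have der: "((\<lambda>u. chart_map ?c (\<gamma> (s0 + u))) has_vector_derivative chart_field ?c (chart_map ?c (\<gamma> (s0 + u)))) (at u within {-e..e})"
    if "has_velocity A \<gamma> (X (\<gamma> (s0 + u))) (s0 + u)" "\<gamma> (s0 + u) \<in> N" for u \<gamma>
  proof -
    have "((chart_map ?c \<circ> \<gamma>) has_vector_derivative chart_field ?c (chart_map ?c (\<gamma> (s0 + u)))) (at (s0 + u))"
      using that velocity_in_chart[of ?c \<gamma> "s0 + u"] by (simp add: N_def)
    from vector_diff_chain_at[OF sh this] show ?thesis
      by (auto simp: comp_def intro: has_vector_derivative_at_within)
  qed
  have f0: "norm (chart_map ?c (\<gamma>1 (s0 + u)) - chart_map ?c (\<gamma>2 (s0 + u))) \<le>
      2 * (norm (chart_map ?c (\<gamma>1 (s0 + 0)) - chart_map ?c (\<gamma>2 (s0 + 0))) + e * 0)"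
    if u: "u \<in> {-e..e}" for u
  proof (rule small_interval_bound[where f="\<lambda>u. chart_map ?c (\<gamma>1 (s0 + u)) - chart_map ?c (\<gamma>2 (s0 + u))", OF _ e(3) R(2) _ _ u])
    fix s assume s: "s \<in> {-e..e}"
    show "((\<lambda>u. chart_map ?c (\<gamma>1 (s0 + u)) - chart_map ?c (\<gamma>2 (s0 + u))) has_vector_derivative
      chart_field ?c (chart_map ?c (\<gamma>1 (s0 + s))) - chart_field ?c (chart_map ?c (\<gamma>2 (s0 + s)))) (at s within {-e..e})"
      using in_N[OF s] v[of "s0 + s"] by (intro has_vector_derivative_diff der) auto
    have "chart_map ?c (\<gamma>1 (s0 + s)) \<in> cball (chart_map ?c ?p) R" "chart_map ?c (\<gamma>2 (s0 + s)) \<in> cball (chart_map ?c ?p) R"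
      using in_N[OF s] by (auto simp: N_def)
    from R(3)[OF this] show "norm (chart_field ?c (chart_map ?c (\<gamma>1 (s0 + s))) - chart_field ?c (chart_map ?c (\<gamma>2 (s0 + s))))
      \<le> L * norm (chart_map ?c (\<gamma>1 (s0 + s)) - chart_map ?c (\<gamma>2 (s0 + s))) + 0" by simp
  qed (use e in auto)
  have eq: "\<gamma>1 (s0 + u) = \<gamma>2 (s0 + u)" if u: "u \<in> {-e..e}" for u
  proof -
    have "chart_map ?c (\<gamma>1 (s0 + u)) = chart_map ?c (\<gamma>2 (s0 + u))" using f0[OF u] s0(2) by simp
    moreover have "\<gamma>1 (s0 + u) \<in> chart_dom ?c" "\<gamma>2 (s0 + u) \<in> chart_dom ?c" using in_N[OF u] by (auto simp: N_def)
    ultimately show ?thesis by (metis chart_inv_map chart_at_props(1))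
  qed
  show ?thesis
  proof (rule that[of "ball s0 e"])
    show "ball s0 e \<subseteq> J"
    proof
      fix s assume "s \<in> ball s0 e"
      then show "s \<in> J" using in_N(1)[of "s - s0"] by (auto simp: dist_real_def abs_less_iff)
    qed
    show "\<gamma>1 s = \<gamma>2 s" if "s \<in> ball s0 e" for s
      using eq[of "s - s0"] that by (auto simp: dist_real_def abs_less_iff)
  qed (use e in auto)
qed

text \<open>The set of coincidence times is open by local uniqueness and closed because the manifold
  is Hausdorff; the interval is connected.\<close>

lemma integral_curve_unique:
  assumes 1: "integral_curve J \<gamma>1" and 2: "integral_curve J \<gamma>2" and s0: "s0 \<in> J" "\<gamma>1 s0 = \<gamma>2 s0"
    and s: "s \<in> J"
  shows "\<gamma>1 s = \<gamma>2 s"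
proof (rule connected_induction_simple[of J s0 s "\<lambda>s. \<gamma>1 s = \<gamma>2 s"])
  show "connected J" using 1 by (simp add: integral_curve_def is_interval_connected)
  fix a assume a: "a \<in> J"
  have oJ: "open J" using 1 by (simp add: integral_curve_def)
  show "\<exists>T. openin (top_of_set J) T \<and> a \<in> T \<and> (\<forall>x\<in>T. \<forall>y\<in>T. \<gamma>1 x = \<gamma>2 x \<longrightarrow> \<gamma>1 y = \<gamma>2 y)"
  proof (cases "\<gamma>1 a = \<gamma>2 a")
    case True
    obtain T where "open T" "a \<in> T" "T \<subseteq> J" "\<And>s. s \<in> T \<Longrightarrow> \<gamma>1 s = \<gamma>2 s"
      using integral_curve_locally_unique[OF 1 2 a True] by blast
    then show ?thesis using oJ by (intro exI[of _ T]) (auto simp: openin_open_eq)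
  next
    case False
    then obtain U V where UV: "open U" "open V" "\<gamma>1 a \<in> U" "\<gamma>2 a \<in> V" "U \<inter> V = {}" by (metis hausdorff)
    have "isCont \<gamma>1 a" "isCont \<gamma>2 a" using 1 2 a by (auto simp: integral_curve_def has_velocity_def)
    then obtain T1 T2 where T: "open T1" "a \<in> T1" "\<gamma>1 ` T1 \<subseteq> U" "open T2" "a \<in> T2" "\<gamma>2 ` T2 \<subseteq> V"
      using isCont_open_preimage[where f=\<gamma>1 and p=a and V=U] isCont_open_preimage[where f=\<gamma>2 and p=a and V=V] UV by metis
    have "\<gamma>1 x \<noteq> \<gamma>2 x" if "x \<in> J \<inter> T1 \<inter> T2" for x using that T UV(5) by blast
    moreover have "openin (top_of_set J) (J \<inter> T1 \<inter> T2)" using T oJ by (auto simp: openin_open_eq)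
    ultimately show ?thesis using T a by (intro exI[of _ "J \<inter> T1 \<inter> T2"]) auto
  qed
qed (use s0 s in auto)

lemma integral_curve_subset:
  "integral_curve J \<gamma> \<Longrightarrow> open J' \<Longrightarrow> is_interval J' \<Longrightarrow> J' \<subseteq> J \<Longrightarrow> integral_curve J' \<gamma>"
  by (auto simp: integral_curve_def)

lemma reaches_unique:
  assumes "reaches t p q" "reaches t p q'" shows "q = q'"
proof -
  obtain \<gamma> J where 1: "integral_curve J \<gamma>" "{0, t} \<subseteq> J" "\<gamma> 0 = p" "\<gamma> t = q"
    using assms(1) unfolding reaches_def by blast
  obtain \<gamma>' J' where 2: "integral_curve J' \<gamma>'" "{0, t} \<subseteq> J'" "\<gamma>' 0 = p" "\<gamma>' t = q'"
    using assms(2) unfolding reaches_def by blast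
  have o: "open (J \<inter> J')" "is_interval (J \<inter> J')" using 1 2 by (auto simp: integral_curve_def is_interval_Int)
  have "\<gamma> t = \<gamma>' t"
    by (rule integral_curve_unique[of "J \<inter> J'" _ _ 0]) (use 1 2 o in \<open>auto intro: integral_curve_subset\<close>)
  then show ?thesis using 1 2 by simp
qed

lemma flow_eq: "reaches t p q \<Longrightarrow> flow t p = q"
  unfolding flow_eq_The using reaches_unique by blast

lemma integral_curve_shift:
  assumes "integral_curve J \<gamma>" shows "integral_curve {u. u + s \<in> J} (\<lambda>u. \<gamma> (u + s))"
proof -
  have "open ((\<lambda>u. u + s) -` J)" using assms by (intro open_vimage continuous_intros) (simp add: integral_curve_def)
  moreover have "is_interval {u. u + s \<in> J}"
    using assms unfolding integral_curve_def is_interval_1 by (metis add_le_cancel_right mem_Collect_eq)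
  moreover have "has_velocity A (\<lambda>u. \<gamma> (u + s)) (X (\<gamma> (u + s))) u" if "u + s \<in> J" for u
    using has_velocity_affine[of \<gamma> "X (\<gamma> (u + s))" 1 u s] assms that by (simp add: integral_curve_def)
  ultimately show ?thesis by (simp add: integral_curve_def vimage_def)
qed

lemma reaches_along:
  assumes "integral_curve J \<gamma>" "a \<in> J" "b \<in> J" shows "reaches (b - a) (\<gamma> a) (\<gamma> b)"
  unfolding reaches_def
  by (intro exI[of _ "\<lambda>u. \<gamma> (u + a)"] exI[of _ "{u. u + a \<in> J}"]) (use assms integral_curve_shift in auto)

text \<open>After a time shift both curves pass through \<open>q\<close> at time \<open>s\<close>.
  Uniqueness makes them agree on the overlap of their open intervals, so the glued curve has the
  right velocity at every time.\<close>

lemma reaches_trans: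
  assumes "reaches s p q" "reaches t q r" shows "reaches (s + t) p r"
proof -
  obtain \<gamma> J where 1: "integral_curve J \<gamma>" "{0, s} \<subseteq> J" "\<gamma> 0 = p" "\<gamma> s = q"
    using assms(1) unfolding reaches_def by blast
  obtain \<gamma>0 J0 where 20: "integral_curve J0 \<gamma>0" "{0, t} \<subseteq> J0" "\<gamma>0 0 = q" "\<gamma>0 t = r"
    using assms(2) unfolding reaches_def by blast
  define \<gamma>' J' where "\<gamma>' = (\<lambda>u. \<gamma>0 (u + - s))" and "J' = {u. u + - s \<in> J0}"
  have 2: "integral_curve J' \<gamma>'" "{s, s + t} \<subseteq> J'" "\<gamma>' s = q" "\<gamma>' (s + t) = r"
    using 20 integral_curve_shift[OF 20(1), of "- s"] by (auto simp: \<gamma>'_def J'_def)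
  have o: "open (J \<inter> J')" "is_interval (J \<inter> J')" using 1 2 by (auto simp: integral_curve_def is_interval_Int)
  have agree: "\<gamma> u = \<gamma>' u" if "u \<in> J \<inter> J'" for u
    by (rule integral_curve_unique[of "J \<inter> J'" _ _ s]) (use 1 2 o that in \<open>auto intro: integral_curve_subset\<close>)
  define \<beta> where "\<beta> u = (if u \<in> J then \<gamma> u else \<gamma>' u)" for u
  have \<beta>1: "\<beta> u = \<gamma> u" if "u \<in> J" for u using that by (simp add: \<beta>_def)
  have \<beta>2: "\<beta> u = \<gamma>' u" if "u \<in> J'" for u using that agree by (auto simp: \<beta>_def)
  have "integral_curve (J \<union> J') \<beta>"
    unfolding integral_curve_def
  proof (intro conjI ballI)
    show "open (J \<union> J')" using 1 2 by (auto simp: integral_curve_def)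
    have "connected (J \<union> J')"
      using 1 2 by (intro connected_Un) (auto simp: integral_curve_def is_interval_connected)
    then show "is_interval (J \<union> J')" by (simp add: is_interval_connected_1)
    fix u assume "u \<in> J \<union> J'"
    then consider "u \<in> J" | "u \<in> J'" by blast
    then show "has_velocity A \<beta> (X (\<beta> u)) u"
    proof cases
      assume u: "u \<in> J"
      show ?thesis
        by (rule has_velocity_cong[of \<gamma> _ _ J]) (use 1 u \<beta>1 in \<open>auto simp: integral_curve_def\<close>)
    next
      assume u: "u \<in> J'"
      show ?thesis
        by (rule has_velocity_cong[of \<gamma>' _ _ J']) (use 2 u \<beta>2 in \<open>auto simp: integral_curve_def\<close>)
    qed
  qed
  moreover have "\<beta> 0 = p" "\<beta> (s + t) = r" "{0, s + t} \<subseteq> J \<union> J'" using 1 2 \<beta>1 \<beta>2 by auto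
  ultimately show ?thesis unfolding reaches_def by blast
qed

text \<open>A map that preserves the field carries integral curves to integral curves. Applied to
  \<sigma>, this is the commutation with the flow, in a form that makes sense without
  completeness.\<close>

lemma reaches_image:
  assumes f: "\<And>p. has_tangent_map A f p" "\<And>p. tangent_map A f p (X p) = X (f p)" and r: "reaches t p q"
  shows "reaches t (f p) (f q)"
proof -
  obtain \<gamma> J where 1: "integral_curve J \<gamma>" "{0, t} \<subseteq> J" "\<gamma> 0 = p" "\<gamma> t = q"
    using r unfolding reaches_def by blast
  have "integral_curve J (f \<circ> \<gamma>)"
    using 1(1) has_velocity_compose[OF f(1)] f(2) by (fastforce simp: integral_curve_def)
  then show ?thesis using 1 unfolding reaches_def by (intro exI[of _ "f \<circ> \<gamma>"] exI[of _ J]) auto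
qed

section \<open>Invariance of the form and regularity of the flow\<close>

lemma chart_form_along_flow_constant:
  assumes c: "c \<in> A" and e: "0 < e"
    and x: "\<And>s. s \<in> {-e<..<e} \<Longrightarrow> x s \<in> chart_image c \<and> (x has_vector_derivative chart_field c (x s)) (at s)"
    and u: "\<And>s. s \<in> {-e<..<e} \<Longrightarrow>
      (u has_vector_derivative frechet_derivative (chart_field c) (at (x s)) (u s)) (at s)"
    and w: "\<And>s. s \<in> {-e<..<e} \<Longrightarrow>
      (w has_vector_derivative frechet_derivative (chart_field c) (at (x s)) (w s)) (at s)"
    and s: "s \<in> {-e<..<e}"
  shows "chart_form c (x s) (u s) (w s) = chart_form c (x 0) (u 0) (w 0)"
proof -
  let ?V = "\<lambda>s. frechet_derivative (chart_field c) (at (x s))"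
  let ?P = "\<lambda>s i j. frechet_derivative (form_coeff A \<omega> c i j) (at (x s))"
  have "((\<lambda>s. chart_form c (x s) (u s) (w s)) has_real_derivative 0) (at s)" if s: "s \<in> {-e<..<e}" for s
  proof -
    have xs: "x s \<in> chart_image c" using x[OF s] by simp
    have 1: "((\<lambda>s. form_coeff A \<omega> c i j (x s)) has_real_derivative ?P s i j (chart_field c (x s))) (at s)" for i j
    proof -
      have "(form_coeff A \<omega> c i j has_derivative ?P s i j) (at (x s))"
        using smooth_form_coeff[OF c, of 1] xs by (intro has_frechet_derivative_on[OF open_chart_image[OF c]]) auto
      moreover have "(x has_derivative (\<lambda>h. h *\<^sub>R chart_field c (x s))) (at s)"
        using x[OF s] by (simp add: has_vector_derivative_def)
      ultimately have "((form_coeff A \<omega> c i j \<circ> x) has_derivative ?P s i j \<circ> (\<lambda>h. h *\<^sub>R chart_field c (x s))) (at s)"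
        and "linear (?P s i j)"
        by (auto intro: diff_chain_at has_derivative_linear)
      then show ?thesis using linear_scale[of "?P s i j"] by (simp add: has_vector_derivative_def has_field_derivative_def comp_def mult_commute_abs)
    qed
    have 2: "((\<lambda>s. u s $ i) has_real_derivative ?V s (u s) $ i) (at s)" "((\<lambda>s. w s $ i) has_real_derivative ?V s (w s) $ i) (at s)" for i
      using bounded_linear.has_vector_derivative[OF bounded_linear_vec_nth u[OF s]]
        bounded_linear.has_vector_derivative[OF bounded_linear_vec_nth w[OF s]]
      by (auto simp: has_real_derivative_iff_has_vector_derivative)
    have "((\<lambda>s. chart_form c (x s) (u s) (w s)) has_real_derivative
      (\<Sum>i\<in>UNIV. \<Sum>j\<in>UNIV. (?P s i j (chart_field c (x s)) * u s $ i + ?V s (u s) $ i * form_coeff A \<omega> c i j (x s)) * w s $ j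
         + ?V s (w s) $ j * (form_coeff A \<omega> c i j (x s) * u s $ i))) (at s)"
      unfolding chart_form_def by (intro DERIV_sum DERIV_mult 1 2)
    moreover have "(\<Sum>i\<in>UNIV. \<Sum>j\<in>UNIV. (?P s i j (chart_field c (x s)) * u s $ i + ?V s (u s) $ i * form_coeff A \<omega> c i j (x s)) * w s $ j
         + ?V s (w s) $ j * (form_coeff A \<omega> c i j (x s) * u s $ i)) =
      (\<Sum>i\<in>UNIV. \<Sum>j\<in>UNIV. ?P s i j (chart_field c (x s)) * u s $ i * w s $ j) +
      chart_form c (x s) (?V s (u s)) (w s) + chart_form c (x s) (u s) (?V s (w s))"
      by (simp add: chart_form_def algebra_simps sum.distrib)
    \<comment> \<open>The derivative along solutions of the linearized equation is the Lie
      derivative of the form in coordinates.\<close>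
    ultimately show ?thesis using chart_form_invariant[OF c xs, of "u s" "w s"] by simp
  qed
  then have "((\<lambda>s. chart_form c (x s) (u s) (w s)) has_derivative (\<lambda>h. 0)) (at s within {-e<..<e})" if "s \<in> {-e<..<e}" for s
    using that by (auto simp: has_field_derivative_def lambda_zero intro: has_derivative_at_withinI)
  then obtain k where "\<forall>s\<in>{-e<..<e}. chart_form c (x s) (u s) (w s) = k"
    using has_derivative_zero_constant[of "{-e<..<e}" "\<lambda>s. chart_form c (x s) (u s) (w s)"] by auto
  then show ?thesis using s e by auto
qed

text \<open>A package of properties that survives composition and can thus be propagated along an
  orbit. The flow has to exist on a whole neighbourhood of \<open>p\<close>, since its tangent map
  depends on nearby points.\<close>

definition regular_flow :: "real \<Rightarrow> 'a \<Rightarrow> bool" where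
  "regular_flow s p \<longleftrightarrow> (\<exists>W. open W \<and> p \<in> W \<and> (\<forall>q\<in>W. reaches s q (flow s q))) \<and>
     has_tangent_map A (flow s) p \<and>
     (\<forall>\<xi> \<eta>. \<omega> (flow s p) (tangent_map A (flow s) p \<xi>) (tangent_map A (flow s) p \<eta>) = \<omega> p \<xi> \<eta>) \<and>
     tangent_map A (flow s) p (X p) = X (flow s p)"

text \<open>\<open>local_flow\<close> in the chart at \<open>p\<close>, carried back to the
  manifold. One \<open>e\<close> serves all starting points in \<open>W\<close>, as the propagation
  along an orbit requires; continuity in time is stated in the fixed chart at \<open>p\<close>,
  because the preferred chart may change with \<open>s\<close>.\<close>

theorem local_regular_flow:
  obtains e W where "0 < e" "open W" "p \<in> W" "\<And>q s. q \<in> W \<Longrightarrow> s \<in> {-e<..<e} \<Longrightarrow> regular_flow s q"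
    "\<And>s. s \<in> {-e<..<e} \<Longrightarrow> flow s p \<in> chart_dom (ch p)"
    "\<And>\<xi>. continuous_on {-e<..<e} (\<lambda>s. to_chart A (ch p) (flow s p) (tangent_map A (flow s) p \<xi>))"
proof -
  define c where "c = ch p"
  have c: "c \<in> A" "p \<in> chart_dom c" by (simp_all add: c_def)
  let ?V = "\<lambda>x. frechet_derivative (chart_field c) (at x)" and ?x0 = "chart_map c p"
  obtain R L K where R: "0 < R" "0 \<le> L" "0 \<le> K" "cball ?x0 R \<subseteq> chart_image c"
    and bnd: "\<And>x. x \<in> cball ?x0 R \<Longrightarrow> (chart_field c has_derivative ?V x) (at x)"
    "\<And>x w. x \<in> cball ?x0 R \<Longrightarrow> norm (?V x w) \<le> L * norm w"
    "\<And>x y w. x \<in> cball ?x0 R \<Longrightarrow> y \<in> cball ?x0 R \<Longrightarrow> norm (?V x w - ?V y w) \<le> K * norm (x - y) * norm w"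
    using chart_field_bounds[OF c] by metis
  obtain e \<Phi> D where e: "0 < e"
    and \<Phi>0: "\<And>x. x \<in> ball ?x0 (R/2) \<Longrightarrow> \<Phi> 0 x = x" and D0: "\<And>x h. x \<in> ball ?x0 (R/2) \<Longrightarrow> D 0 x h = h"
    and \<Phi>in: "\<And>x s. x \<in> ball ?x0 (R/2) \<Longrightarrow> s \<in> {-e<..<e} \<Longrightarrow> \<Phi> s x \<in> cball ?x0 R"
    and \<Phi>': "\<And>x s. x \<in> ball ?x0 (R/2) \<Longrightarrow> s \<in> {-e<..<e} \<Longrightarrow>
      ((\<lambda>s. \<Phi> s x) has_vector_derivative chart_field c (\<Phi> s x)) (at s)"
    and \<Phi>D: "\<And>x s. x \<in> ball ?x0 (R/2) \<Longrightarrow> s \<in> {-e<..<e} \<Longrightarrow> (\<Phi> s has_derivative D s x) (at x)"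
    and D': "\<And>x s h. x \<in> ball ?x0 (R/2) \<Longrightarrow> s \<in> {-e<..<e} \<Longrightarrow>
      ((\<lambda>s. D s x h) has_vector_derivative ?V (\<Phi> s x) (D s x h)) (at s)"
    and DX: "\<And>x s. x \<in> ball ?x0 (R/2) \<Longrightarrow> s \<in> {-e<..<e} \<Longrightarrow> D s x (chart_field c x) = chart_field c (\<Phi> s x)"
    by (rule local_flow[where R=R and L=L and K=K and p="?x0" and X="chart_field c" and X'="?V"];
      (rule R(1,2,3) | (rule bnd, assumption+) | (rule that, assumption+)))
  have \<Phi>im: "\<Phi> s x \<in> chart_image c" if "x \<in> ball ?x0 (R/2)" "s \<in> {-e<..<e}" for x s
    using \<Phi>in[OF that] R(4) by blast
  have ball_im: "ball ?x0 (R/2) \<subseteq> chart_image c" using R(1,4) by fastforce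
  define W where "W = chart_dom c \<inter> chart_map c -` ball ?x0 (R/2)"
  have W: "open W" "p \<in> W" using R(1) c by (auto simp: W_def intro: open_chart_dom_preimage)
  have xW: "q \<in> chart_dom c" "chart_map c q \<in> ball ?x0 (R/2)" if "q \<in> W" for q using that by (auto simp: W_def)
  \<comment> \<open>The coordinate solution becomes an integral curve on the manifold; by uniqueness
    it is the value of the definite description \<open>flow\<close>.\<close>
  have reach: "reaches s q (chart_inv c (\<Phi> s (chart_map c q)))" if q: "q \<in> W" and s: "s \<in> {-e<..<e}" for q s
  proof -
    let ?x = "chart_map c q" and ?\<gamma> = "\<lambda>s. chart_inv c (\<Phi> s (chart_map c q))"
    have "integral_curve {-e<..<e} ?\<gamma>"
      unfolding integral_curve_def
    proof (intro conjI ballI)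
      show "is_interval {-e<..<e}" by (auto simp: is_interval_1)
      fix s assume s: "s \<in> {-e<..<e}"
      have dom: "?\<gamma> s \<in> chart_dom c" using chart_inv_in[OF c(1) \<Phi>im[OF xW(2)[OF q] s]] .
      have mi: "chart_map c (?\<gamma> u) = \<Phi> u ?x" if "u \<in> {-e<..<e}" for u
        using chart_map_inv[OF c(1) \<Phi>im[OF xW(2)[OF q] that]] .
      have "isCont (\<lambda>s. \<Phi> s ?x) s"
        using \<Phi>'[OF xW(2)[OF q] s] has_vector_derivative_continuous by blast
      then have "isCont ?\<gamma> s"
        using isCont_chart_inv[OF c(1) \<Phi>im[OF xW(2)[OF q] s]] by (rule isCont_o2)
      moreover have "((chart_map c \<circ> ?\<gamma>) has_vector_derivative chart_field c (\<Phi> s ?x)) (at s)"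
        by (rule has_vector_derivative_transform_within_open[OF \<Phi>'[OF xW(2)[OF q] s], of "{-e<..<e}"])
          (use s mi in auto)
      ultimately show "has_velocity A ?\<gamma> (X (?\<gamma> s)) s"
        unfolding velocity_in_chart[where \<gamma>="?\<gamma>", OF c(1) dom] mi[OF s] by simp
    qed simp
    then show ?thesis
      unfolding reaches_def using s e \<Phi>0[OF xW(2)[OF q]] chart_inv_map[OF c(1) xW(1)[OF q]]
      by (intro exI[of _ ?\<gamma>] exI[of _ "{-e<..<e}"]) auto
  qed
  have fl: "flow s q = chart_inv c (\<Phi> s (chart_map c q))" if "q \<in> W" "s \<in> {-e<..<e}" for q s
    by (rule flow_eq[OF reach[OF that]])
  have der: "has_charts_derivative c c (flow s) q (D s (chart_map c q))" if q: "q \<in> W" and s: "s \<in> {-e<..<e}" for q s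
  proof -
    have "((chart_map c \<circ> flow s \<circ> chart_inv c) has_derivative D s (chart_map c q)) (at (chart_map c q))"
    proof (rule has_derivative_transform_within_open[OF \<Phi>D[OF xW(2)[OF q] s] open_ball xW(2)[OF q]])
      fix y assume y: "y \<in> ball ?x0 (R/2)"
      then have y': "y \<in> chart_image c" using ball_im by blast
      then have "chart_inv c y \<in> W" using y chart_inv_in[OF c(1)] chart_map_inv[OF c(1)] by (auto simp: W_def)
      then show "\<Phi> s y = (chart_map c \<circ> flow s \<circ> chart_inv c) y"
        using fl[OF _ s] chart_map_inv[OF c(1) y'] chart_map_inv[OF c(1) \<Phi>im[OF y s]] by simp
    qed
    moreover have "isCont (flow s) q"
    proof -
      have "isCont (\<lambda>q. \<Phi> s (chart_map c q)) q"
        using isCont_chart_map[OF c(1) xW(1)[OF q]] has_derivative_continuous[OF \<Phi>D[OF xW(2)[OF q] s]]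
        by (rule isCont_o2)
      then have "isCont (\<lambda>q. chart_inv c (\<Phi> s (chart_map c q))) q"
        using isCont_chart_inv[OF c(1) \<Phi>im[OF xW(2)[OF q] s]] by (rule isCont_o2)
      moreover have "\<forall>\<^sub>F q in nhds q. flow s q = chart_inv c (\<Phi> s (chart_map c q))"
        using W(1) q fl[OF _ s] eventually_nhds by blast
      ultimately show ?thesis
        using isCont_cong[of "flow s" "\<lambda>q. chart_inv c (\<Phi> s (chart_map c q))" q] by blast
    qed
    ultimately show ?thesis by (simp add: has_charts_derivative_def has_chart_derivative_def o_assoc)
  qed
  have dom: "flow s q \<in> chart_dom c" "chart_map c (flow s q) = \<Phi> s (chart_map c q)" if "q \<in> W" "s \<in> {-e<..<e}" for q s
    using fl[OF that] chart_inv_in[OF c(1) \<Phi>im[OF xW(2)[OF that(1)] that(2)]]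
      chart_map_inv[OF c(1) \<Phi>im[OF xW(2)[OF that(1)] that(2)]] by auto
  have tm: "has_tangent_map A (flow s) q"
    "to_chart A c (flow s q) (tangent_map A (flow s) q \<xi>) = D s (chart_map c q) (to_chart A c q \<xi>)"
    if "q \<in> W" "s \<in> {-e<..<e}" for q s \<xi>
    using has_tangent_map_charts[OF c(1) xW(1)[OF that(1)] c(1) dom(1)[OF that] der[OF that]] by auto
  show ?thesis
  proof (rule that[OF e W])
    fix q s assume qs: "q \<in> W" "s \<in> {-e<..<e}"
    note x = xW(2)[OF qs(1)]
    have "\<exists>W. open W \<and> q \<in> W \<and> (\<forall>q\<in>W. reaches s q (flow s q))"
      using W(1) qs reach fl by (intro exI[of _ W]) auto
    moreover have "\<omega> (flow s q) (tangent_map A (flow s) q \<xi>) (tangent_map A (flow s) q \<eta>) = \<omega> q \<xi> \<eta>" for \<xi> \<eta>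
    proof -
      have "chart_form c (\<Phi> s (chart_map c q)) (D s (chart_map c q) (to_chart A c q \<xi>)) (D s (chart_map c q) (to_chart A c q \<eta>))
        = chart_form c (\<Phi> 0 (chart_map c q)) (D 0 (chart_map c q) (to_chart A c q \<xi>)) (D 0 (chart_map c q) (to_chart A c q \<eta>))"
        by (rule chart_form_along_flow_constant[OF c(1) e _ D'[OF x] D'[OF x] qs(2)]) (use \<Phi>im[OF x] \<Phi>'[OF x] in auto)
      then show ?thesis
        unfolding \<omega>_chart[OF c(1) dom(1)[OF qs]] \<omega>_chart[OF c(1) xW(1)[OF qs(1)]] tm(2)[OF qs] dom(2)[OF qs] \<Phi>0[OF x] D0[OF x] .
    qed
    moreover have "tangent_map A (flow s) q (X q) = X (flow s q)"
    proof -
      have "to_chart A c (flow s q) (tangent_map A (flow s) q (X q)) = to_chart A c (flow s q) (X (flow s q))"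
        unfolding tm(2)[OF qs]
        using DX[OF x qs(2)] dom(2)[OF qs] chart_inv_map[OF c(1) dom(1)[OF qs]] chart_inv_map[OF c(1) xW(1)[OF qs(1)]]
        by (simp add: chart_field_def)
      then show ?thesis using from_to_chart[OF c(1) dom(1)[OF qs]] by metis
    qed
    ultimately show "regular_flow s q" unfolding regular_flow_def using tm(1)[OF qs] by blast
  next
    show "flow s p \<in> chart_dom (ch p)" if "s \<in> {-e<..<e}" for s using dom(1)[OF W(2) that] by (simp add: c_def)
    fix \<xi>
    have "continuous_on {-e<..<e} (\<lambda>s. D s (chart_map c p) (to_chart A c p \<xi>))"
      using D'[OF xW(2)[OF W(2)]] has_vector_derivative_continuous
      by (intro continuous_at_imp_continuous_on ballI) blast
    then show "continuous_on {-e<..<e} (\<lambda>s. to_chart A (ch p) (flow s p) (tangent_map A (flow s) p \<xi>))"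
      unfolding c_def[symmetric] using tm(2)[OF W(2)]
      by (subst continuous_on_cong[OF refl, where g="\<lambda>s. D s (chart_map c p) (to_chart A c p \<xi>)"]) auto
  qed
qed

lemma has_tangent_map_isCont: "has_tangent_map A f p \<Longrightarrow> isCont f p"
  by (simp add: has_tangent_map_def has_charts_derivative_def)

text \<open>To apply the chain rule, the composition law is needed on a neighbourhood. The set
  \<open>W1\<close> is therefore intersected with a set that the first flow maps into the region
  where the second is defined.\<close>

lemma regular_flow_compose:
  assumes 1: "regular_flow s p" and 2: "regular_flow t (flow s p)"
  shows "regular_flow (s + t) p" "flow (s + t) p = flow t (flow s p)"
    "tangent_map A (flow (s + t)) p = tangent_map A (flow t) (flow s p) \<circ> tangent_map A (flow s) p"
proof -
  obtain W1 where W1: "open W1" "p \<in> W1" "\<And>q. q \<in> W1 \<Longrightarrow> reaches s q (flow s q)"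
    using 1 by (auto simp: regular_flow_def)
  obtain W2 where W2: "open W2" "flow s p \<in> W2" "\<And>q. q \<in> W2 \<Longrightarrow> reaches t q (flow t q)"
    using 2 by (auto simp: regular_flow_def)
  have tm: "has_tangent_map A (flow s) p" "has_tangent_map A (flow t) (flow s p)"
    using 1 2 by (auto simp: regular_flow_def)
  obtain W3 where W3: "open W3" "p \<in> W3" "flow s ` W3 \<subseteq> W2"
    using isCont_open_preimage[OF has_tangent_map_isCont[OF tm(1)] W2(1,2)] .
  have r: "reaches (s + t) q ((flow t \<circ> flow s) q)" if "q \<in> W1 \<inter> W3" for q
    using reaches_trans[OF W1(3) W2(3)] that W3(3) by auto
  then have eq: "(flow t \<circ> flow s) q = flow (s + t) q" if "q \<in> W1 \<inter> W3" for q
    using flow_eq[OF r[OF that]] by simp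
  have W: "open (W1 \<inter> W3)" "p \<in> W1 \<inter> W3" using W1 W3 by auto
  note c = tangent_map_compose[OF tm] and d = tangent_map_cong[OF W eq tangent_map_compose(1)[OF tm]]
  show fe: "flow (s + t) p = flow t (flow s p)" using eq[OF W(2)] by simp
  show te: "tangent_map A (flow (s + t)) p = tangent_map A (flow t) (flow s p) \<circ> tangent_map A (flow s) p"
    using c(2) d(2) by simp
  show "regular_flow (s + t) p"
    unfolding regular_flow_def
  proof (intro conjI allI)
    show "\<exists>W. open W \<and> p \<in> W \<and> (\<forall>q\<in>W. reaches (s + t) q (flow (s + t) q))"
      using W r eq by (intro exI[of _ "W1 \<inter> W3"]) auto
    show "has_tangent_map A (flow (s + t)) p" by (rule d(1))
  qed (use 1 2 in \<open>simp_all add: fe te regular_flow_def\<close>)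
qed

lemma reaches_0: "reaches 0 p p"
proof -
  obtain e W where "0 < e" "p \<in> W" "\<And>q s. q \<in> W \<Longrightarrow> s \<in> {-e<..<e} \<Longrightarrow> regular_flow s q"
    by (rule local_regular_flow[where p=p]) (rule that, assumption+)
  then have "regular_flow 0 p" by auto
  then have "reaches 0 p (flow 0 p)" by (auto simp: regular_flow_def)
  moreover from this have "flow 0 p = p" by (auto simp: reaches_def)
  ultimately show ?thesis by simp
qed

lemma flow_0: "flow 0 = id"
  using flow_eq[OF reaches_0] by auto

lemma regular_flow_0: "regular_flow 0 p"
  unfolding regular_flow_def using tangent_map_id reaches_0 by (auto simp: flow_0)

lemma isCont_integral_curve: "integral_curve J y \<Longrightarrow> s \<in> J \<Longrightarrow> isCont y s"
  by (auto simp: integral_curve_def has_velocity_def)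

lemma flow_along:
  assumes "integral_curve UNIV y" shows "flow (b - a) (y a) = y b"
  by (rule flow_eq) (rule reaches_along[OF assms], auto)

text \<open>Near time \<open>a\<close> one existence time \<open>e\<close> serves all points of the
  curve close to \<open>y a\<close>. Regularity therefore passes between any two times within e/2 of
  \<open>a\<close>, and connectedness of the line carries it from 0 to \<open>s\<close>.\<close>

lemma regular_flow_along:
  assumes y: "integral_curve UNIV y" shows "regular_flow s (y 0)"
proof (rule connected_induction_simple[of UNIV 0 s "\<lambda>s. regular_flow s (y 0)"])
  fix a :: real
  obtain e W where e: "0 < e" "open W" "y a \<in> W" "\<And>q s. q \<in> W \<Longrightarrow> s \<in> {-e<..<e} \<Longrightarrow> regular_flow s q"
    by (rule local_regular_flow[where p="y a"]) (rule that, assumption+)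
  obtain T where T: "open T" "a \<in> T" "y ` T \<subseteq> W"
    using isCont_open_preimage[OF isCont_integral_curve[OF y UNIV_I] e(2,3)] .
  show "\<exists>T. openin (top_of_set UNIV) T \<and> a \<in> T \<and> (\<forall>x\<in>T. \<forall>z\<in>T. regular_flow x (y 0) \<longrightarrow> regular_flow z (y 0))"
  proof (intro exI[of _ "T \<inter> {a - e/2<..<a + e/2}"] conjI ballI impI)
    fix x z assume x: "x \<in> T \<inter> {a - e/2<..<a + e/2}" and z: "z \<in> T \<inter> {a - e/2<..<a + e/2}"
      and r: "regular_flow x (y 0)"
    have fx: "flow x (y 0) = y x" using flow_along[OF y, of x 0] by simp
    have "z - x \<in> {-e<..<e}" using x z by auto
    then have "regular_flow (z - x) (flow x (y 0))" using e(4) T(3) x fx by auto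
    from regular_flow_compose(1)[OF r this] show "regular_flow z (y 0)" by simp
  qed (use T e in auto)
qed (auto simp: regular_flow_0)

text \<open>Near time \<open>a\<close> the transported vector is the short-time flow from
  \<open>y a\<close> applied to the fixed vector transported up to \<open>a\<close>. This is
  continuous in the chart at \<open>y a\<close>, and the pairing, being a scalar, may be computed in
  that chart.\<close>

lemma continuous_form_along_flow:
  assumes y: "integral_curve UNIV y"
    and G: "\<And>c. c \<in> A \<Longrightarrow> continuous_on {s. y s \<in> chart_dom c} (\<lambda>s. to_chart A c (y s) (G s))"
  shows "continuous_on UNIV (\<lambda>s. \<omega> (y s) (tangent_map A (flow s) (y 0) \<xi>) (G s))"
proof (rule continuous_at_imp_continuous_on, rule ballI)
  fix a :: real
  obtain e W where e: "0 < e" "open W" "y a \<in> W"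
    and reg: "\<And>q s. q \<in> W \<Longrightarrow> s \<in> {-e<..<e} \<Longrightarrow> regular_flow s q"
    and dom: "\<And>s. s \<in> {-e<..<e} \<Longrightarrow> flow s (y a) \<in> chart_dom (ch (y a))"
    and cont: "\<And>\<xi>. continuous_on {-e<..<e} (\<lambda>s. to_chart A (ch (y a)) (flow s (y a)) (tangent_map A (flow s) (y a) \<xi>))"
    by (rule local_regular_flow[where p="y a"]) (rule that, assumption+)
  let ?c = "ch (y a)" and ?T = "{a - e<..<a + e}" and ?\<eta> = "tangent_map A (flow a) (y 0) \<xi>"
  have fa: "flow (s - a) (y a) = y s" for s by (rule flow_along[OF y])
  have inT: "y s \<in> chart_dom ?c" if "s \<in> ?T" for s using dom[of "s - a"] fa that by auto
  have tm: "tangent_map A (flow s) (y 0) \<xi> = tangent_map A (flow (s - a)) (y a) ?\<eta>" if s: "s \<in> ?T" for s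
  proof -
    have f0: "flow a (y 0) = y a" using flow_along[OF y, of a 0] by simp
    have "regular_flow (s - a) (flow a (y 0))" unfolding f0 using reg e(3) s by auto
    from regular_flow_compose(3)[OF regular_flow_along[OF y] this] show ?thesis by (simp add: f0)
  qed
  define u where "u s = to_chart A ?c (y s) (tangent_map A (flow s) (y 0) \<xi>)" for s
  define g where "g s = to_chart A ?c (y s) (G s)" for s
  have cu: "continuous_on ?T u"
  proof -
    have "continuous_on ?T (\<lambda>s. to_chart A ?c (flow (s - a) (y a)) (tangent_map A (flow (s - a)) (y a) ?\<eta>))"
      by (rule continuous_on_compose2[OF cont]) (auto intro!: continuous_intros)
    then show ?thesis
    proof (rule continuous_on_eq)
      fix s assume "s \<in> ?T"
      then show "to_chart A ?c (flow (s - a) (y a)) (tangent_map A (flow (s - a)) (y a) ?\<eta>) = u s"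
        unfolding u_def fa by (intro arg_cong[OF tm[symmetric]])
    qed
  qed
  have cg: "continuous_on ?T g"
    unfolding g_def by (rule continuous_on_subset[OF G]) (use inT in auto)
  have cy: "continuous_on ?T (\<lambda>s. chart_map ?c (y s))"
  proof (rule continuous_on_compose2[OF continuous_on_chart_map])
    show "continuous_on ?T y" using isCont_integral_curve[OF y] by (intro continuous_at_imp_continuous_on) auto
  qed (use inT in auto)
  have "continuous_on ?T (\<lambda>s. chart_form ?c (chart_map ?c (y s)) (u s) (g s))"
    unfolding chart_form_def
  proof (intro continuous_intros cu cg)
    fix i j
    have "continuous_on (chart_image ?c) (form_coeff A \<omega> ?c i j)"
      using smooth_form_coeff[of ?c 0] by simp
    then show "continuous_on ?T (\<lambda>s. form_coeff A \<omega> ?c i j (chart_map ?c (y s)))"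
      by (rule continuous_on_compose2[OF _ cy]) (auto intro!: chart_map_in inT)
  qed
  then have "continuous_on ?T (\<lambda>s. \<omega> (y s) (tangent_map A (flow s) (y 0) \<xi>) (G s))"
  proof (rule continuous_on_eq)
    fix s assume "s \<in> ?T"
    then show "chart_form ?c (chart_map ?c (y s)) (u s) (g s) = \<omega> (y s) (tangent_map A (flow s) (y 0) \<xi>) (G s)"
      unfolding u_def g_def by (intro \<omega>_chart[symmetric] inT chart_at_props(1))
  qed
  then show "isCont (\<lambda>s. \<omega> (y s) (tangent_map A (flow s) (y 0) \<xi>) (G s)) a"
    using e(1) by (simp add: continuous_on_eq_continuous_at)
qed

section \<open>Level sets and antisymplectic symmetries\<close>

lemma level_tangent_iff: "\<xi> \<in> level_tangent A H p \<longleftrightarrow> \<omega> p \<xi> (X p) = 0"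
  by (simp add: level_tangent_def differential_eq)

lemma reduced_symplectic_basis_iff:
  "reduced_symplectic_basis A \<omega> H p e \<longleftrightarrow> adapted_basis (\<omega> p) (X p) e"
  by (simp add: reduced_symplectic_basis_def adapted_basis_def level_tangent_iff)

text \<open>Pair both sides with an arbitrary vector, written as the image of some vector under the
  tangent map of \<rho>. Invariance of \<open>H\<close> preserves the pairing with the field, while
  \<rho> reverses the form, and nondegeneracy gives the sign.\<close>

lemma antisymplectic_field:
  assumes \<rho>: "antisymplectic_involution A \<omega> \<rho>" "H \<circ> \<rho> = H"
  shows "has_tangent_map A \<rho> p" "tangent_map A \<rho> p (X p) = - X (\<rho> p)"
proof -
  have tm: "has_tangent_map A \<rho> p" for p
    using \<rho>(1) by (intro has_tangent_mapI_smooth) (auto simp: antisymplectic_involution_def diffeomorphism_def)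
  then show "has_tangent_map A \<rho> p" .
  have anti: "\<omega> (\<rho> p) (tangent_map A \<rho> p \<xi>) (tangent_map A \<rho> p \<eta>) = - \<omega> p \<xi> \<eta>" for p \<xi> \<eta>
    using \<rho>(1) by (auto simp: antisymplectic_involution_def)
  have inv: "\<rho> \<circ> \<rho> = id" using \<rho>(1) by (simp add: antisymplectic_involution_def)
  have inv': "\<rho> (\<rho> p) = p" using inv by (metis comp_apply id_apply)
  have surj: "tangent_map A \<rho> p (tangent_map A \<rho> (\<rho> p) \<zeta>) = \<zeta>" for \<zeta>
    using tangent_map_compose(2)[OF tm tm, of "\<rho> p"] tangent_map_id(2)[of "\<rho> p"]
    by (simp add: inv inv' fun_eq_iff)
  interpret symplectic_vector_space4 "\<omega> (\<rho> p)" by (rule symplectic_at)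
  have "\<omega> (\<rho> p) (tangent_map A \<rho> p (X p) + X (\<rho> p)) \<zeta> = 0" for \<zeta>
  proof -
    let ?\<eta> = "tangent_map A \<rho> (\<rho> p) \<zeta>"
    have "\<omega> (\<rho> p) \<zeta> (X (\<rho> p)) = differential A H p ?\<eta>"
      using differential_compose[OF smooth_H tm, of p ?\<eta>] \<rho>(2) by (simp add: surj differential_eq)
    also have "\<dots> = - \<omega> (\<rho> p) \<zeta> (tangent_map A \<rho> p (X p))"
      using anti[of p ?\<eta> "X p"] by (simp add: surj differential_eq)
    finally show ?thesis
      using antisym[of \<zeta> "X (\<rho> p)"] antisym[of \<zeta> "tangent_map A \<rho> p (X p)"] by (simp add: bilinear_simps)
  qed
  then have "tangent_map A \<rho> p (X p) + X (\<rho> p) = 0" by (rule nondeg)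
  then show "tangent_map A \<rho> p (X p) = - X (\<rho> p)" by (simp add: eq_neg_iff_add_eq_0)
qed

end

section \<open>Doubly symmetric orbits\<close>

locale doubly_symmetric_orbit = hamiltonian_system A \<omega> H
  for A :: "'a::{t2_space,second_countable_topology} chart set" and \<omega> H +
  fixes \<rho>\<^sub>1 \<rho>\<^sub>2 :: "'a \<Rightarrow> 'a" and v :: "real \<Rightarrow> 'a" and \<tau> :: real
  assumes \<rho>\<^sub>1: "antisymplectic_involution A \<omega> \<rho>\<^sub>1" "H \<circ> \<rho>\<^sub>1 = H"
    and \<rho>\<^sub>2: "antisymplectic_involution A \<omega> \<rho>\<^sub>2" "H \<circ> \<rho>\<^sub>2 = H"
    and commute: "\<rho>\<^sub>1 \<circ> \<rho>\<^sub>2 = \<rho>\<^sub>2 \<circ> \<rho>\<^sub>1"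
    and orbit: "simple_periodic_orbit A \<omega> H \<tau> v"
    and symmetric: "doubly_symmetric \<rho>\<^sub>1 \<rho>\<^sub>2 v"
begin

definition "\<sigma> = \<rho>\<^sub>1 \<circ> \<rho>\<^sub>2"

lemma \<tau>_pos: "\<tau> > 0" using orbit by (simp add: simple_periodic_orbit_def)

lemma integral_curve_orbit: "integral_curve UNIV (\<lambda>s. v (s / \<tau>))"
proof -
  have "has_velocity A (\<lambda>s. v (s / \<tau>)) (X (v (s / \<tau>))) s" for s
  proof -
    have "has_velocity A v (\<tau> *\<^sub>R X (v ((1/\<tau>) * s + 0))) ((1/\<tau>) * s + 0)"
      using orbit by (simp add: simple_periodic_orbit_def)
    from has_velocity_affine[OF this] show ?thesis using \<tau>_pos by simp
  qed
  then show ?thesis by (simp add: integral_curve_def is_interval_univ)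
qed

lemma flow_orbit: "flow (\<tau> * t) (v 0) = v t"
  using flow_along[OF integral_curve_orbit, of "\<tau> * t" 0] \<tau>_pos by simp

lemma regular_flow_orbit: "regular_flow s (v 0)"
  using regular_flow_along[OF integral_curve_orbit, of s] by simp

lemma v_1: "v 1 = v 0"
  using orbit unfolding simple_periodic_orbit_def by (metis add_0)

text \<open>At a zero of the field the constant curve is an integral curve; uniqueness would make
  the orbit constant, against injectivity at 0 and 1/2.\<close>

lemma X_nonzero: "X (v t) \<noteq> 0"
proof
  assume 0: "X (v t) = 0"
  have "integral_curve UNIV (\<lambda>s. v t)"
    by (simp add: integral_curve_def is_interval_univ has_velocity_def comp_def 0 has_vector_derivative_const)
  from integral_curve_unique[OF this integral_curve_orbit, of "\<tau> * t"]
  have const: "v t = v (s / \<tau>)" for s using \<tau>_pos by simp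
  have "v 0 = v (1/2)" using const[of 0] const[of "\<tau> / 2"] \<tau>_pos by simp
  moreover have "inj_on v {0..<1}" using orbit by (simp add: simple_periodic_orbit_def)
  ultimately show False using inj_onD[of v "{0..<1}" 0 "1/2"] by simp
qed

lemma \<sigma>_tangent: "has_tangent_map A \<sigma> p" "tangent_map A \<sigma> p (X p) = X (\<sigma> p)"
  "\<omega> (\<sigma> p) (tangent_map A \<sigma> p \<xi>) (tangent_map A \<sigma> p \<eta>) = \<omega> p \<xi> \<eta>"
proof -
  note 1 = antisymplectic_field[OF \<rho>\<^sub>1] and 2 = antisymplectic_field[OF \<rho>\<^sub>2]
  note c = tangent_map_compose[OF 2(1) 1(1), of p]
  show "has_tangent_map A \<sigma> p" using c(1) by (simp add: \<sigma>_def)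
  have t: "tangent_map A \<sigma> p \<xi> = tangent_map A \<rho>\<^sub>1 (\<rho>\<^sub>2 p) (tangent_map A \<rho>\<^sub>2 p \<xi>)" for \<xi>
    using c(2) by (simp add: \<sigma>_def)
  show "tangent_map A \<sigma> p (X p) = X (\<sigma> p)"
    using linear_neg[OF linear_tangent_map[OF 1(1)]] by (simp add: t 1(2) 2(2)) (simp add: \<sigma>_def)
  show "\<omega> (\<sigma> p) (tangent_map A \<sigma> p \<xi>) (tangent_map A \<sigma> p \<eta>) = \<omega> p \<xi> \<eta>"
    using \<rho>\<^sub>1(1) \<rho>\<^sub>2(1) by (simp add: t antisymplectic_involution_def) (simp add: \<sigma>_def)
qed

lemma \<sigma>_\<sigma>: "\<sigma> (\<sigma> p) = p"
proof -
  have "\<rho>\<^sub>1 (\<rho>\<^sub>1 q) = q" "\<rho>\<^sub>2 (\<rho>\<^sub>2 q) = q" for q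
    using \<rho>\<^sub>1(1) \<rho>\<^sub>2(1) by (auto simp: antisymplectic_involution_def fun_eq_iff)
  moreover have "\<rho>\<^sub>1 (\<rho>\<^sub>2 q) = \<rho>\<^sub>2 (\<rho>\<^sub>1 q)" for q using commute by (simp add: fun_eq_iff)
  ultimately show ?thesis by (simp add: \<sigma>_def)
qed

text \<open>\<open>\<rho>\<^sub>2\<close> sends \<open>v 0\<close> to \<open>v (1/2)\<close>, and
  \<open>\<rho>\<^sub>1\<close> fixes that point because -1/2 and 1/2 agree modulo the period; then
  apply the involution \<sigma>.\<close>

lemma \<sigma>_orbit: "\<sigma> (v (1/2)) = v 0"
proof -
  have sym: "\<rho>\<^sub>1 (v (- t)) = v t" for t using symmetric by (simp add: doubly_symmetric_def symmetric_orbit_def)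
  have "\<sigma> (v 0) = \<rho>\<^sub>1 (v (1/2))" using symmetric by (simp add: \<sigma>_def doubly_symmetric_def)
  also have "\<dots> = v (- (1/2))" using sym[of "- (1/2)"] by simp
  also have "\<dots> = v (1/2)"
  proof -
    have "v (- (1/2) + 1) = v (- (1/2))" using orbit unfolding simple_periodic_orbit_def by blast
    then show ?thesis by simp
  qed
  finally show ?thesis using \<sigma>_\<sigma>[of "v 0"] by simp
qed

text \<open>The half-period return map composed with the symplectic symmetry \<open>\<sigma>\<close> is a square root of the
  full return map, so the monodromy is the square of a symplectic map.\<close>

definition "half_return = \<sigma> \<circ> flow (\<tau> / 2)"

definition "half_monodromy = tangent_map A half_return (v 0)"

lemma half_return_fixed: "flow (\<tau> / 2) (v 0) = v (1/2)" "half_return (v 0) = v 0"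
  using flow_orbit[of "1/2"] \<sigma>_orbit by (simp_all add: half_return_def)

lemma half_monodromy_symplectic:
  "has_tangent_map A half_return (v 0)" "linear half_monodromy" "half_monodromy (X (v 0)) = X (v 0)"
  "\<omega> (v 0) (half_monodromy \<xi>) (half_monodromy \<eta>) = \<omega> (v 0) \<xi> \<eta>"
proof -
  have r: "has_tangent_map A (flow (\<tau>/2)) (v 0)"
    "tangent_map A (flow (\<tau>/2)) (v 0) (X (v 0)) = X (v (1/2))"
    "\<And>\<xi> \<eta>. \<omega> (v (1/2)) (tangent_map A (flow (\<tau>/2)) (v 0) \<xi>) (tangent_map A (flow (\<tau>/2)) (v 0) \<eta>) = \<omega> (v 0) \<xi> \<eta>"
    using regular_flow_orbit[of "\<tau>/2"] by (auto simp: regular_flow_def half_return_fixed)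
  note c = tangent_map_compose[OF r(1) \<sigma>_tangent(1)]
  show h: "has_tangent_map A half_return (v 0)" using c(1) by (simp add: half_return_def)
  show "linear half_monodromy" unfolding half_monodromy_def by (rule linear_tangent_map[OF h])
  have t: "half_monodromy \<xi> = tangent_map A \<sigma> (v (1/2)) (tangent_map A (flow (\<tau>/2)) (v 0) \<xi>)" for \<xi>
    using c(2) by (simp add: half_monodromy_def half_return_def half_return_fixed(1))
  show "half_monodromy (X (v 0)) = X (v 0)" by (simp add: t r(2) \<sigma>_tangent(2) \<sigma>_orbit)
  show "\<omega> (v 0) (half_monodromy \<xi>) (half_monodromy \<eta>) = \<omega> (v 0) \<xi> \<eta>"
    using \<sigma>_tangent(3)[of "v (1/2)"] by (simp add: t r(3) \<sigma>_orbit)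
qed

text \<open>Equality of the return map with the square at the point \<open>v 0\<close> would not be
  enough; it is shown on a neighbourhood, so that the tangent maps agree.\<close>

lemma monodromy_eq_square: "monodromy A \<omega> H \<tau> v = half_monodromy \<circ> half_monodromy"
proof -
  obtain W where W: "open W" "v 0 \<in> W" "\<And>q. q \<in> W \<Longrightarrow> reaches (\<tau>/2) q (flow (\<tau>/2) q)"
    using regular_flow_orbit[of "\<tau>/2"] unfolding regular_flow_def by blast
  note h = half_monodromy_symplectic(1)
  obtain W' where W': "open W'" "v 0 \<in> W'" "half_return ` W' \<subseteq> W"
    using isCont_open_preimage[where f=half_return and p="v 0" and V=W] has_tangent_map_isCont[OF h] W(1,2)
      half_return_fixed(2) by metis
  have "(half_return \<circ> half_return) q = flow \<tau> q" if q: "q \<in> W \<inter> W'" for q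
  proof -
    have "reaches (\<tau>/2) (half_return q) (flow (\<tau>/2) (half_return q))" using W(3) W'(3) q by blast
    \<comment> \<open>\<sigma> carries the second half of the trajectory, which starts at
      \<open>half_return q\<close>, to one that starts at \<open>flow (\<tau> / 2) q\<close>; there
      it continues the first half.\<close>
    from reaches_image[OF \<sigma>_tangent(1,2) this]
    have "reaches (\<tau>/2) (flow (\<tau>/2) q) (half_return (half_return q))"
      by (simp add: half_return_def \<sigma>_\<sigma>)
    then have "reaches (\<tau>/2 + \<tau>/2) q (half_return (half_return q))"
      using reaches_trans[OF W(3)] q by blast
    then show ?thesis using flow_eq[of \<tau> q] by simp
  qed
  moreover have h': "has_tangent_map A half_return (half_return (v 0))" using h half_return_fixed(2) by simp
  moreover have "open (W \<inter> W')" "v 0 \<in> W \<inter> W'" using W W' by auto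
  ultimately have "tangent_map A (flow \<tau>) (v 0) = tangent_map A (half_return \<circ> half_return) (v 0)"
    using tangent_map_cong(2)[of "W \<inter> W'" "v 0" "half_return \<circ> half_return" "flow \<tau>"]
      tangent_map_compose(1)[OF h h'] by blast
  also have "\<dots> = half_monodromy \<circ> half_monodromy"
    using tangent_map_compose(2)[OF h h'] half_return_fixed(2) by (simp add: half_monodromy_def)
  finally show ?thesis by (simp add: monodromy_def)
qed

section \<open>The linearized path in a symplectic trivialization\<close>

context
  fixes F :: "real \<Rightarrow> real^4^2"
  assumes trivialization: "symplectic_trivialization A \<omega> H v F"
begin

abbreviation "\<Psi> \<equiv> linearized_path A \<omega> H \<tau> v F"

lemma adapted_F: "adapted_basis (\<omega> (v t)) (X (v t)) (F t)"
  using trivialization by (simp add: symplectic_trivialization_def reduced_symplectic_basis_iff)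

lemma tangent_flow_orbit:
  "\<omega> (v t) (tangent_map A (flow (\<tau> * t)) (v 0) \<xi>) (tangent_map A (flow (\<tau> * t)) (v 0) \<eta>) = \<omega> (v 0) \<xi> \<eta>"
  "tangent_map A (flow (\<tau> * t)) (v 0) (X (v 0)) = X (v t)"
  using regular_flow_orbit[of "\<tau> * t"] by (auto simp: regular_flow_def flow_orbit)

lemma tangent_flow_level:
  "\<omega> (v t) (tangent_map A (flow (\<tau> * t)) (v 0) (F 0 $ j)) (X (v t)) = 0"
  using tangent_flow_orbit(1)[of t "F 0 $ j" "X (v 0)"] adapted_F[of 0] exhaust_2[of j]
  by (auto simp: tangent_flow_orbit(2) adapted_basis_def)

text \<open>The pairings replace the definite description by formulas that can be continuous in
  \<open>t\<close>; the determinant is 1 because the flow preserves \<omega> and the frame at time 0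
  is symplectic.\<close>

lemma linearized_path_entries:
  "\<Psi> t $ 1 $ j = \<omega> (v t) (tangent_map A (flow (\<tau> * t)) (v 0) (F 0 $ j)) (F t $ 2)"
  "\<Psi> t $ 2 $ j = \<omega> (v t) (F t $ 1) (tangent_map A (flow (\<tau> * t)) (v 0) (F 0 $ j))"
  "det (\<Psi> t) = 1"
proof -
  interpret symplectic_vector_space4 "\<omega> (v t)" by (rule symplectic_at)
  show "\<Psi> t $ 1 $ j = \<omega> (v t) (tangent_map A (flow (\<tau> * t)) (v 0) (F 0 $ j)) (F t $ 2)"
    "\<Psi> t $ 2 $ j = \<omega> (v t) (F t $ 1) (tangent_map A (flow (\<tau> * t)) (v 0) (F 0 $ j))"
    unfolding linearized_path_def
    by (rule induced_matrix_properties(1,2)[where X="X (v t)" and e="F 0" and L="tangent_map A (flow (\<tau> * t)) (v 0)", OF adapted_F X_nonzero tangent_flow_level])+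
  have "det (\<Psi> t) = \<omega> (v 0) (F 0 $ 1) (F 0 $ 2)"
    unfolding linearized_path_def
    by (subst det_induced_matrix[where X="X (v t)" and e="F 0" and L="tangent_map A (flow (\<tau> * t)) (v 0)", OF adapted_F X_nonzero tangent_flow_level]) (rule tangent_flow_orbit(1))
  then show "det (\<Psi> t) = 1" using adapted_F[of 0] by (simp add: adapted_basis_def)
qed

lemma continuous_linearized_path: "continuous_on UNIV \<Psi>"
proof (rule continuous_on_matrix2)
  have entry: "continuous_on UNIV (\<lambda>t. \<omega> (v t) (tangent_map A (flow (\<tau> * t)) (v 0) \<xi>) (F t $ i))" for \<xi> i
  proof -
    have "continuous_on UNIV (\<lambda>s. \<omega> (v (s / \<tau>)) (tangent_map A (flow s) (v (0 / \<tau>)) \<xi>) (F (s / \<tau>) $ i))"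
    proof (rule continuous_form_along_flow[OF integral_curve_orbit])
      fix c assume "c \<in> A"
      then have "continuous_on {t. v t \<in> chart_dom c} (\<lambda>t. to_chart A c (v t) (F t $ i))"
        using trivialization by (simp add: symplectic_trivialization_def)
      then show "continuous_on {s. v (s / \<tau>) \<in> chart_dom c} (\<lambda>s. to_chart A c (v (s / \<tau>)) (F (s / \<tau>) $ i))"
        by (rule continuous_on_compose2) (use \<tau>_pos in \<open>auto intro!: continuous_intros\<close>)
    qed
    then have "continuous_on UNIV (\<lambda>t. \<omega> (v ((\<tau> * t) / \<tau>)) (tangent_map A (flow (\<tau> * t)) (v (0 / \<tau>)) \<xi>) (F ((\<tau> * t) / \<tau>) $ i))"
      by (rule continuous_on_compose2) (auto intro!: continuous_intros)
    then show ?thesis using \<tau>_pos by simp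
  qed
  fix i j :: 2
  show "continuous_on UNIV (\<lambda>t. \<Psi> t $ i $ j)"
  proof (cases "i = 1")
    case True
    then show ?thesis using entry by (simp add: linearized_path_entries)
  next
    case False
    then have "i = 2" using exhaust_2 by blast
    \<comment> \<open>\<open>entry\<close> has the transported vector in the first slot, so the
      second row is turned around by antisymmetry.\<close>
    moreover have "\<Psi> t $ 2 $ j = - \<omega> (v t) (tangent_map A (flow (\<tau> * t)) (v 0) (F 0 $ j)) (F t $ 1)" for t
      unfolding linearized_path_entries(2) by (rule antisym_\<omega>)
    ultimately show ?thesis using entry by (auto intro: continuous_on_minus)
  qed
qed

lemma linearized_path_0: "\<Psi> 0 = mat 1"
proof -
  interpret symplectic_vector_space4 "\<omega> (v 0)" by (rule symplectic_at)
  have "tangent_map A (flow 0) (v 0) = id" by (simp add: flow_0 tangent_map_id)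
  then show ?thesis
    using adapted_F[of 0] linearized_path_entries(1,2)[of 0]
    by (simp add: vec_eq_iff forall_2 mat_def adapted_basis_def alternating)
qed

text \<open>Orbit and frame both have period one, so the path ends at the reduced monodromy in a
  single basis.\<close>

lemma linearized_path_1: "\<Psi> 1 = induced_matrix (monodromy A \<omega> H \<tau> v) (span {X (v 0)}) (F 0) (F 0)"
proof -
  have "F 1 = F 0" using trivialization unfolding symplectic_trivialization_def by (metis add_0)
  then show ?thesis by (simp add: linearized_path_def monodromy_def v_1)
qed

lemma monodromy_symplectic:
  "linear (monodromy A \<omega> H \<tau> v)" "monodromy A \<omega> H \<tau> v (X (v 0)) = X (v 0)"
  "\<omega> (v 0) (monodromy A \<omega> H \<tau> v \<xi>) (monodromy A \<omega> H \<tau> v \<eta>) = \<omega> (v 0) \<xi> \<eta>"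
  using half_monodromy_symplectic
  by (auto simp: monodromy_eq_square intro: linear_compose)

text \<open>Independence of the basis gives one value for all bases; that this value is the only
  candidate requires some basis to exist, and \<open>F 0\<close> is one.\<close>

lemma reduced_trace_eq: "reduced_trace A \<omega> H \<tau> v = trace (\<Psi> 1)"
  unfolding reduced_trace_def reduced_symplectic_basis_iff
proof (rule the_equality)
  interpret symplectic_vector_space4 "\<omega> (v 0)" by (rule symplectic_at)
  show "\<forall>e. adapted_basis (\<omega> (v 0)) (X (v 0)) e \<longrightarrow>
      trace (induced_matrix (monodromy A \<omega> H \<tau> v) (span {X (v 0)}) e e) = trace (\<Psi> 1)"
    unfolding linearized_path_1
    using trace_induced_matrix_basis_independent[OF adapted_F[of 0] _ X_nonzero monodromy_symplectic] by blast
qed (use adapted_F[of 0] linearized_path_1 in auto)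

lemma trace_linearized_path_1_ge: "trace (\<Psi> 1) \<ge> - 2"
proof -
  interpret symplectic_vector_space4 "\<omega> (v 0)" by (rule symplectic_at)
  let ?B = "induced_matrix half_monodromy (span {X (v 0)}) (F 0) (F 0)"
  note N = half_monodromy_symplectic(2-4)
  have "\<omega> (v 0) (half_monodromy (F 0 $ j)) (X (v 0)) = 0" for j
    using N(3)[of "F 0 $ j" "X (v 0)"] adapted_F[of 0] exhaust_2[of j] by (auto simp: N(2) adapted_basis_def)
  then have "det ?B = 1"
    using det_induced_matrix[of "X (v 0)" "F 0" half_monodromy "F 0"] adapted_F[of 0] X_nonzero N(3)
    by (simp add: adapted_basis_def)
  moreover have "\<Psi> 1 = ?B ** ?B"
    unfolding linearized_path_1 monodromy_eq_square
    by (rule induced_matrix_square[OF adapted_F X_nonzero N])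
  ultimately show ?thesis by (simp add: trace_square_matrix2)
qed

text \<open>For determinant 1, \<open>det (mat 1 - B)\<close> is 2 minus the trace, so trace 2
  yields a vector fixed modulo the line of the field.\<close>

lemma trace_linearized_path_1_ne:
  assumes "nondegenerate A \<omega> H \<tau> v" shows "trace (\<Psi> 1) \<noteq> 2"
proof
  interpret symplectic_vector_space4 "\<omega> (v 0)" by (rule symplectic_at)
  let ?M = "monodromy A \<omega> H \<tau> v"
  assume "trace (\<Psi> 1) = 2"
  then have "det (mat 1 - induced_matrix ?M (span {X (v 0)}) (F 0) (F 0)) = 0"
    using linearized_path_entries(3)[of 1] by (simp add: det_one_minus_matrix2 flip: linearized_path_1)
  moreover have "\<omega> (v 0) (?M (F 0 $ j)) (X (v 0)) = 0" for j
    using tangent_flow_level[of 1 j] by (simp add: monodromy_def v_1)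
  ultimately obtain \<xi> where "\<omega> (v 0) \<xi> (X (v 0)) = 0" "\<xi> \<notin> span {X (v 0)}" "?M \<xi> - \<xi> \<in> span {X (v 0)}"
    using unit_eigenvector_of_induced_matrix[of "X (v 0)" "F 0" ?M] adapted_F X_nonzero monodromy_symplectic(1)
    by blast
  then show False using assms by (auto simp: nondegenerate_def level_tangent_iff)
qed

text \<open>The lower bound -2 always holds and nondegeneracy excludes trace 2, so being elliptic
  amounts to trace below 2, the condition in the parity criterion.\<close>

theorem elliptic_iff_odd_index:
  assumes "nondegenerate A \<omega> H \<tau> v"
  shows "elliptic A \<omega> H \<tau> v \<longleftrightarrow> odd (orbit_CZ_index A \<omega> H \<tau> v F)"
proof -
  have "odd (CZ_index \<Psi>) \<longleftrightarrow> trace (\<Psi> 1) < 2"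
    using continuous_linearized_path linearized_path_entries(3) linearized_path_0 trace_linearized_path_1_ne[OF assms]
    by (intro odd_CZ_index_iff) (auto intro: continuous_on_subset)
  then show ?thesis
    using trace_linearized_path_1_ge trace_linearized_path_1_ne[OF assms]
    by (auto simp: elliptic_def reduced_trace_eq orbit_CZ_index_def)
qed

end

end

theorem corollaryB:
  fixes A :: "'a::{t2_space,second_countable_topology} chart set"
    and \<omega> :: "'a two_form"
    and \<rho>\<^sub>1 \<rho>\<^sub>2 :: "'a \<Rightarrow> 'a"
    and H :: "'a \<Rightarrow> real"
    and v :: "real \<Rightarrow> 'a"
    and \<tau> :: real
    and F :: "real \<Rightarrow> real^4^2"
  assumes "symplectic_manifold A \<omega>"
    and "antisymplectic_involution A \<omega> \<rho>\<^sub>1"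
    and "antisymplectic_involution A \<omega> \<rho>\<^sub>2"
    and "\<rho>\<^sub>1 \<noteq> \<rho>\<^sub>2"
    and "\<rho>\<^sub>1 \<circ> \<rho>\<^sub>2 = \<rho>\<^sub>2 \<circ> \<rho>\<^sub>1"
    and "smooth_function A H"
    and "H \<circ> \<rho>\<^sub>1 = H"
    and "H \<circ> \<rho>\<^sub>2 = H"
    and "simple_periodic_orbit A \<omega> H \<tau> v"
    and "doubly_symmetric \<rho>\<^sub>1 \<rho>\<^sub>2 v"
    and "nondegenerate A \<omega> H \<tau> v"
    and "symplectic_trivialization A \<omega> H v F"
  shows "stable A \<omega> H \<tau> v \<longleftrightarrow> odd (orbit_CZ_index A \<omega> H \<tau> v F)"
proof -
  interpret doubly_symmetric_orbit A \<omega> H \<rho>\<^sub>1 \<rho>\<^sub>2 v \<tau>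
    using assms by unfold_locales (auto simp: symplectic_manifold_def)
  show ?thesis by (rule elliptic_iff_odd_index[OF assms(12,11)])
qed

end
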